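(* Let $Q$ be a symmetric quiver. There is an isomorphism of ($L\times\mathbb Z$-)graded vector spaces $F:\mathcal P_Q^\vee\to\mathcal H_Q$. Specifically, for any dimension vector $\mathbf d\in\mathbb N^I$, the isomorphism $\mathcal P_{Q,\mathbf d}^\vee\to\mathcal H_{Q,\mathbf d}=\Lambda_{\mathbf d}[-\chi(\mathbf d,\mathbf d)]$ is given by $$\xi\mapsto F_\xi=\prod_{k<l}(z_k-z_l)^{\mathcal N(i_k,i_l)}\cdot\langle\xi,\,Y(i_1,z_1)Y(i_2,z_2)\cdots Y(i_p,z_p)\mathbf 1\rangle\Big|_{z_{\mathbf d_1+\dots+\mathbf d_{j-1}+k}=x_{j,k}},$$ where $p=\sum_{i\in I}\mathbf d_i$, the set $I$ is identified with $\{1,\dots,r\}$ by a choice of order, and $i_{\mathbf d_1+\dots+\mathbf d_{j-1}+k}=j$ for $j\in I$, $1\le k\le\mathbf d_j$.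
   Context: The ground field is $\mathbb Q$. $Q$ is a finite quiver with vertex set $I$ which is symmetric (as many arrows $i\to j$ as $j\to i$). $L=\mathbb Z^I$ has standard basis $(e_i)$ and Euler form $\chi(\mathbf d,\mathbf e)=\sum_i\mathbf d_i\mathbf e_i-\sum_{a:i\to j}\mathbf d_i\mathbf e_j$. $L$-graded vector spaces have braiding $a\otimes b\mapsto(-1)^{\chi(\alpha,\beta)}b\otimes a$ for $a,b$ of $L$-degrees $\alpha,\beta$; Lie algebras and enveloping algebras are taken in this symmetric monoidal category (e.g. $[a,b]=ab-(-1)^{\chi(\alpha,\beta)}ba$ in an associative algebra). Shifts: $M[k]^n=M^{n+k}$. $\mathcal N(i,j)=-\chi(e_i,e_j)$, $\mathcal N_+=\max(\mathcal N,0)$. $\mathfrak L$ is the Lie algebra generated by symbols $i(n)$ ($i\in I$, $n\in\mathbb Z$) of $L$-degree $e_i$ and weight $\frac12\chi(e_i,e_i)-n-1$, with relations $\sum_{k=0}^N(-1)^k\binom Nk[i(m-k),j(n+k)]=0$, $N=\mathcal N_+(i,j)$, for all $i,j\in I$, $m,n\in\mathbb Z$. The principal free vertex algebra is (as a $U(\mathfrak L)$-module) $\mathcal P_Q=U(\mathfrak L)/U(\mathfrak L)\{i(n):i\in I,n\ge0\}$ with cyclic vector (vacuum) $\mathbf 1$, and $Y(i,z)=\sum_{n\in\mathbb Z}i(n)z^{-n-1}$ acting on $\mathcal P_Q$. (Equivalently, it is the vertex subalgebra of the lattice vertex algebra $V_L$ generated by the vectors $|e_i\rangle$, with $i\mapsto|e_i\rangle$.)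 The vacuum has $L$-degree and weight $0$, and the cohomological degree of $u\in\mathcal P_Q$ is $-2\,\mathrm{wt}(u)\in\mathbb Z$; so $\mathcal P_Q=\bigoplus_{\mathbf d\in\mathbb N^I,n\in\mathbb Z}\mathcal P_{Q,\mathbf d}^n$ with finite-dimensional components. The graded dual is $\mathcal P_Q^\vee=\bigoplus_{\mathbf d}\mathcal P_{Q,\mathbf d}^\vee$, $\mathcal P_{Q,\mathbf d}^\vee=\bigoplus_n(\mathcal P_{Q,\mathbf d}^{-n})^\vee$ (the summand with index $n$ in degree $n$). The underlying graded space of the cohomological Hall algebra is $\mathcal H_Q=\bigoplus_{\mathbf d\in\mathbb N^I}\mathcal H_{Q,\mathbf d}$, $\mathcal H_{Q,\mathbf d}=\Lambda_{\mathbf d}[-\chi(\mathbf d,\mathbf d)]$, with $\Lambda_{\mathbf d}=\mathbb Q[x_{i,k}:i\in I,1\le k\le\mathbf d_i]^{\Sigma_{\mathbf d}}$, $\Sigma_{\mathbf d}=\prod_i\Sigma_{\mathbf d_i}$, $\deg x_{i,k}=2$. Negative powers of $z_k-z_l$ ($k<l$) are expanded as series in non-negative powers of $z_l$, so that the displayed expression is a priori an element of $\mathbb Q((z_1))\cdots((z_p))$. *)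

theory Defs
  imports
    Complex_Main
    "HOL-Library.Poly_Mapping"
    "HOL-Combinatorics.Permutations"
    "Graph_Theory.Digraph"
begin

section \<open>Symmetric quivers\<close>

text \<open>
  A quiver is a finite multi-digraph, loops and parallel arrows allowed; an arrow \<open>a\<close> goes from
  \<open>tail Q a\<close> to \<open>head Q a\<close>.  The vertex set \<open>I\<close> is the whole (finite) type \<open>'i\<close>, so that
  \<open>L\<close> is \<open>'i \<Rightarrow> int\<close> and dimension vectors are functions \<open>'i \<Rightarrow> nat\<close>.
\<close>

definition symmetric_quiver :: "('i::finite, 'a) pre_digraph \<Rightarrow> bool" where
  "symmetric_quiver Q \<longleftrightarrow> fin_digraph Q \<and> verts Q = UNIV \<and>
     (\<forall>i j. card {a \<in> arcs Q. tail Q a = i \<and> head Q a = j}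
          = card {a \<in> arcs Q. tail Q a = j \<and> head Q a = i})"

definition basis_vec :: "'i \<Rightarrow> 'i \<Rightarrow> int" where
  "basis_vec i = (\<lambda>j. if j = i then 1 else 0)"

definition euler :: "('i::finite, 'a) pre_digraph \<Rightarrow> ('i \<Rightarrow> int) \<Rightarrow> ('i \<Rightarrow> int) \<Rightarrow> int" where
  "euler Q d e = (\<Sum>i\<in>UNIV. d i * e i) - (\<Sum>a\<in>arcs Q. d (tail Q a) * e (head Q a))"

definition locality :: "('i::finite, 'a) pre_digraph \<Rightarrow> 'i \<Rightarrow> 'i \<Rightarrow> int" where
  "locality Q i j = - euler Q (basis_vec i) (basis_vec j)"

definition locality_pos :: "('i::finite, 'a) pre_digraph \<Rightarrow> 'i \<Rightarrow> 'i \<Rightarrow> nat" where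
  "locality_pos Q i j = nat (max (locality Q i j) 0)"

definition braid_sign :: "('i::finite, 'a) pre_digraph \<Rightarrow> ('i \<Rightarrow> int) \<Rightarrow> ('i \<Rightarrow> int) \<Rightarrow> rat" where
  "braid_sign Q \<alpha> \<beta> = (-1) powi (euler Q \<alpha> \<beta>)"


section \<open>Linear algebra with finitely supported functions\<close>

text \<open>\<open>'x \<Rightarrow>\<^sub>0 rat\<close> is the rational vector space with basis \<open>'x\<close>.\<close>

abbreviation lookup :: "('x \<Rightarrow>\<^sub>0 'b::zero) \<Rightarrow> 'x \<Rightarrow> 'b" where
  "lookup \<equiv> Poly_Mapping.lookup"

abbreviation keys :: "('x \<Rightarrow>\<^sub>0 'b::zero) \<Rightarrow> 'x set" where
  "keys \<equiv> Poly_Mapping.keys"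

abbreviation single :: "'x \<Rightarrow> 'b \<Rightarrow> 'x \<Rightarrow>\<^sub>0 'b::zero" where
  "single \<equiv> Poly_Mapping.single"

definition scale :: "rat \<Rightarrow> ('x \<Rightarrow>\<^sub>0 rat) \<Rightarrow> ('x \<Rightarrow>\<^sub>0 rat)" where
  "scale c f = Poly_Mapping.map (\<lambda>r. c * r) f"

definition is_subspace :: "('x \<Rightarrow>\<^sub>0 rat) set \<Rightarrow> bool" where
  "is_subspace W \<longleftrightarrow> 0 \<in> W \<and> (\<forall>f\<in>W. \<forall>g\<in>W. f + g \<in> W) \<and> (\<forall>c. \<forall>f\<in>W. scale c f \<in> W)"

definition coset :: "'v::ab_group_add set \<Rightarrow> 'v \<Rightarrow> 'v set" where
  "coset W u = {v. u - v \<in> W}"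


section \<open>The Lie algebra \<open>\<LL>\<close>\<close>

datatype 'g lie_word = Gen 'g | Br "'g lie_word" "'g lie_word"

type_synonym 'i gen = "'i \<times> int"  \<comment> \<open>\<open>(i, n)\<close> is the symbol \<open>i(n)\<close>\<close>

text \<open>The free non-associative algebra on the generators; \<open>bracket\<close> is its bilinear product.\<close>

type_synonym 'i pre_lie = "'i gen lie_word \<Rightarrow>\<^sub>0 rat"

definition bracket :: "'i pre_lie \<Rightarrow> 'i pre_lie \<Rightarrow> 'i pre_lie" where
  "bracket f g = (\<Sum>u\<in>keys f. \<Sum>v\<in>keys g. single (Br u v) (lookup f u * lookup g v))"

primrec lie_degree :: "'i gen lie_word \<Rightarrow> 'i \<Rightarrow> int" where
  "lie_degree (Gen x) = basis_vec (fst x)"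
| "lie_degree (Br u v) = (\<lambda>i. lie_degree u i + lie_degree v i)"

primrec lie_weight :: "('i::finite, 'a) pre_digraph \<Rightarrow> 'i gen lie_word \<Rightarrow> rat" where
  "lie_weight Q (Gen x) =
     of_int (euler Q (basis_vec (fst x)) (basis_vec (fst x))) / 2 - of_int (snd x) - 1"
| "lie_weight Q (Br u v) = lie_weight Q u + lie_weight Q v"

text \<open>
  Antisymmetry and the Jacobi identity in the category of \<open>L\<close>-graded spaces with the braiding
  \<open>braid_sign\<close>.  Being multilinear, they are only needed on the (homogeneous) basis.
\<close>

definition antisymmetry_relations :: "('i::finite, 'a) pre_digraph \<Rightarrow> 'i pre_lie set" where
  "antisymmetry_relations Q =
     {single (Br u v) 1 + single (Br v u) (braid_sign Q (lie_degree u) (lie_degree v)) | u v. True}"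

definition jacobi_relations :: "('i::finite, 'a) pre_digraph \<Rightarrow> 'i pre_lie set" where
  "jacobi_relations Q =
     {single (Br u (Br v w)) 1 - single (Br (Br u v) w) 1
        - single (Br v (Br u w)) (braid_sign Q (lie_degree u) (lie_degree v)) | u v w. True}"

definition locality_relations :: "('i::finite, 'a) pre_digraph \<Rightarrow> 'i pre_lie set" where
  "locality_relations Q =
     {(\<Sum>k=0..locality_pos Q i j.
         single (Br (Gen (i, m - int k)) (Gen (j, n + int k)))
           ((-1) ^ k * of_nat (locality_pos Q i j choose k))) | i j m n. True}"

definition is_lie_ideal :: "'i pre_lie set \<Rightarrow> bool" where
  "is_lie_ideal R \<longleftrightarrow> is_subspace R \<and> (\<forall>f\<in>R. \<forall>g. bracket f g \<in> R \<and> bracket g f \<in> R)"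

text \<open>\<open>\<LL>\<close> is the quotient of the free non-associative algebra by this ideal.\<close>

definition lie_relations :: "('i::finite, 'a) pre_digraph \<Rightarrow> 'i pre_lie set" where
  "lie_relations Q =
     is_lie_ideal hull (antisymmetry_relations Q \<union> jacobi_relations Q \<union> locality_relations Q)"


section \<open>The enveloping algebra \<open>U(\<LL>)\<close>\<close>

datatype 'x tensor_word = Word (letters: "'x list")

instantiation tensor_word :: (type) monoid_add
begin

definition zero_tensor_word :: "'a tensor_word" where
  "0 = Word []"

definition plus_tensor_word :: "'a tensor_word \<Rightarrow> 'a tensor_word \<Rightarrow> 'a tensor_word" where
  "v + w = Word (letters v @ letters w)"

instance
  by standard (simp_all add: zero_tensor_word_def plus_tensor_word_def)

end

text \<open>
  The tensor algebra \<open>T(V)\<close> of the free non-associative algebra \<open>V\<close>, i.e. the monoid algebra of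
  words in the basis of \<open>V\<close>; multiplication is the convolution product of \<open>Poly_Mapping\<close>.
\<close>

type_synonym 'i tensor_alg = "'i gen lie_word tensor_word \<Rightarrow>\<^sub>0 rat"

definition letter :: "'i gen lie_word \<Rightarrow> 'i tensor_alg" where
  "letter u = single (Word [u]) 1"

definition incl :: "'i pre_lie \<Rightarrow> 'i tensor_alg" where
  "incl f = (\<Sum>u\<in>keys f. scale (lookup f u) (letter u))"

definition is_ideal :: "'r::ring_1 set \<Rightarrow> bool" where
  "is_ideal J \<longleftrightarrow> 0 \<in> J \<and> (\<forall>a\<in>J. \<forall>b\<in>J. a + b \<in> J) \<and> (\<forall>a\<in>J. \<forall>x. x * a \<in> J \<and> a * x \<in> J)"

definition is_left_ideal :: "'r::ring_1 set \<Rightarrow> bool" where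
  "is_left_ideal J \<longleftrightarrow> 0 \<in> J \<and> (\<forall>a\<in>J. \<forall>b\<in>J. a + b \<in> J) \<and> (\<forall>a\<in>J. \<forall>x. x * a \<in> J)"

text \<open>
  With \<open>R = lie_relations Q\<close> we have \<open>\<LL> = V / R\<close> and \<open>T(\<LL>) = T(V) / (R)\<close>.  Hence
  \<open>U(\<LL>) = T(\<LL>) / (a b - (-1)\<^sup>\<chi>\<^sup>(\<^sup>\<alpha>\<^sup>,\<^sup>\<beta>\<^sup>) b a - [a, b])\<close> is \<open>T(V) / enveloping_ideal Q\<close>.
\<close>

definition enveloping_ideal :: "('i::finite, 'a) pre_digraph \<Rightarrow> 'i tensor_alg set" where
  "enveloping_ideal Q = is_ideal hull
     (incl ` lie_relations Q \<union>
      {letter u * letter v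
         - scale (braid_sign Q (lie_degree u) (lie_degree v)) (letter v * letter u)
         - letter (Br u v) | u v. True})"


section \<open>The principal free vertex algebra\<close>

text \<open>
  The preimage in \<open>T(V)\<close> of the left ideal of \<open>U(\<LL>)\<close> generated by the \<open>i(n)\<close>, \<open>n \<ge> 0\<close>.  So
  \<open>T(V) / vacuum_ideal Q\<close> is the \<open>U(\<LL>)\<close>-module \<open>P\<^sub>Q\<close>, with elements the cosets \<open>pcls Q u\<close>.
\<close>

definition vacuum_ideal :: "('i::finite, 'a) pre_digraph \<Rightarrow> 'i tensor_alg set" where
  "vacuum_ideal Q = is_left_ideal hull
     (enveloping_ideal Q \<union> {letter (Gen (i, n)) | i n. n \<ge> 0})"

definition pcls :: "('i::finite, 'a) pre_digraph \<Rightarrow> 'i tensor_alg \<Rightarrow> 'i tensor_alg set" where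
  "pcls Q u = coset (vacuum_ideal Q) u"

definition principal :: "('i::finite, 'a) pre_digraph \<Rightarrow> 'i tensor_alg set set" where
  "principal Q = range (pcls Q)"

definition vacuum :: "('i::finite, 'a) pre_digraph \<Rightarrow> 'i tensor_alg set" where
  "vacuum Q = pcls Q 1"

text \<open>The action of \<open>i(n)\<close> on \<open>P\<^sub>Q\<close>; the union is over the representatives of the class \<open>X\<close>.\<close>

definition gen_action ::
  "('i::finite, 'a) pre_digraph \<Rightarrow> 'i \<Rightarrow> int \<Rightarrow> 'i tensor_alg set \<Rightarrow> 'i tensor_alg set" where
  "gen_action Q i n X = (\<Union>u\<in>X. pcls Q (letter (Gen (i, n)) * u))"

text \<open>\<open>field_coeff Q i e\<close> is the coefficient of \<open>z\<^sup>e\<close> in \<open>Y(i,z) = \<Sum>\<^sub>n i(n) z\<^sup>-\<^sup>n\<^sup>-\<^sup>1\<close>.\<close>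

definition field_coeff ::
  "('i::finite, 'a) pre_digraph \<Rightarrow> 'i \<Rightarrow> int \<Rightarrow> 'i tensor_alg set \<Rightarrow> 'i tensor_alg set" where
  "field_coeff Q i e = gen_action Q i (- e - 1)"

definition word_degree :: "'i gen lie_word tensor_word \<Rightarrow> 'i \<Rightarrow> int" where
  "word_degree w = (\<lambda>i. \<Sum>u\<leftarrow>letters w. lie_degree u i)"

definition word_weight :: "('i::finite, 'a) pre_digraph \<Rightarrow> 'i gen lie_word tensor_word \<Rightarrow> rat" where
  "word_weight Q w = (\<Sum>u\<leftarrow>letters w. lie_weight Q u)"

text \<open>\<open>P\<^sub>Q\<^sub>,\<^sub>d\<^sup>n\<close>: \<open>L\<close>-degree \<open>d\<close> and cohomological degree \<open>n = -2 wt\<close>.\<close>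

definition principal_comp ::
  "('i::finite, 'a) pre_digraph \<Rightarrow> ('i \<Rightarrow> nat) \<Rightarrow> int \<Rightarrow> 'i tensor_alg set set" where
  "principal_comp Q d n = pcls Q `
     {u. \<forall>w\<in>keys u. word_degree w = (\<lambda>i. int (d i)) \<and> of_int n = - 2 * word_weight Q w}"


section \<open>The graded dual\<close>

text \<open>Linear functionals on \<open>P\<^sub>Q\<close>, extended by \<open>0\<close> to sets that are not elements of \<open>P\<^sub>Q\<close>.\<close>

definition functionals :: "('i::finite, 'a) pre_digraph \<Rightarrow> ('i tensor_alg set \<Rightarrow> rat) set" where
  "functionals Q = {\<xi>.
     (\<forall>u v. \<xi> (pcls Q (u + v)) = \<xi> (pcls Q u) + \<xi> (pcls Q v)) \<and>
     (\<forall>c u. \<xi> (pcls Q (scale c u)) = c * \<xi> (pcls Q u)) \<and>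
     (\<forall>X. X \<notin> principal Q \<longrightarrow> \<xi> X = 0)}"

text \<open>
  A functional on a homogeneous component is identified with its extension by \<open>0\<close> to the other
  components.  The graded dual then consists of the functionals supported on finitely many
  components, and \<open>dual_comp Q d n\<close> is \<open>(P\<^sub>Q\<^sub>,\<^sub>d\<^sup>-\<^sup>n)\<^sup>\<or>\<close>, sitting in degree \<open>n\<close>.
\<close>

definition dual_support ::
  "('i::finite, 'a) pre_digraph \<Rightarrow> ('i tensor_alg set \<Rightarrow> rat) \<Rightarrow> (('i \<Rightarrow> nat) \<times> int) set" where
  "dual_support Q \<xi> = {(d, n). \<exists>X\<in>principal_comp Q d (- n). \<xi> X \<noteq> 0}"

definition graded_dual :: "('i::finite, 'a) pre_digraph \<Rightarrow> ('i tensor_alg set \<Rightarrow> rat) set" where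
  "graded_dual Q = {\<xi> \<in> functionals Q. finite (dual_support Q \<xi>)}"

definition dual_at ::
  "('i::finite, 'a) pre_digraph \<Rightarrow> ('i \<Rightarrow> nat) \<Rightarrow> ('i tensor_alg set \<Rightarrow> rat) set" where
  "dual_at Q d = {\<xi> \<in> graded_dual Q. dual_support Q \<xi> \<subseteq> {d} \<times> UNIV}"

definition dual_comp ::
  "('i::finite, 'a) pre_digraph \<Rightarrow> ('i \<Rightarrow> nat) \<Rightarrow> int \<Rightarrow> ('i tensor_alg set \<Rightarrow> rat) set" where
  "dual_comp Q d n = {\<xi> \<in> graded_dual Q. dual_support Q \<xi> \<subseteq> {(d, n)}}"


section \<open>The underlying graded space of the cohomological Hall algebra\<close>

text \<open>
  Polynomials in the variables \<open>x\<^bsub>i,k\<^esub>\<close>; a monomial is its exponent function.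
  The variable \<open>(i, k)\<close> is used for \<open>1 \<le> k \<le> d i\<close> only.
\<close>

type_synonym 'i xpoly = "(('i \<times> nat) \<Rightarrow>\<^sub>0 nat) \<Rightarrow>\<^sub>0 rat"

definition vars :: "('i \<Rightarrow> nat) \<Rightarrow> ('i \<times> nat) set" where
  "vars d = {(i, k). 1 \<le> k \<and> k \<le> d i}"

definition sym_polys :: "('i \<Rightarrow> nat) \<Rightarrow> 'i xpoly set" where
  "sym_polys d = {f. (\<forall>m\<in>keys f. keys m \<subseteq> vars d) \<and>
     (\<forall>\<sigma>. (\<forall>i. \<sigma> i permutes {1..d i}) \<longrightarrow>
        (\<forall>m. lookup f (Poly_Mapping.map_key (\<lambda>(i, k). (i, \<sigma> i k)) m) = lookup f m))}"

definition mono_degree :: "('v \<Rightarrow>\<^sub>0 nat) \<Rightarrow> nat" where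
  "mono_degree m = (\<Sum>v\<in>keys m. lookup m v)"

text \<open>The degree \<open>n\<close> part of \<open>\<Lambda>\<^sub>d[-\<chi>(d,d)]\<close> is the degree \<open>n - \<chi>(d,d)\<close> part of \<open>\<Lambda>\<^sub>d\<close>, where \<open>deg x\<^bsub>i,k\<^esub> = 2\<close>.\<close>

definition coha_comp :: "('i::finite, 'a) pre_digraph \<Rightarrow> ('i \<Rightarrow> nat) \<Rightarrow> int \<Rightarrow> 'i xpoly set" where
  "coha_comp Q d n = {f \<in> sym_polys d. \<forall>m\<in>keys f.
     2 * int (mono_degree m) = n - euler Q (\<lambda>i. int (d i)) (\<lambda>i. int (d i))}"

text \<open>The direct sum of the \<open>\<Lambda>\<^sub>d\<close>, as finitely supported families.\<close>

type_synonym 'i coha = "('i \<Rightarrow> nat) \<Rightarrow>\<^sub>0 'i xpoly"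

definition coha :: "'i coha set" where
  "coha = {h. \<forall>d. lookup h d \<in> sym_polys d}"

definition coha_scale :: "rat \<Rightarrow> 'i coha \<Rightarrow> 'i coha" where
  "coha_scale c h = Poly_Mapping.map (scale c) h"

definition graded_iso ::
  "('i::finite, 'a) pre_digraph \<Rightarrow> (('i tensor_alg set \<Rightarrow> rat) \<Rightarrow> 'i coha) \<Rightarrow> bool" where
  "graded_iso Q F \<longleftrightarrow>
     (\<forall>\<xi>\<in>graded_dual Q. \<forall>\<eta>\<in>graded_dual Q. F (\<lambda>X. \<xi> X + \<eta> X) = F \<xi> + F \<eta>) \<and>
     (\<forall>c. \<forall>\<xi>\<in>graded_dual Q. F (\<lambda>X. c * \<xi> X) = coha_scale c (F \<xi>)) \<and>
     bij_betw F (graded_dual Q) coha \<and>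
     (\<forall>d n. F ` dual_comp Q d n = single d ` coha_comp Q d n)"


section \<open>Iterated Laurent series\<close>

text \<open>
  A formal series in \<open>z\<^sub>0, \<dots>, z\<^sub>p\<^sub>-\<^sub>1\<close> (indexing from \<open>0\<close>) is the function sending an exponent vector
  to the coefficient.  \<open>iter_laurent p\<close> is the field \<open>\<rat>((z\<^sub>0))\<dots>((z\<^sub>p\<^sub>-\<^sub>1))\<close>: Laurent series in the
  last variable with coefficients that are iterated Laurent series in the others.
\<close>

type_synonym zseries = "(nat \<Rightarrow>\<^sub>0 int) \<Rightarrow> rat"

primrec iter_laurent :: "nat \<Rightarrow> zseries set" where
  "iter_laurent 0 = {f. \<forall>e. e \<noteq> 0 \<longrightarrow> f e = 0}"
| "iter_laurent (Suc p) = {f.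
     (\<exists>b. \<forall>e. lookup e p < b \<longrightarrow> f e = 0) \<and>
     (\<forall>n. (\<lambda>e. if lookup e p = 0 then f (e + single p n) else 0) \<in> iter_laurent p)}"

text \<open>The product; on \<open>iter_laurent p\<close> the sum below always has finitely many terms.\<close>

definition series_mult :: "zseries \<Rightarrow> zseries \<Rightarrow> zseries" where
  "series_mult f g = (\<lambda>e. \<Sum>a | f a \<noteq> 0 \<and> g (e - a) \<noteq> 0. f a * g (e - a))"

text \<open>
  For \<open>k \<noteq> l\<close>, the expansion
  \<open>(z\<^sub>k - z\<^sub>l)\<^sup>N = \<Sum>\<^sub>m\<^sub>\<ge>\<^sub>0 (-1)\<^sup>m (N choose m) z\<^sub>k\<^sup>N\<^sup>-\<^sup>m z\<^sub>l\<^sup>m\<close> in non-negative powers of \<open>z\<^sub>l\<close>.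
\<close>

definition diff_power :: "nat \<Rightarrow> nat \<Rightarrow> int \<Rightarrow> zseries" where
  "diff_power k l N = (\<lambda>e. let m = lookup e l in
     if m \<ge> 0 \<and> e = single k (N - m) + single l m
     then (-1) ^ nat m * (of_int N gchoose nat m) else 0)"


section \<open>The series \<open>F\<^sub>\<xi>\<close>\<close>

text \<open>
  For an enumeration \<open>vs\<close> of the vertices, \<open>positions vs d\<close> lists the variables
  \<open>x\<^bsub>j,1\<^esub>, \<dots>, x\<^bsub>j,d j\<^esub>\<close> for \<open>j\<close> running through \<open>vs\<close>.  Its \<open>k\<close>-th entry is the variable that is
  substituted for \<open>z\<^sub>k\<close>, and the first component of this entry is \<open>i\<^sub>k\<close>.
\<close>

definition positions :: "'i list \<Rightarrow> ('i \<Rightarrow> nat) \<Rightarrow> ('i \<times> nat) list" where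
  "positions vs d = concat (map (\<lambda>j. map (\<lambda>k. (j, k)) [1..<Suc (d j)]) vs)"

definition num_vars :: "('i::finite \<Rightarrow> nat) \<Rightarrow> nat" where
  "num_vars d = (\<Sum>i\<in>UNIV. d i)"

definition vertex_at :: "'i list \<Rightarrow> ('i \<Rightarrow> nat) \<Rightarrow> nat \<Rightarrow> 'i" where
  "vertex_at vs d k = fst (positions vs d ! k)"

text \<open>The matrix coefficient \<open>\<langle>\<xi>, Y(i\<^sub>0, z\<^sub>0) \<dots> Y(i\<^sub>p\<^sub>-\<^sub>1, z\<^sub>p\<^sub>-\<^sub>1) \<one>\<rangle>\<close>.\<close>

definition correlation ::
  "('i::finite, 'a) pre_digraph \<Rightarrow> 'i list \<Rightarrow> ('i \<Rightarrow> nat) \<Rightarrow> ('i tensor_alg set \<Rightarrow> rat) \<Rightarrow> zseries" where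
  "correlation Q vs d \<xi> = (\<lambda>e.
     if keys e \<subseteq> {..<num_vars d}
     then \<xi> (foldr (\<lambda>k X. field_coeff Q (vertex_at vs d k) (lookup e k) X)
               [0..<num_vars d] (vacuum Q))
     else 0)"

definition F_series ::
  "('i::finite, 'a) pre_digraph \<Rightarrow> 'i list \<Rightarrow> ('i \<Rightarrow> nat) \<Rightarrow> ('i tensor_alg set \<Rightarrow> rat) \<Rightarrow> zseries" where
  "F_series Q vs d \<xi> =
     foldr (\<lambda>(k, l). series_mult (diff_power k l (locality Q (vertex_at vs d k) (vertex_at vs d l))))
       [(k, l). l \<leftarrow> [0..<num_vars d], k \<leftarrow> [0..<l]]
       (correlation Q vs d \<xi>)"

text \<open>The polynomial \<open>f\<close> in the \<open>x\<^bsub>j,k\<^esub>\<close>, written as a series in the \<open>z\<^sub>k\<close>.\<close>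

definition poly_series :: "'i::finite list \<Rightarrow> ('i \<Rightarrow> nat) \<Rightarrow> 'i xpoly \<Rightarrow> zseries" where
  "poly_series vs d f = (\<lambda>e.
     if keys e \<subseteq> {..<num_vars d} \<and> (\<forall>k. 0 \<le> lookup e k)
     then lookup f (\<Sum>k<num_vars d. single (positions vs d ! k) (nat (lookup e k)))
     else 0)"

end

theory Submission
  imports Defs
begin

text \<open>
  A functional \<open>\<xi>\<close> on \<open>P\<^sub>Q\<close> is determined by its values on the vectors
  \<open>i\<^sub>1(n\<^sub>1) \<dots> i\<^sub>p(n\<^sub>p) \<one>\<close>, and a function of words arises in this way as soon as it satisfies the
  locality relations and vanishes on words ending in \<open>i(n)\<close> with \<open>n \<ge> 0\<close>.  No structure theory
  of \<open>U(\<LL>)\<close> (PBW, lattice vertex algebras) is needed for this: evaluating brackets as braided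
  commutators in the free algebra on the generators kills antisymmetry and Jacobi identically.

  Locality of \<open>Y(i,z)\<close> and \<open>Y(j,w)\<close> says that \<open>(z - w)\<^sup>N Y(i,z) Y(j,w)\<close> is invariant under exchanging
  \<open>(i,z)\<close> and \<open>(j,w)\<close>; the sign of the braiding is exactly the sign of \<open>(z - w)\<^sup>N\<close>.  Hence \<open>F\<^sub>\<xi>\<close> is
  equivariant under all permutations.  The vacuum axiom gives non-negative exponents in the last
  variable, so in all of them, and the finite support of \<open>\<xi>\<close> makes \<open>F\<^sub>\<xi>\<close> a polynomial.  Conversely,
  dividing a symmetric polynomial by the product of the \<open>(z\<^sub>k - z\<^sub>l)\<^sup>N\<close> gives a function of words with
  the two required properties.
\<close>

section \<open>Powers of differences acting on iterated Laurent series\<close>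

text \<open>The obstacle is the direction of expansion. A negative power of \<open>z_k - z_l\<close>
  stands for its expansion in \<open>z_l\<close>, and exchanging the variables turns it into a
  different series, so \<open>F\<close> cannot be handled as a rational function. Invariance is
  therefore proved for exchanges of neighbours: among the pairs \<open>k < l\<close> only
  \<open>(a, Suc a)\<close> is reversed, while all other factors keep their direction and are merely
  permuted. The reversed factor is a polynomial except at a vertex without loops paired with itself,
  where the exponent is -1, because N(i,j) is the number of arrows minus the Kronecker delta; that
  case needs its own argument.

  An exchange of variables also exchanges vertices, so all series are set up for arbitrary vertex
  sequences, although the theorem speaks of the sorted one.

  Identities for powers of either sign are derived from the operator of multiplication by
  \<open>z_k - z_l\<close> and its injectivity, instead of convolutions of binomial coefficients.

  The shift by chi(d,d) has two sources: the diagonal terms come from the weights of the generators,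
  the off-diagonal ones from the degree of the product of differences.\<close>

lemma lookup_single_if: "lookup (single k v) j = (if j = k then v else 0)"
  by (simp add: lookup_single when_def)

text \<open>A non-recursive form of \<open>iter_laurent p\<close>.\<close>

definition laurent :: "nat \<Rightarrow> zseries set" where
  "laurent p = {f. (\<forall>e. f e \<noteq> 0 \<longrightarrow> keys e \<subseteq> {..<p}) \<and>
     (\<forall>l<p. \<forall>e. \<exists>b. \<forall>e'. (\<forall>j>l. lookup e' j = lookup e j) \<longrightarrow> f e' \<noteq> 0 \<longrightarrow> b \<le> lookup e' l)}"

lemma laurent_keys: "f \<in> laurent p \<Longrightarrow> f e \<noteq> 0 \<Longrightarrow> keys e \<subseteq> {..<p}"
  unfolding laurent_def by blast

lemma laurent_bound:
  assumes "f \<in> laurent p" "l < p"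
  obtains b where "\<And>e'. (\<forall>j>l. lookup e' j = lookup e j) \<Longrightarrow> f e' \<noteq> 0 \<Longrightarrow> b \<le> lookup e' l"
  using assms unfolding laurent_def by blast

lemma laurentI:
  assumes "\<And>e. f e \<noteq> 0 \<Longrightarrow> keys e \<subseteq> {..<p}"
    and "\<And>l e. l < p \<Longrightarrow>
      \<exists>b. \<forall>e'. (\<forall>j>l. lookup e' j = lookup e j) \<longrightarrow> f e' \<noteq> 0 \<longrightarrow> b \<le> lookup e' l"
  shows "f \<in> laurent p"
  unfolding laurent_def using assms by blast

text \<open>The bound in \<open>laurent\<close> for the variable \<open>l\<close> may depend on the
  exponents above \<open>l\<close> only. For the last variable nothing lies above, so one bound
  serves; fixing the last exponent at \<open>n\<close> turns the condition for \<open>Suc p\<close>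
  into the one for \<open>p\<close>.\<close>

lemma laurent_subset_iter_laurent: "laurent p \<subseteq> iter_laurent p"
proof (induction p)
  case 0
  show ?case unfolding laurent_def by auto
next
  case (Suc p)
  show ?case
  proof
    fix f assume f: "f \<in> laurent (Suc p)"
    obtain b where b: "\<And>e'. (\<forall>j>p. lookup e' j = lookup 0 j) \<Longrightarrow> f e' \<noteq> 0 \<Longrightarrow> b \<le> lookup e' p"
      using laurent_bound[OF f, of p 0] by blast
    have z: "lookup e j = 0" if "f e \<noteq> 0" "j > p" for e j
      using laurent_keys[OF f that(1)] that(2) by (metis in_keys_iff lessThan_iff not_less_eq subsetD)
    have "f e = 0" if "lookup e p < b" for e
      using b[of e] z[of e] that by force
    moreover have "(\<lambda>e. if lookup e p = 0 then f (e + single p n) else 0) \<in> laurent p" for n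
    proof (rule laurentI)
      fix e assume "(if lookup e p = 0 then f (e + single p n) else 0) \<noteq> 0"
      hence h: "lookup e p = 0" "f (e + single p n) \<noteq> 0" by (auto split: if_splits)
      show "keys e \<subseteq> {..<p}"
      proof
        fix x assume x: "x \<in> keys e"
        have "lookup (e + single p n) x = lookup e x" if "x > p"
          using that by (simp add: lookup_add lookup_single_if)
        hence "\<not> x > p" using z[OF h(2), of x] x by (auto simp: in_keys_iff)
        moreover have "x \<noteq> p" using h(1) x by (auto simp: in_keys_iff)
        ultimately show "x \<in> {..<p}" by auto
      qed
    next
      fix l e assume l: "l < p"
      obtain b where b: "\<And>e'. (\<forall>j>l. lookup e' j = lookup (e + single p n) j) \<Longrightarrow> f e' \<noteq> 0 \<Longrightarrow> b \<le> lookup e' l"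
        using laurent_bound[OF f, of l "e + single p n"] l by auto
      have "b \<le> lookup e' l" if "\<forall>j>l. lookup e' j = lookup e j" "f (e' + single p n) \<noteq> 0" for e'
        using b[of "e' + single p n"] that l by (simp add: lookup_add lookup_single_if)
      thus "\<exists>b. \<forall>e'. (\<forall>j>l. lookup e' j = lookup e j) \<longrightarrow>
          (if lookup e' p = 0 then f (e' + single p n) else 0) \<noteq> 0 \<longrightarrow> b \<le> lookup e' l"
        by (intro exI[of _ b]) auto
    qed
    ultimately show "f \<in> iter_laurent (Suc p)" using Suc by auto
  qed
qed

text \<open>\<open>dmul k l N\<close> is multiplication by \<open>(z\<^sub>k - z\<^sub>l)\<^sup>N\<close>, expanded as in \<open>diff_power\<close>; \<open>diff_op\<close> is the case
  \<open>N = 1\<close>, which makes sense for arbitrary series.\<close>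

definition binom_coeff :: "int \<Rightarrow> nat \<Rightarrow> rat" where
  "binom_coeff N m = (-1) ^ m * (of_int N gchoose m)"

text \<open>The term \<open>z_k^(N-m) z_l^m\<close> of the binomial series contributes to the
  coefficient at \<open>e\<close> through this exponent of the other factor.\<close>

definition shifted :: "nat \<Rightarrow> nat \<Rightarrow> int \<Rightarrow> (nat \<Rightarrow>\<^sub>0 int) \<Rightarrow> nat \<Rightarrow> (nat \<Rightarrow>\<^sub>0 int)" where
  "shifted k l N e m = e - (single k (N - int m) + single l (int m))"

definition dmul :: "nat \<Rightarrow> nat \<Rightarrow> int \<Rightarrow> zseries \<Rightarrow> zseries" where
  "dmul k l N g e = (\<Sum>m | g (shifted k l N e m) \<noteq> 0. binom_coeff N m * g (shifted k l N e m))"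

lemma lookup_shifted: "lookup (shifted k l N e m) j =
   lookup e j - (if j = k then N - int m else 0) - (if j = l then int m else 0)"
  by (simp add: shifted_def lookup_minus lookup_add lookup_single_if)

lemma dmul_eq_sum:
  assumes "\<And>m. m \<ge> M \<Longrightarrow> g (shifted k l N e m) = 0"
  shows "dmul k l N g e = (\<Sum>m<M. binom_coeff N m * g (shifted k l N e m))"
  unfolding dmul_def
  by (rule sum.mono_neutral_left) (use assms in \<open>auto simp: not_less[symmetric]\<close>)

lemma dmul_neqD:
  assumes "dmul k l N g e \<noteq> 0"
  obtains m where "g (shifted k l N e m) \<noteq> 0"
  using assms unfolding dmul_def by (metis (mono_tags, lifting) mem_Collect_eq sum.not_neutral_contains_not_neutral)

text \<open>With \<open>k < l\<close>, the exponents above \<open>l\<close> stay put and the one at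
  \<open>l\<close> drops by \<open>m\<close>. Its lower bound in \<open>g\<close> therefore caps
  \<open>m\<close>, uniformly in \<open>N\<close> and in the exponents below \<open>l\<close>; this
  makes the sum in \<open>dmul\<close> finite.\<close>

lemma laurent_shifted_bound:
  assumes g: "g \<in> laurent p" and "k < l" "l < p"
  obtains b where "\<And>e' N m. (\<forall>j>l. lookup e' j = lookup e j) \<Longrightarrow> g (shifted k l N e' m) \<noteq> 0 \<Longrightarrow> int m \<le> lookup e' l - b"
proof -
  obtain b where b: "\<And>e'. (\<forall>j>l. lookup e' j = lookup e j) \<Longrightarrow> g e' \<noteq> 0 \<Longrightarrow> b \<le> lookup e' l"
    using laurent_bound[OF g \<open>l < p\<close>, of e] by blast
  have "int m \<le> lookup e' l - b" if "\<forall>j>l. lookup e' j = lookup e j" "g (shifted k l N e' m) \<noteq> 0" for e' N m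
    using b[of "shifted k l N e' m"] that assms by (simp add: lookup_shifted)
  thus ?thesis using that by blast
qed

lemma laurent_shifted_fin:
  assumes g: "g \<in> laurent p" and "k < l" "l < p"
  obtains M where "\<And>N m. m \<ge> M \<Longrightarrow> g (shifted k l N e m) = 0"
proof -
  obtain b where b: "\<And>e' N m. (\<forall>j>l. lookup e' j = lookup e j) \<Longrightarrow> g (shifted k l N e' m) \<noteq> 0 \<Longrightarrow> int m \<le> lookup e' l - b"
    using laurent_shifted_bound[OF assms] by blast
  show ?thesis
    by (rule that[of "nat (lookup e l - b + 1)"]) (use b[of e] in force)
qed

lemma dmul_laurent:
  assumes g: "g \<in> laurent p" and kl: "k < l" "l < p"
  shows "dmul k l N g \<in> laurent p"
proof (rule laurentI)
  fix e assume "dmul k l N g e \<noteq> 0"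
  then obtain m where m: "g (shifted k l N e m) \<noteq> 0" by (rule dmul_neqD)
  have "lookup (shifted k l N e m) j = lookup e j" if "j \<ge> p" for j
    using that kl by (simp add: lookup_shifted)
  thus "keys e \<subseteq> {..<p}" using laurent_keys[OF g m]
    by (metis in_keys_iff lessThan_iff not_le_imp_less subset_eq)
next
  fix j e assume j: "j < p"
  show "\<exists>b. \<forall>e'. (\<forall>i>j. lookup e' i = lookup e i) \<longrightarrow> dmul k l N g e' \<noteq> 0 \<longrightarrow> b \<le> lookup e' j"
  proof (cases "j \<ge> l")
    case True
    obtain b where b: "\<And>e'. (\<forall>i>j. lookup e' i = lookup e i) \<Longrightarrow> g e' \<noteq> 0 \<Longrightarrow> b \<le> lookup e' j"
      using laurent_bound[OF g j, of e] by blast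
    show ?thesis
    proof (intro exI[of _ b] allI impI)
      fix e' assume e': "\<forall>i>j. lookup e' i = lookup e i" "dmul k l N g e' \<noteq> 0"
      then obtain m where m: "g (shifted k l N e' m) \<noteq> 0" by (metis dmul_neqD)
      show "b \<le> lookup e' j"
        using b[OF _ m] e' True kl by (simp add: lookup_shifted split: if_splits)
    qed
  next
    case False
    obtain c where c: "\<And>e' N m. (\<forall>i>l. lookup e' i = lookup e i) \<Longrightarrow> g (shifted k l N e' m) \<noteq> 0 \<Longrightarrow> int m \<le> lookup e' l - c"
      using laurent_shifted_bound[OF assms] by blast
    have "\<exists>b. \<forall>e'. (\<forall>i>j. lookup e' i = lookup (shifted k l N e m) i) \<longrightarrow> g e' \<noteq> 0 \<longrightarrow> b \<le> lookup e' j" for m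
      using g j unfolding laurent_def by blast
    then obtain B where B: "\<And>m e'. (\<forall>i>j. lookup e' i = lookup (shifted k l N e m) i) \<Longrightarrow> g e' \<noteq> 0 \<Longrightarrow> B m \<le> lookup e' j"
      by metis
    \<comment> \<open>Since \<open>j < l\<close>, the exponent at \<open>l\<close> is fixed too, so
      only the \<open>m\<close> in \<open>S\<close> occur. The tail above \<open>j\<close> depends
      on \<open>m\<close>, hence a separate bound \<open>B m\<close> for each; the least of finitely
      many bounds works.\<close>
    define S where "S = {..nat (lookup e l - c)}"
    define b where "b = Min ((\<lambda>m. B m + (if j = k then N - int m else 0)) ` S)"
    show ?thesis
    proof (intro exI[of _ b] allI impI)
      fix e' assume e': "\<forall>i>j. lookup e' i = lookup e i" "dmul k l N g e' \<noteq> 0"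
      then obtain m where m: "g (shifted k l N e' m) \<noteq> 0" by (metis dmul_neqD)
      have "int m \<le> lookup e l - c" using c[OF _ m] e' False by auto
      hence mS: "m \<in> S" unfolding S_def by auto
      have "\<forall>i>j. lookup (shifted k l N e' m) i = lookup (shifted k l N e m) i"
        using e' by (simp add: lookup_shifted)
      hence "B m \<le> lookup (shifted k l N e' m) j" using B m by blast
      hence "B m + (if j = k then N - int m else 0) \<le> lookup e' j"
        using False by (simp add: lookup_shifted split: if_splits)
      moreover have "b \<le> B m + (if j = k then N - int m else 0)"
        unfolding b_def by (rule Min_le) (use mS S_def in auto)
      ultimately show "b \<le> lookup e' j" by linarith
    qed
  qed
qed

lemma binom_coeff_0 [simp]: "binom_coeff N 0 = 1" by (simp add: binom_coeff_def)

lemma binom_coeff_0_Suc [simp]: "binom_coeff 0 (Suc m) = 0" by (simp add: binom_coeff_def)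

lemma binom_coeff_Suc: "binom_coeff (N + 1) (Suc m) = binom_coeff N (Suc m) - binom_coeff N m"
  using gbinomial_Suc_Suc[of "of_int N :: rat" m] by (simp add: binom_coeff_def algebra_simps)

lemma binom_coeff_nat: "binom_coeff (int N) m = (-1) ^ m * of_nat (N choose m)"
  by (simp add: binom_coeff_def binomial_gbinomial)

lemma dmul_0:
  assumes "g \<in> laurent p" "k < l" "l < p"
  shows "dmul k l 0 g = g"
proof
  fix e
  obtain M where M: "\<And>N m. m \<ge> M \<Longrightarrow> g (shifted k l N e m) = 0"
    using laurent_shifted_fin[OF assms] by blast
  have "dmul k l 0 g e = (\<Sum>m<Suc M. binom_coeff 0 m * g (shifted k l 0 e m))"
    by (rule dmul_eq_sum) (use M in auto)
  also have "\<dots> = g e" 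
    by (subst sum.lessThan_Suc_shift) (simp add: shifted_def)
  finally show "dmul k l 0 g e = g e" .
qed

definition diff_op :: "nat \<Rightarrow> nat \<Rightarrow> zseries \<Rightarrow> zseries" where
  "diff_op k l g e = g (e - single k 1) - g (e - single l 1)"

text \<open>Pascal's rule \<open>binom_coeff_Suc\<close>, which holds for exponents of either
  sign.\<close>

lemma diff_op_dmul:
  assumes "g \<in> laurent p" "k < l" "l < p"
  shows "diff_op k l (dmul k l N g) = dmul k l (N + 1) g"
proof
  fix e
  obtain M1 where M1: "\<And>N m. m \<ge> M1 \<Longrightarrow> g (shifted k l N e m) = 0"
    using laurent_shifted_fin[OF assms] by blast
  have s1: "shifted k l N (e - single k 1) m = shifted k l (N + 1) e m" for m
    by (rule poly_mapping_eqI) (simp add: lookup_shifted lookup_minus lookup_single_if)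
  have s2: "shifted k l N (e - single l 1) m = shifted k l (N + 1) e (Suc m)" for m
    by (rule poly_mapping_eqI) (simp add: lookup_shifted lookup_minus lookup_single_if)
  have "dmul k l N g (e - single k 1) = (\<Sum>m<Suc M1. binom_coeff N m * g (shifted k l (N + 1) e m))"
    by (subst dmul_eq_sum[where M = "Suc M1"]) (use M1 in \<open>auto simp: s1\<close>)
  moreover have "dmul k l N g (e - single l 1) = (\<Sum>m<M1. binom_coeff N m * g (shifted k l (N + 1) e (Suc m)))"
    by (subst dmul_eq_sum[where M = "M1"]) (use M1 in \<open>auto simp: s2\<close>)
  moreover have "dmul k l (N+1) g e = (\<Sum>m<Suc M1. binom_coeff (N+1) m * g (shifted k l (N + 1) e m))"
    by (rule dmul_eq_sum) (use M1 in auto)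
  moreover have "(\<Sum>m<Suc M1. binom_coeff (N+1) m * g (shifted k l (N + 1) e m)) = 
     (\<Sum>m<Suc M1. binom_coeff N m * g (shifted k l (N + 1) e m)) - (\<Sum>m<M1. binom_coeff N m * g (shifted k l (N + 1) e (Suc m)))"
    unfolding sum.lessThan_Suc_shift
    by (simp add: binom_coeff_Suc left_diff_distrib sum_subtractf)
  ultimately show "diff_op k l (dmul k l N g) e = dmul k l (N + 1) g e"
    unfolding diff_op_def by simp
qed

text \<open>A difference killed by \<open>z_k - z_l\<close> is constant when exponent is moved from
  \<open>l\<close> to \<open>k\<close>, and on that way the exponent of \<open>z_l\<close> leaves
  the support. The lower bound in \<open>z_l\<close> is essential: the two-sided sum of all
  \<open>z_k^n z_l^(-n-1)\<close> is killed as well.\<close>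

lemma diff_op_inj:
  assumes g: "g \<in> laurent p" and h: "h \<in> laurent p" and kl: "k < l" "l < p"
    and eq: "diff_op k l g = diff_op k l h"
  shows "g = h"
proof
  fix e
  define d where "d = (\<lambda>e. g e - h e)"
  have step: "d (shifted k l 0 e m) = d (shifted k l 0 e (Suc m))" for m
  proof -
    define e' where "e' = shifted k l 0 e m + single k 1"
    have "diff_op k l g e' = diff_op k l h e'" using eq by simp
    moreover have "e' - single k 1 = shifted k l 0 e m" 
      by (simp add: e'_def)
    moreover have "e' - single l 1 = shifted k l 0 e (Suc m)"
      by (rule poly_mapping_eqI) (simp add: e'_def lookup_shifted lookup_minus lookup_add lookup_single_if)
    ultimately show ?thesis by (simp add: diff_op_def d_def)
  qed
  have all: "d (shifted k l 0 e 0) = d (shifted k l 0 e m)" for m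
    by (induction m) (use step in auto)
  obtain M1 where M1: "\<And>N m. m \<ge> M1 \<Longrightarrow> g (shifted k l N e m) = 0"
    using laurent_shifted_fin[OF g kl] by blast
  obtain M2 where M2: "\<And>N m. m \<ge> M2 \<Longrightarrow> h (shifted k l N e m) = 0"
    using laurent_shifted_fin[OF h kl] by blast
  have "d (shifted k l 0 e (max M1 M2)) = 0" using M1 M2 by (simp add: d_def)
  moreover have "shifted k l 0 e 0 = e" by (simp add: shifted_def)
  ultimately show "g e = h e" using all[of "max M1 M2"] by (simp add: d_def)
qed

lemma diff_op_laurent:
  assumes "g \<in> laurent p" "k < l" "l < p"
  shows "diff_op k l g \<in> laurent p"
  using dmul_laurent[OF assms, of 1] diff_op_dmul[OF assms, of 0] dmul_0[OF assms] by simp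

text \<open>Since \<open>diff_op\<close> is injective on Laurent series, an identity for all integral powers
  follows by induction in both directions from the case of exponent \<open>0\<close>.\<close>

lemma dmul_unique:
  assumes kl: "k < l" "l < p" and h: "\<And>N. h N \<in> laurent p"
    and step: "\<And>N. diff_op k l (h N) = h (N + 1)"
  shows "h N = dmul k l N (h 0)"
proof (induction N rule: int_induct[of _ 0])
  case base
  show ?case using dmul_0[OF h kl] by simp
next
  case (step1 i)
  thus ?case by (metis diff_op_dmul[OF h kl] step)
next
  case (step2 i)
  have "diff_op k l (h (i - 1)) = diff_op k l (dmul k l (i - 1) (h 0))"
    using step2 step[of "i - 1"] diff_op_dmul[OF h[of 0] kl, of "i - 1"] by simp
  thus ?case by (rule diff_op_inj[OF h dmul_laurent[OF h kl] kl])
qed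

text \<open>Takes the place of Vandermonde's convolution: as functions of \<open>N\<close>, both
  sides obey the recursion of \<open>dmul_unique\<close> and agree at \<open>N = 0\<close>.\<close>

lemma dmul_dmul:
  assumes g: "g \<in> laurent p" and kl: "k < l" "l < p"
  shows "dmul k l N (dmul k l M g) = dmul k l (N + M) g"
  using dmul_unique[OF kl, of "\<lambda>N. dmul k l (N + M) g" N] dmul_laurent[OF g kl] diff_op_dmul[OF g kl]
  by (simp add: algebra_simps)

lemma dmul_diff_op_commute:
  assumes g: "g \<in> laurent p" and kl: "k < l" "l < p" and kl': "k' < l'" "l' < p"
  shows "diff_op k' l' (dmul k l N g) = dmul k l N (diff_op k' l' g)"
proof
  fix e
  let ?f = "diff_op k' l' g"
  have f: "?f \<in> laurent p" by (rule diff_op_laurent[OF g kl'])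
  obtain M1 where M1: "\<And>N m. m \<ge> M1 \<Longrightarrow> g (shifted k l N (e - single k' 1) m) = 0"
    using laurent_shifted_fin[OF g kl] by blast
  obtain M2 where M2: "\<And>N m. m \<ge> M2 \<Longrightarrow> g (shifted k l N (e - single l' 1) m) = 0"
    using laurent_shifted_fin[OF g kl] by blast
  have s: "shifted k l N (e - single j 1) m = shifted k l N e m - single j 1" for j m N
    by (simp add: shifted_def algebra_simps)
  define M where "M = max M1 M2"
  have a: "dmul k l N g (e - single k' 1) = (\<Sum>m<M. binom_coeff N m * g (shifted k l N e m - single k' 1))"
    by (subst dmul_eq_sum[where M = M]) (use M1[unfolded s] M_def in \<open>auto simp: s\<close>)
  have b: "dmul k l N g (e - single l' 1) = (\<Sum>m<M. binom_coeff N m * g (shifted k l N e m - single l' 1))"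
    by (subst dmul_eq_sum[where M = M]) (use M2[unfolded s] M_def in \<open>auto simp: s\<close>)
  have "dmul k l N ?f e = (\<Sum>m<M. binom_coeff N m * ?f (shifted k l N e m))"
    by (rule dmul_eq_sum) (use M1[unfolded s] M2[unfolded s] M_def in \<open>auto simp: diff_op_def\<close>)
  also have "\<dots> = diff_op k' l' (dmul k l N g) e"
    unfolding diff_op_def a b by (simp add: sum_subtractf algebra_simps)
  finally show "diff_op k' l' (dmul k l N g) e = dmul k l N ?f e" by simp
qed

text \<open>\<open>dmul_unique\<close> in the exponent \<open>N'\<close>; the recursion passes
  through the outer factor by \<open>dmul_diff_op_commute\<close>. This avoids interchanging two
  expansions directly.\<close>

lemma dmul_commute:
  assumes g: "g \<in> laurent p" and kl: "k < l" "l < p" and kl': "k' < l'" "l' < p"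
  shows "dmul k l N (dmul k' l' N' g) = dmul k' l' N' (dmul k l N g)"
proof -
  have "dmul k l N (dmul k' l' M g) \<in> laurent p" for M
    using dmul_laurent g kl kl' by blast
  moreover have "diff_op k' l' (dmul k l N (dmul k' l' M g)) = dmul k l N (dmul k' l' (M + 1) g)" for M
    using dmul_diff_op_commute[OF dmul_laurent[OF g kl'] kl kl'] diff_op_dmul[OF g kl'] by simp
  ultimately show ?thesis
    using dmul_unique[OF kl', of "\<lambda>M. dmul k l N (dmul k' l' M g)" N'] dmul_0[OF g kl'] by simp
qed

text \<open>Since \<open>k\<close> and \<open>l\<close> differ, the exponent \<open>m\<close> of
  \<open>z_l\<close> parametrises the terms of \<open>diff_power\<close> injectively, and the sum
  over exponents becomes the sum over \<open>m\<close> in \<open>dmul\<close>.\<close>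

lemma series_mult_diff_power:
  assumes g: "g \<in> laurent p" and kl: "k < l" "l < p"
  shows "series_mult (diff_power k l N) g = dmul k l N g"
proof
  fix e
  define t where "t m = single k (N - int m) + single l (int m)" for m
  have tl: "lookup (t m) l = int m" for m using kl by (simp add: t_def lookup_add lookup_single_if)
  have inj: "inj t" by (rule injI) (metis tl of_nat_eq_iff)
  have dt: "diff_power k l N (t m) = binom_coeff N m" for m
    unfolding diff_power_def Let_def tl by (simp add: t_def binom_coeff_def)
  have dn: "a \<in> range t" if "diff_power k l N a \<noteq> 0" for a
  proof -
    from that have h: "lookup a l \<ge> 0" "a = single k (N - lookup a l) + single l (lookup a l)"
      unfolding diff_power_def Let_def by (auto split: if_splits)
    have "a = t (nat (lookup a l))" unfolding t_def using h by simp
    thus ?thesis by blast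
  qed
  obtain M where M: "\<And>N m. m \<ge> M \<Longrightarrow> g (shifted k l N e m) = 0"
    using laurent_shifted_fin[OF assms] by blast
  have sh: "shifted k l N e m = e - t m" for m by (simp add: shifted_def t_def)
  have "series_mult (diff_power k l N) g e = (\<Sum>a\<in>t ` {..<M}. diff_power k l N a * g (e - a))"
    unfolding series_mult_def
  proof (rule sum.mono_neutral_left)
    show "{a. diff_power k l N a \<noteq> 0 \<and> g (e - a) \<noteq> 0} \<subseteq> t ` {..<M}"
    proof
      fix a assume a: "a \<in> {a. diff_power k l N a \<noteq> 0 \<and> g (e - a) \<noteq> 0}"
      then obtain m where m: "a = t m" using dn by blast
      have "g (shifted k l N e m) \<noteq> 0" using a by (simp add: sh m)
      hence "m < M" using M[of m N] by (simp add: not_le[symmetric]) blast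
      thus "a \<in> t ` {..<M}" using m by auto
    qed
  qed auto
  also have "\<dots> = (\<Sum>m<M. binom_coeff N m * g (shifted k l N e m))"
    by (subst sum.reindex) (use inj in \<open>auto simp: dt sh inj_def inj_on_def\<close>)
  also have "\<dots> = dmul k l N g e" by (rule dmul_eq_sum[symmetric]) (use M in auto)
  finally show "series_mult (diff_power k l N) g e = dmul k l N g e" .
qed

section \<open>Permuting variables, and products over lists of pairs\<close>

abbreviation permute_exps :: "(nat \<Rightarrow> nat) \<Rightarrow> (nat \<Rightarrow>\<^sub>0 int) \<Rightarrow> (nat \<Rightarrow>\<^sub>0 int)" where
  "permute_exps \<equiv> Poly_Mapping.map_key"

lemma lookup_map_key: "inj s \<Longrightarrow> lookup (Poly_Mapping.map_key s e) k = lookup e (s k)"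
  by (simp add: map_key.rep_eq)

text \<open>Pure reindexing, valid for every series. The direction of expansion travels along, so
  the result is a factor in the standard direction only if \<open>inv s k < inv s l\<close>.\<close>

lemma dmul_permute:
  assumes s: "bij s"
  shows "dmul k l N (\<lambda>e. g (permute_exps s e)) e = dmul (inv s k) (inv s l) N g (permute_exps s e)"
proof -
  have inj: "inj s" using s bij_is_inj by blast
  have "permute_exps s (shifted k l N e m) = shifted (inv s k) (inv s l) N (permute_exps s e) m" for m
    by (rule poly_mapping_eqI)
      (auto simp: lookup_map_key[OF inj] lookup_shifted bij_inv_eq_iff[OF s] s surj_f_inv_f bij_is_surj)
  thus ?thesis unfolding dmul_def by simp
qed

text \<open>For natural exponents the binomial series stops at \<open>N\<close>; this finite sum is
  the shape in which the locality relations come.\<close>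

lemma dmul_nat:
  assumes "g \<in> laurent p" "k < l" "l < p"
  shows "dmul k l (int N) g e = (\<Sum>m\<le>N. (-1) ^ m * of_nat (N choose m) * g (shifted k l (int N) e m))"
proof -
  obtain M where M: "\<And>N m. m \<ge> M \<Longrightarrow> g (shifted k l N e m) = 0"
    using laurent_shifted_fin[OF assms] by blast
  have "dmul k l (int N) g e = (\<Sum>m<max M (Suc N). binom_coeff (int N) m * g (shifted k l (int N) e m))"
    by (rule dmul_eq_sum) (use M in auto)
  also have "\<dots> = (\<Sum>m\<le>N. binom_coeff (int N) m * g (shifted k l (int N) e m))"
    by (rule sum.mono_neutral_right) (auto simp: binom_coeff_nat binomial_eq_0)
  finally show ?thesis by (simp add: binom_coeff_nat)
qed

definition dmul_list :: "(nat \<times> nat) list \<Rightarrow> (nat \<times> nat \<Rightarrow> int) \<Rightarrow> zseries \<Rightarrow> zseries" where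
  "dmul_list ps w g = foldr (\<lambda>x. dmul (fst x) (snd x) (w x)) ps g"

lemma dmul_list_Nil [simp]: "dmul_list [] w g = g"
  and dmul_list_Cons [simp]: "dmul_list (x # ps) w g = dmul (fst x) (snd x) (w x) (dmul_list ps w g)"
  by (simp_all add: dmul_list_def)

definition ordered_pairs :: "nat \<Rightarrow> (nat \<times> nat) set" where
  "ordered_pairs p = {(k, l). k < l \<and> l < p}"

lemma dmul_list_laurent:
  "g \<in> laurent p \<Longrightarrow> set ps \<subseteq> ordered_pairs p \<Longrightarrow> dmul_list ps w g \<in> laurent p"
  by (induction ps) (auto simp: ordered_pairs_def intro!: dmul_laurent)

lemma dmul_dmul_list:
  assumes "g \<in> laurent p" "set ps \<subseteq> ordered_pairs p" "k < l" "l < p"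
  shows "dmul k l N (dmul_list ps w g) = dmul_list ps w (dmul k l N g)"
  using assms(2)
proof (induction ps)
  case (Cons x ps)
  have "dmul k l N (dmul (fst x) (snd x) (w x) (dmul_list ps w g)) =
     dmul (fst x) (snd x) (w x) (dmul k l N (dmul_list ps w g))"
    by (rule dmul_commute[OF dmul_list_laurent[OF assms(1)]])
       (use Cons.prems assms in \<open>auto simp: ordered_pairs_def\<close>)
  thus ?case using Cons by simp
qed simp

lemma dmul_list_append: "dmul_list (xs @ ys) w g = dmul_list xs w (dmul_list ys w g)"
  by (simp add: dmul_list_def)

text \<open>Serves to bring a chosen pair into the innermost position.\<close>

lemma dmul_list_mset:
  assumes g: "g \<in> laurent p" and "set ps \<subseteq> ordered_pairs p" and "mset ps = mset qs"
  shows "dmul_list ps w g = dmul_list qs w g"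
  using assms(2,3)
proof (induction ps arbitrary: qs)
  case (Cons x ps)
  have "x \<in> set qs" using Cons.prems(2) by (metis list.set_intros(1) set_mset_mset)
  then obtain ys zs where q: "qs = ys @ x # zs" by (meson split_list)
  have m: "mset ps = mset (ys @ zs)" using Cons.prems(2) by (simp add: q)
  have sub: "set (ys @ zs) \<subseteq> ordered_pairs p" using Cons.prems(1) mset_eq_setD[OF m] by auto
  have "dmul_list qs w g = dmul_list ys w (dmul (fst x) (snd x) (w x) (dmul_list zs w g))"
    by (simp add: q dmul_list_append)
  also have "\<dots> = dmul (fst x) (snd x) (w x) (dmul_list ys w (dmul_list zs w g))"
    by (rule dmul_dmul_list[symmetric, OF dmul_list_laurent[OF g]])
       (use sub Cons.prems(1) in \<open>auto simp: ordered_pairs_def\<close>)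
  also have "\<dots> = dmul (fst x) (snd x) (w x) (dmul_list ps w g)"
    using Cons.IH[OF _ m] Cons.prems(1) by (simp add: dmul_list_append)
  finally show ?case by simp
qed simp

text \<open>The factors commute and each one cancels its inverse power. This yields both the
  injectivity of the passage from correlations to \<open>F\<close> and the construction of
  correlations from polynomials.\<close>

lemma dmul_list_inverse:
  assumes g: "g \<in> laurent p" and "set ps \<subseteq> ordered_pairs p"
  shows "dmul_list ps w (dmul_list ps (\<lambda>x. - w x) g) = g"
  using assms(2)
proof (induction ps)
  case (Cons x ps)
  have x: "fst x < snd x" "snd x < p" and ps: "set ps \<subseteq> ordered_pairs p"
    using Cons.prems by (auto simp: ordered_pairs_def)
  let ?h = "dmul_list ps (\<lambda>x. - w x) g"
  have h: "?h \<in> laurent p" by (rule dmul_list_laurent[OF g ps])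
  have "dmul_list (x # ps) w (dmul_list (x # ps) (\<lambda>x. - w x) g) =
     dmul (fst x) (snd x) (w x) (dmul (fst x) (snd x) (- w x) (dmul_list ps w ?h))"
    by (simp add: dmul_dmul_list[OF h ps x])
  also have "\<dots> = dmul_list ps w ?h"
    using dmul_dmul[OF dmul_list_laurent[OF h ps] x] dmul_0[OF dmul_list_laurent[OF h ps] x] by simp
  finally show ?case using Cons.IH ps by simp
qed simp

lemma dmul_list_permute:
  assumes s: "bij s"
  shows "dmul_list ps w (\<lambda>e. g (permute_exps s e)) =
     (\<lambda>e. dmul_list (map (map_prod (inv s) (inv s)) ps) (\<lambda>x. w (map_prod s s x)) g (permute_exps s e))"
proof (induction ps)
  case (Cons x ps)
  have "w (map_prod s s (inv s (fst x), inv s (snd x))) = w x"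
    using s by (cases x) (simp add: bij_is_surj surj_f_inv_f)
  thus ?case
    using dmul_permute[OF s, of "fst x" "snd x" "w x" "dmul_list (map (map_prod (inv s) (inv s)) ps) (\<lambda>x. w (map_prod s s x)) g"]
    by (cases x) (simp add: Cons.IH)
qed simp

lemma dmul_list_cong:
  "(\<And>x. x \<in> set ps \<Longrightarrow> w x = w' x) \<Longrightarrow> dmul_list ps w g = dmul_list ps w' g"
  by (induction ps) auto

section \<open>Total degree, the last variable, and linearity\<close>

definition exp_sum :: "nat \<Rightarrow> (nat \<Rightarrow>\<^sub>0 int) \<Rightarrow> int" where
  "exp_sum p e = (\<Sum>k<p. lookup e k)"

lemma exp_sum_shifted:
  assumes "k < l" "l < p"
  shows "exp_sum p (shifted k l N e m) = exp_sum p e - N"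
  using assms by (simp add: exp_sum_def lookup_shifted sum_subtractf sum.delta)

text \<open>\<open>(z_k - z_l)^N\<close> is homogeneous of degree \<open>N\<close>, also when
  expanded for negative \<open>N\<close>, so total degrees add up.\<close>

lemma dmul_list_exp_sum:
  assumes "set ps \<subseteq> ordered_pairs p" "dmul_list ps w g e \<noteq> 0"
  shows "\<exists>e'. g e' \<noteq> 0 \<and> exp_sum p e = exp_sum p e' + sum_list (map w ps)"
  using assms
proof (induction ps arbitrary: e)
  case (Cons x ps)
  have x: "fst x < snd x" "snd x < p" and ps: "set ps \<subseteq> ordered_pairs p"
    using Cons.prems by (auto simp: ordered_pairs_def)
  obtain m where m: "dmul_list ps w g (shifted (fst x) (snd x) (w x) e m) \<noteq> 0"
    using Cons.prems(2) dmul_neqD by (metis dmul_list_Cons)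
  show ?case using Cons.IH[OF ps m] exp_sum_shifted[OF x, of "w x" e m] by auto
qed auto

text \<open>In an ordered pair the last variable can only be the second one, and the expansions
  contain non-negative powers of the second variable only, whatever the exponent.\<close>

lemma dmul_list_nonneg_last:
  assumes "set ps \<subseteq> ordered_pairs (Suc p)" "dmul_list ps w g e \<noteq> 0"
    "\<And>e. g e \<noteq> 0 \<Longrightarrow> lookup e p \<ge> 0"
  shows "lookup e p \<ge> 0"
  using assms(1,2)
proof (induction ps arbitrary: e)
  case (Cons x ps)
  have x: "fst x < snd x" "snd x < Suc p" and ps: "set ps \<subseteq> ordered_pairs (Suc p)"
    using Cons.prems by (auto simp: ordered_pairs_def)
  obtain m where m: "dmul_list ps w g (shifted (fst x) (snd x) (w x) e m) \<noteq> 0"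
    using Cons.prems(2) dmul_neqD by (metis dmul_list_Cons)
  show ?case using Cons.IH[OF ps m] x by (auto simp: lookup_shifted split: if_splits)
qed (use assms(3) in auto)

lemma dmul_linear:
  assumes g: "g \<in> laurent p" and h: "h \<in> laurent p" and kl: "k < l" "l < p"
  shows "dmul k l N (\<lambda>e. a * g e + b * h e) = (\<lambda>e. a * dmul k l N g e + b * dmul k l N h e)"
proof
  fix e
  obtain M1 where M1: "\<And>N m. m \<ge> M1 \<Longrightarrow> g (shifted k l N e m) = 0"
    using laurent_shifted_fin[OF g kl] by blast
  obtain M2 where M2: "\<And>N m. m \<ge> M2 \<Longrightarrow> h (shifted k l N e m) = 0"
    using laurent_shifted_fin[OF h kl] by blast
  define M where "M = max M1 M2"
  have "dmul k l N g e = (\<Sum>m<M. binom_coeff N m * g (shifted k l N e m))"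
    by (rule dmul_eq_sum) (use M1 M_def in auto)
  moreover have "dmul k l N h e = (\<Sum>m<M. binom_coeff N m * h (shifted k l N e m))"
    by (rule dmul_eq_sum) (use M2 M_def in auto)
  moreover have "dmul k l N (\<lambda>e. a * g e + b * h e) e = (\<Sum>m<M. binom_coeff N m * (a * g (shifted k l N e m) + b * h (shifted k l N e m)))"
    by (rule dmul_eq_sum) (use M1 M2 M_def in auto)
  ultimately show "dmul k l N (\<lambda>e. a * g e + b * h e) e = a * dmul k l N g e + b * dmul k l N h e"
    by (simp add: sum_distrib_left sum.distrib algebra_simps)
qed

lemma dmul_list_linear:
  assumes g: "g \<in> laurent p" and h: "h \<in> laurent p" and "set ps \<subseteq> ordered_pairs p"
  shows "dmul_list ps w (\<lambda>e. a * g e + b * h e) = (\<lambda>e. a * dmul_list ps w g e + b * dmul_list ps w h e)"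
  using assms(3)
proof (induction ps)
  case (Cons x ps)
  have x: "fst x < snd x" "snd x < p" and ps: "set ps \<subseteq> ordered_pairs p"
    using Cons.prems by (auto simp: ordered_pairs_def)
  show ?case 
    using Cons.IH[OF ps] dmul_linear[OF dmul_list_laurent[OF g ps] dmul_list_laurent[OF h ps] x] by simp
qed simp

section \<open>Functionals on the principal free vertex algebra as functions of words\<close>

lemma euler_add_left: "euler Q (\<lambda>i. a i + b i) c = euler Q a c + euler Q b c"
  by (simp add: euler_def sum.distrib algebra_simps)

lemma euler_add_right: "euler Q c (\<lambda>i. a i + b i) = euler Q c a + euler Q c b"
  by (simp add: euler_def sum.distrib algebra_simps)

text \<open>Grouping arrows by their end points expresses the Euler form through arrow counts, to
  which the symmetry of the quiver applies.\<close>

lemma sum_arcs_tail_head: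
  fixes f g :: "'i::finite \<Rightarrow> int"
  assumes "finite (arcs Q)"
  shows "(\<Sum>a\<in>arcs Q. f (tail Q a) * g (head Q a)) =
     (\<Sum>i\<in>UNIV. \<Sum>j\<in>UNIV. f i * g j * int (card {a \<in> arcs Q. tail Q a = i \<and> head Q a = j}))"
proof -
  have "(\<Sum>a\<in>arcs Q. f (tail Q a) * g (head Q a)) =
     (\<Sum>x\<in>UNIV. \<Sum>a\<in>{a \<in> arcs Q. (tail Q a, head Q a) = x}. f (tail Q a) * g (head Q a))"
    by (rule sum.group[symmetric]) (use assms in auto)
  also have "\<dots> = (\<Sum>x\<in>UNIV. f (fst x) * g (snd x) * int (card {a \<in> arcs Q. tail Q a = fst x \<and> head Q a = snd x}))"
  proof (rule sum.cong[OF refl])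
    fix x :: "'i \<times> 'i"
    have "(\<Sum>a\<in>{a \<in> arcs Q. (tail Q a, head Q a) = x}. f (tail Q a) * g (head Q a)) =
        (\<Sum>a\<in>{a \<in> arcs Q. tail Q a = fst x \<and> head Q a = snd x}. f (fst x) * g (snd x))"
      by (rule sum.cong) auto
    thus "(\<Sum>a\<in>{a \<in> arcs Q. (tail Q a, head Q a) = x}. f (tail Q a) * g (head Q a)) =
       f (fst x) * g (snd x) * int (card {a \<in> arcs Q. tail Q a = fst x \<and> head Q a = snd x})"
      by simp
  qed
  finally show ?thesis by (simp add: sum.cartesian_product case_prod_beta UNIV_Times_UNIV[symmetric] del: UNIV_Times_UNIV)
qed

lemma euler_commute:
  assumes "symmetric_quiver Q"
  shows "euler Q a b = euler Q b a"
proof -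
  have fin: "finite (arcs Q)" using assms by (simp add: symmetric_quiver_def fin_digraph_def fin_digraph_axioms_def)
  have sym: "card {a \<in> arcs Q. tail Q a = i \<and> head Q a = j} = card {a \<in> arcs Q. tail Q a = j \<and> head Q a = i}" for i j
    using assms unfolding symmetric_quiver_def by blast
  have "(\<Sum>x\<in>arcs Q. a (tail Q x) * b (head Q x)) = (\<Sum>x\<in>arcs Q. b (tail Q x) * a (head Q x))"
    unfolding sum_arcs_tail_head[OF fin]
    by (subst sum.swap) (simp add: sym mult.commute)
  thus ?thesis by (simp add: euler_def mult.commute)
qed

lemma locality_commute: "symmetric_quiver Q \<Longrightarrow> locality Q i j = locality Q j i"
  by (simp add: locality_def euler_commute)

text \<open>\<open>locality Q i j\<close> is the number of arrows from \<open>i\<close> to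
  \<open>j\<close> minus the Kronecker delta.\<close>

lemma locality_neg:
  assumes "locality Q i j < 0"
  shows "i = j \<and> locality Q i j = -1"
proof -
  have "(\<Sum>k\<in>UNIV. basis_vec i k * basis_vec j k) = (\<Sum>k\<in>UNIV. if k = i then (if i = j then 1 else 0) else (0::int))"
    by (rule sum.cong) (auto simp: basis_vec_def)
  hence "(\<Sum>k\<in>UNIV. basis_vec i k * basis_vec j k) = (if i = j then 1 else 0)" by simp
  moreover have "(\<Sum>a\<in>arcs Q. basis_vec i (tail Q a) * basis_vec j (head Q a)) \<ge> 0"
    by (rule sum_nonneg) (simp add: basis_vec_def)
  ultimately show ?thesis using assms unfolding locality_def euler_def by (auto split: if_splits)
qed

lemma braid_sign_cases: "braid_sign Q a b = 1 \<or> braid_sign Q a b = -1"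
  unfolding braid_sign_def by (cases "even (euler Q a b)") (auto simp: power_int_minus_left)

lemma braid_sign_add_left: "braid_sign Q (\<lambda>i. a i + b i) c = braid_sign Q a c * braid_sign Q b c"
  by (simp add: braid_sign_def euler_add_left power_int_add)

lemma braid_sign_add_right: "braid_sign Q c (\<lambda>i. a i + b i) = braid_sign Q c a * braid_sign Q c b"
  by (simp add: braid_sign_def euler_add_right power_int_add)

lemma braid_sign_commute: "symmetric_quiver Q \<Longrightarrow> braid_sign Q a b = braid_sign Q b a"
  by (simp add: braid_sign_def euler_commute)

lemma braid_sign_basis_vec:
  "braid_sign Q (basis_vec i) (basis_vec j) = (-1) ^ nat \<bar>locality Q i j\<bar>"
  by (simp add: braid_sign_def locality_def power_int_def power_inverse[symmetric] del: power_inverse)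

lemma euler_sum_basis_vec:
  fixes v :: "'k \<Rightarrow> 'i::finite"
  assumes "finite A"
  shows "euler Q (\<lambda>i. \<Sum>k\<in>A. basis_vec (v k) i) c = (\<Sum>k\<in>A. euler Q (basis_vec (v k)) c)"
    and "euler Q c (\<lambda>i. \<Sum>k\<in>A. basis_vec (v k) i) = (\<Sum>k\<in>A. euler Q c (basis_vec (v k)))"
proof -
  have z: "euler Q (\<lambda>i. 0) c = 0" "euler Q c (\<lambda>i. 0) = 0" for c by (simp_all add: euler_def)
  show "euler Q (\<lambda>i. \<Sum>k\<in>A. basis_vec (v k) i) c = (\<Sum>k\<in>A. euler Q (basis_vec (v k)) c)"
    using assms by induction (simp_all add: z euler_add_left)
  show "euler Q c (\<lambda>i. \<Sum>k\<in>A. basis_vec (v k) i) = (\<Sum>k\<in>A. euler Q c (basis_vec (v k)))"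
    using assms by induction (simp_all add: z euler_add_right)
qed

section \<open>Linear extension from a basis\<close>

lemma lookup_scale [simp]: "lookup (scale c f) u = c * lookup f u"
  by (simp add: scale_def map.rep_eq when_def)

lemma scale_simps [simp]: "scale 0 f = 0" "scale 1 f = f" "scale c 0 = 0" "scale c (scale d f) = scale (c * d) f"
  "scale c (single u d) = single u (c * d)"
  by (auto intro!: poly_mapping_eqI simp: lookup_single_if)

lemma scale_minus_one: "scale (-1) f = - f"
  by (auto intro!: poly_mapping_eqI)

lemma scale_add: "scale c (f + g) = scale c f + scale c g"
  and scale_diff: "scale c (f - g) = scale c f - scale c g"
  and scale_add_left: "scale (c + d) f = scale c f + scale d f"
  and scale_uminus: "scale c (- f) = - scale c f" "scale (-c) f = - scale c f"
  by (auto intro!: poly_mapping_eqI simp: lookup_add lookup_minus algebra_simps)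

lemma scale_sum: "scale c (sum f A) = (\<Sum>x\<in>A. scale c (f x))"
  by (induction A rule: infinite_finite_induct) (simp_all add: scale_add)

lemma poly_mapping_single_add_induct [case_names single add]:
  assumes "\<And>u c. P (single u c)" and "\<And>f g. P f \<Longrightarrow> P g \<Longrightarrow> P (f + g)"
  shows "P (f :: 'x \<Rightarrow>\<^sub>0 rat)"
proof (induction f rule: update_induct)
  case const
  show ?case using assms(1)[of undefined 0] by simp
next
  case (update f a b)
  hence "Poly_Mapping.update a b f = f + single a b"
    by (auto intro!: poly_mapping_eqI simp: lookup_update lookup_add lookup_single_if in_keys_iff)
  thus ?case using assms update by simp
qed

lemma scale_mult_left: "scale c f * g = scale c (f * g)"
  for f g :: "'x::monoid_add \<Rightarrow>\<^sub>0 rat"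
  by (simp add: scale_def mult_map_scale_conv_mult mult.assoc)

lemma scale_mult_right: "f * scale c g = scale c (f * g)"
  for f g :: "'x::monoid_add \<Rightarrow>\<^sub>0 rat"
proof (induction f rule: poly_mapping_single_add_induct)
  case (single u a)
  show ?case
    by (induction g rule: poly_mapping_single_add_induct)
      (simp_all add: mult_single mult.left_commute scale_add distrib_left)
qed (simp add: distrib_right scale_add)

definition lin_ext :: "('x \<Rightarrow> ('y \<Rightarrow>\<^sub>0 rat)) \<Rightarrow> ('x \<Rightarrow>\<^sub>0 rat) \<Rightarrow> ('y \<Rightarrow>\<^sub>0 rat)" where
  "lin_ext \<phi> f = (\<Sum>u\<in>keys f. scale (lookup f u) (\<phi> u))"

lemma lin_ext_superset:
  "finite S \<Longrightarrow> keys f \<subseteq> S \<Longrightarrow> lin_ext \<phi> f = (\<Sum>u\<in>S. scale (lookup f u) (\<phi> u))"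
  unfolding lin_ext_def by (rule sum.mono_neutral_left) (auto simp: in_keys_iff)

lemma lin_ext_add: "lin_ext \<phi> (f + g) = lin_ext \<phi> f + lin_ext \<phi> g"
  using lin_ext_superset[of "keys f \<union> keys g" "f + g" \<phi>] lin_ext_superset[of "keys f \<union> keys g" f \<phi>]
    lin_ext_superset[of "keys f \<union> keys g" g \<phi>] Poly_Mapping.keys_add[of f g]
  by (simp add: lookup_add scale_add_left sum.distrib)

lemma lin_ext_single [simp]: "lin_ext \<phi> (single u c) = scale c (\<phi> u)"
  by (cases "c = 0") (simp_all add: lin_ext_def)

lemma lin_ext_zero [simp]: "lin_ext \<phi> 0 = 0" by (simp add: lin_ext_def)

lemma lin_ext_scale: "lin_ext \<phi> (scale c f) = scale c (lin_ext \<phi> f)"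
  by (induction f rule: poly_mapping_single_add_induct) (simp_all add: scale_add lin_ext_add)

lemma lin_ext_diff: "lin_ext \<phi> (f - g) = lin_ext \<phi> f - lin_ext \<phi> g"
  using lin_ext_add[of \<phi> "f - g" g] by (simp add: algebra_simps)

lemma lin_ext_sum: "lin_ext \<phi> (sum f A) = (\<Sum>x\<in>A. lin_ext \<phi> (f x))"
  by (induction A rule: infinite_finite_induct) (simp_all add: lin_ext_add)

section \<open>Evaluation of brackets in the free algebra on the generators\<close>

lemma incl_eq: "incl = lin_ext letter"
  by (simp add: fun_eq_iff incl_def lin_ext_def)

lemma bracket_eq: "bracket f g = lin_ext (\<lambda>u. lin_ext (\<lambda>v. single (Br u v) 1) g) f"
  unfolding bracket_def lin_ext_def by (simp add: scale_sum)

lemma bracket_simps: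
  "bracket (f + f') g = bracket f g + bracket f' g"
  "bracket f (g + g') = bracket f g + bracket f g'"
  "bracket (single u c) (single v d) = single (Br u v) (c * d)"
  unfolding bracket_eq
  by (simp_all add: lin_ext_add) (induction f rule: poly_mapping_single_add_induct, simp_all add: lin_ext_add scale_add add_ac)

text \<open>The commutators are formed in the tensor algebra itself, where the free algebra on the
  generators is the span of the words whose letters are all of the form \<open>Gen x\<close>. An
  element and its expansion can then be compared modulo \<open>enveloping_ideal\<close>.\<close>

primrec lie_expand :: "('i::finite, 'a) pre_digraph \<Rightarrow> 'i gen lie_word \<Rightarrow> 'i tensor_alg" where
  "lie_expand Q (Gen x) = letter (Gen x)"
| "lie_expand Q (Br u v) = lie_expand Q u * lie_expand Q v
     - scale (braid_sign Q (lie_degree u) (lie_degree v)) (lie_expand Q v * lie_expand Q u)"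

definition word_expand :: "('i::finite, 'a) pre_digraph \<Rightarrow> 'i gen lie_word tensor_word \<Rightarrow> 'i tensor_alg" where
  "word_expand Q w = prod_list (map (lie_expand Q) (letters w))"

text \<open>The algebra endomorphism extending \<open>lie_expand\<close>. It fixes the words in
  generators (\<open>expand_gen_word\<close>), hence is a projection onto their span.\<close>

definition expand :: "('i::finite, 'a) pre_digraph \<Rightarrow> 'i tensor_alg \<Rightarrow> 'i tensor_alg" where
  "expand Q = lin_ext (word_expand Q)"

lemma expand_linear:
  "expand Q (f + g) = expand Q f + expand Q g"
  "expand Q (f - g) = expand Q f - expand Q g"
  "expand Q (scale c f) = scale c (expand Q f)"
  "expand Q 0 = 0"
  "expand Q (single w c) = scale c (word_expand Q w)"
  by (simp_all add: expand_def lin_ext_add lin_ext_diff lin_ext_scale)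

lemma word_expand_add: "word_expand Q (v + w) = word_expand Q v * word_expand Q w"
  by (simp add: word_expand_def plus_tensor_word_def)

lemma expand_mult: "expand Q (f * g) = expand Q f * expand Q g"
proof (induction f rule: poly_mapping_single_add_induct)
  case (single u a)
  show ?case
    by (induction g rule: poly_mapping_single_add_induct)
      (simp_all add: mult_single expand_linear word_expand_add scale_mult_left scale_mult_right distrib_left scale_add mult.commute)
qed (simp add: distrib_right expand_linear)

lemma expand_letter: "expand Q (letter u) = lie_expand Q u"
  by (simp add: letter_def expand_linear word_expand_def)

definition gen_word :: "'i gen list \<Rightarrow> 'i tensor_alg" where
  "gen_word xs = single (Word (map Gen xs)) 1"

lemma gen_word_append: "gen_word (xs @ ys) = gen_word xs * gen_word ys"
  by (simp add: gen_word_def mult_single plus_tensor_word_def)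

lemma gen_word_Nil: "gen_word [] = 1"
  by (simp add: gen_word_def zero_tensor_word_def[symmetric])

lemma gen_word_single: "gen_word [x] = letter (Gen x)"
  by (simp add: gen_word_def letter_def)

text \<open>The conditions on \<open>\<theta>\<close> to be of the form \<open>\<xi> (i\<^sub>1(n\<^sub>1) \<dots> i\<^sub>p(n\<^sub>p) \<one>)\<close> for a functional \<open>\<xi>\<close>.\<close>

definition correlator :: "('i::finite, 'a) pre_digraph \<Rightarrow> ('i gen list \<Rightarrow> rat) \<Rightarrow> bool" where
  "correlator Q \<theta> \<longleftrightarrow>
     (\<forall>x y i j m n. (\<Sum>k=0..locality_pos Q i j. (-1) ^ k * of_nat (locality_pos Q i j choose k) *
        (\<theta> (x @ [(i, m - int k), (j, n + int k)] @ y)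
         - braid_sign Q (basis_vec i) (basis_vec j) * \<theta> (x @ [(j, n + int k), (i, m - int k)] @ y))) = 0) \<and>
     (\<forall>x i n. n \<ge> 0 \<longrightarrow> \<theta> (x @ [(i, n)]) = 0)"

definition gens_of :: "'i gen lie_word tensor_word \<Rightarrow> 'i gen list" where
  "gens_of w = (SOME xs. letters w = map Gen xs)"

text \<open>By the default 0, factors with a bracket letter contribute nothing, so that the
  two-sided test in \<open>radical\<close> reduces to words in generators.\<close>

definition word_fun :: "('i gen list \<Rightarrow> rat) \<Rightarrow> 'i gen lie_word tensor_word \<Rightarrow> rat" where
  "word_fun \<theta> w = (if letters w \<in> range (map Gen) then \<theta> (gens_of w) else 0)"

lemma map_Gen_eq: "map Gen xs = map Gen ys \<longleftrightarrow> xs = ys"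
  by (simp add: inj_map_eq_map inj_def)

lemma word_fun_gen [simp]: "word_fun \<theta> (Word (map Gen xs)) = \<theta> xs"
proof -
  have "gens_of (Word (map Gen xs)) = xs"
    unfolding gens_of_def by (rule some_equality) (auto simp: map_Gen_eq)
  thus ?thesis by (simp add: word_fun_def)
qed

lemma word_fun_nongen:
  "us \<notin> range (map Gen) \<Longrightarrow> word_fun \<theta> (Word us) = 0"
  by (simp add: word_fun_def)

lemma map_Gen_append_iff: "us @ vs \<in> range (map Gen) \<longleftrightarrow> us \<in> range (map Gen) \<and> vs \<in> range (map Gen)"
  by (auto simp: image_iff append_eq_map_conv)

definition pairing :: "('i gen list \<Rightarrow> rat) \<Rightarrow> 'i tensor_alg \<Rightarrow> rat" where
  "pairing \<theta> f = (\<Sum>w\<in>keys f. lookup f w * word_fun \<theta> w)"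

lemma pairing_superset:
  "finite S \<Longrightarrow> keys f \<subseteq> S \<Longrightarrow> pairing \<theta> f = (\<Sum>w\<in>S. lookup f w * word_fun \<theta> w)"
  unfolding pairing_def by (rule sum.mono_neutral_left) (auto simp: in_keys_iff)

lemma pairing_add: "pairing \<theta> (f + g) = pairing \<theta> f + pairing \<theta> g"
  using pairing_superset[of "keys f \<union> keys g" "f + g" \<theta>] pairing_superset[of "keys f \<union> keys g" f \<theta>]
    pairing_superset[of "keys f \<union> keys g" g \<theta>] Poly_Mapping.keys_add[of f g]
  by (simp add: lookup_add distrib_right sum.distrib)

lemma pairing_single [simp]: "pairing \<theta> (single w c) = c * word_fun \<theta> w"
  by (cases "c = 0") (simp_all add: pairing_def)

lemma pairing_zero [simp]: "pairing \<theta> 0 = 0" by (simp add: pairing_def)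

lemma pairing_scale: "pairing \<theta> (scale c f) = c * pairing \<theta> f"
  by (induction f rule: poly_mapping_single_add_induct) (simp_all add: scale_add pairing_add distrib_left)

lemma pairing_diff: "pairing \<theta> (f - g) = pairing \<theta> f - pairing \<theta> g"
  using pairing_add[of \<theta> "f - g" g] by (simp add: algebra_simps)

lemma pairing_sum: "pairing \<theta> (sum f A) = (\<Sum>x\<in>A. pairing \<theta> (f x))"
  by (induction A rule: infinite_finite_induct) (simp_all add: pairing_add)

definition locality_element :: "('i::finite, 'a) pre_digraph \<Rightarrow> 'i \<Rightarrow> 'i \<Rightarrow> int \<Rightarrow> int \<Rightarrow> 'i tensor_alg" where
  "locality_element Q i j m n = (\<Sum>k=0..locality_pos Q i j.
     scale ((-1) ^ k * of_nat (locality_pos Q i j choose k))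
       (lie_expand Q (Br (Gen (i, m - int k)) (Gen (j, n + int k)))))"

text \<open>The largest two-sided ideal inside the kernel of \<open>pairing \<theta>\<close>. The
  factors \<open>x\<close> and \<open>y\<close> reproduce the contexts in the first condition of
  \<open>correlator\<close>.\<close>

definition radical :: "('i gen list \<Rightarrow> rat) \<Rightarrow> 'i tensor_alg set" where
  "radical \<theta> = {a. \<forall>x y. pairing \<theta> (x * a * y) = 0}"

lemma radical_ideal:
  "0 \<in> radical \<theta>"
  "a \<in> radical \<theta> \<Longrightarrow> b \<in> radical \<theta> \<Longrightarrow> a + b \<in> radical \<theta>"
  "a \<in> radical \<theta> \<Longrightarrow> b \<in> radical \<theta> \<Longrightarrow> a - b \<in> radical \<theta>"
  "a \<in> radical \<theta> \<Longrightarrow> scale c a \<in> radical \<theta>"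
  "a \<in> radical \<theta> \<Longrightarrow> x * a \<in> radical \<theta>"
  "a \<in> radical \<theta> \<Longrightarrow> a * x \<in> radical \<theta>"
proof -
  show "a \<in> radical \<theta> \<Longrightarrow> x * a \<in> radical \<theta>"
    unfolding radical_def by (auto simp: mult.assoc[symmetric])
  show "a \<in> radical \<theta> \<Longrightarrow> a * x \<in> radical \<theta>"
    unfolding radical_def by (auto simp: mult.assoc)
qed (simp_all add: radical_def pairing_add pairing_diff pairing_scale distrib_left distrib_right
    left_diff_distrib right_diff_distrib scale_mult_left scale_mult_right)

lemma radical_sum: "(\<And>x. x \<in> A \<Longrightarrow> f x \<in> radical \<theta>) \<Longrightarrow> sum f A \<in> radical \<theta>"
  by (induction A rule: infinite_finite_induct) (auto intro: radical_ideal)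

lemma pairing_zero_by_words:
  assumes "\<And>u. pairing \<theta> (single (Word u) 1 * a) = 0"
  shows "pairing \<theta> (x * a) = 0"
proof (induction x rule: poly_mapping_single_add_induct)
  case (single w c)
  have "single w c * a = scale c (single (Word (letters w)) 1 * a)"
    by (simp add: scale_mult_left[symmetric])
  thus ?case using assms[of "letters w"] by (simp add: pairing_scale)
qed (simp add: distrib_right pairing_add)

lemma radicalI:
  assumes "\<And>u v. pairing \<theta> (single (Word u) 1 * a * single (Word v) 1) = 0"
  shows "a \<in> radical \<theta>"
  unfolding radical_def
proof (intro CollectI allI)
  fix x y show "pairing \<theta> (x * a * y) = 0"
  proof (induction y rule: poly_mapping_single_add_induct)
    case (single w c)
    have "pairing \<theta> (x * (a * single (Word (letters w)) 1)) = 0"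
      by (rule pairing_zero_by_words) (use assms[of _ "letters w"] in \<open>simp add: mult.assoc\<close>)
    moreover have "x * a * single w c = scale c (x * (a * single (Word (letters w)) 1))"
      by (simp add: mult.assoc scale_mult_right[symmetric])
    ultimately show ?case by (simp add: pairing_scale)
  qed (simp add: distrib_left pairing_add)
qed

lemma locality_element_radical:
  assumes "correlator Q \<theta>"
  shows "locality_element Q i j m n \<in> radical \<theta>"
proof (rule radicalI)
  fix u v
  let ?s = "braid_sign Q (basis_vec i) (basis_vec j)"
  have e: "pairing \<theta> (single (Word u) 1 * lie_expand Q (Br (Gen (i, a)) (Gen (j, b))) * single (Word v) 1) =
     word_fun \<theta> (Word (u @ [Gen (i, a), Gen (j, b)] @ v)) - ?s * word_fun \<theta> (Word (u @ [Gen (j, b), Gen (i, a)] @ v))" for a b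
    by (simp add: letter_def mult_single plus_tensor_word_def left_diff_distrib right_diff_distrib
        pairing_diff pairing_scale scale_mult_left scale_mult_right)
  show "pairing \<theta> (single (Word u) 1 * locality_element Q i j m n * single (Word v) 1) = 0"
  proof (cases "u \<in> range (map Gen) \<and> v \<in> range (map Gen)")
    case True
    then obtain x y where xy: "u = map Gen x" "v = map Gen y" by auto
    have w: "word_fun \<theta> (Word (u @ [Gen g, Gen h] @ v)) = \<theta> (x @ [g, h] @ y)" for g h
      using word_fun_gen[of \<theta> "x @ [g, h] @ y"] by (simp add: xy)
    show ?thesis
      using assms
      by (simp add: locality_element_def sum_distrib_left sum_distrib_right pairing_sum scale_mult_left
          scale_mult_right pairing_scale e w correlator_def del: lie_expand.simps append.simps)
  next
    case False
    hence "word_fun \<theta> (Word (u @ z @ v)) = 0" for z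
      by (simp add: word_fun_nongen map_Gen_append_iff)
    thus ?thesis
      by (simp add: locality_element_def sum_distrib_left sum_distrib_right pairing_sum scale_mult_left
          scale_mult_right pairing_scale e del: lie_expand.simps append.simps)
  qed
qed

text \<open>Ideals of the free non-associative algebra need not be graded by definition; testing membership
  on each homogeneous component makes the preimage of the radical a Lie ideal.\<close>

definition lie_component :: "('i::finite, 'a) pre_digraph \<Rightarrow> ('i \<Rightarrow> int) \<Rightarrow> 'i pre_lie \<Rightarrow> 'i tensor_alg" where
  "lie_component Q \<delta> = lin_ext (\<lambda>u. if lie_degree u = \<delta> then lie_expand Q u else 0)"

lemma expand_incl: "expand Q (incl f) = lin_ext (lie_expand Q) f"
  unfolding incl_eq
  by (induction f rule: poly_mapping_single_add_induct)
     (simp_all add: lin_ext_add expand_linear expand_letter)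

lemma expand_incl_components:
  "expand Q (incl f) = (\<Sum>\<delta>\<in>lie_degree ` keys f. lie_component Q \<delta> f)"
proof -
  have "(\<Sum>\<delta>\<in>lie_degree ` keys f. lie_component Q \<delta> f) =
    (\<Sum>u\<in>keys f. \<Sum>\<delta>\<in>lie_degree ` keys f. if lie_degree u = \<delta> then scale (lookup f u) (lie_expand Q u) else 0)"
    unfolding lie_component_def lin_ext_def by (subst sum.swap) (intro sum.cong refl, auto)
  also have "\<dots> = (\<Sum>u\<in>keys f. scale (lookup f u) (lie_expand Q u))"
    by (intro sum.cong refl) (simp add: sum.delta')
  finally show ?thesis by (simp add: expand_incl lin_ext_def)
qed

text \<open>On a single degree the braiding sign is a common factor, so the bracket with
  \<open>v\<close> becomes a braided commutator of the component. For inhomogeneous \<open>f\<close>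
  the signs would differ from term to term.\<close>

lemma lie_component_bracket_right:
  "lie_component Q \<delta> (bracket f (single v c)) = scale c
     (lie_component Q (\<lambda>i. \<delta> i - lie_degree v i) f * lie_expand Q v
      - scale (braid_sign Q (\<lambda>i. \<delta> i - lie_degree v i) (lie_degree v))
         (lie_expand Q v * lie_component Q (\<lambda>i. \<delta> i - lie_degree v i) f))"
proof (induction f rule: poly_mapping_single_add_induct)
  case (single u d)
  have "(\<lambda>i. lie_degree u i + lie_degree v i) = \<delta> \<longleftrightarrow> lie_degree u = (\<lambda>i. \<delta> i - lie_degree v i)"
    by (simp add: fun_eq_iff eq_diff_eq add.commute)
  moreover have "(\<lambda>i. \<delta> i - lie_degree v i) = lie_degree u \<longleftrightarrow> lie_degree u = (\<lambda>i. \<delta> i - lie_degree v i)" by auto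
  ultimately show ?case
    by (cases "lie_degree u = (\<lambda>i. \<delta> i - lie_degree v i)")
      (simp_all add: bracket_simps(3) lie_component_def scale_mult_left scale_mult_right scale_diff mult_ac)
next
  case (add f g)
  thus ?case
    by (simp add: bracket_simps lie_component_def lin_ext_add distrib_left distrib_right scale_add scale_diff)
qed

lemma lie_component_bracket_left:
  "lie_component Q \<delta> (bracket (single v c) f) = scale c
     (lie_expand Q v * lie_component Q (\<lambda>i. \<delta> i - lie_degree v i) f
      - scale (braid_sign Q (lie_degree v) (\<lambda>i. \<delta> i - lie_degree v i))
         (lie_component Q (\<lambda>i. \<delta> i - lie_degree v i) f * lie_expand Q v))"
proof (induction f rule: poly_mapping_single_add_induct)
  case (single u d)
  have "(\<lambda>i. lie_degree v i + lie_degree u i) = \<delta> \<longleftrightarrow> lie_degree u = (\<lambda>i. \<delta> i - lie_degree v i)"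
    by (simp add: fun_eq_iff eq_diff_eq add.commute)
  moreover have "(\<lambda>i. \<delta> i - lie_degree v i) = lie_degree u \<longleftrightarrow> lie_degree u = (\<lambda>i. \<delta> i - lie_degree v i)" by auto
  ultimately show ?case
    by (cases "lie_degree u = (\<lambda>i. \<delta> i - lie_degree v i)")
      (simp_all add: bracket_simps(3) lie_component_def scale_mult_left scale_mult_right scale_diff mult_ac)
next
  case (add f g)
  thus ?case
    by (simp add: bracket_simps(1,2) lie_component_def lin_ext_add distrib_left distrib_right scale_add scale_diff)
qed

definition lie_radical :: "('i::finite, 'a) pre_digraph \<Rightarrow> ('i gen list \<Rightarrow> rat) \<Rightarrow> 'i pre_lie set" where
  "lie_radical Q \<theta> = {f. \<forall>\<delta>. lie_component Q \<delta> f \<in> radical \<theta>}"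

lemma lie_radical_ideal: "is_lie_ideal (lie_radical Q \<theta>)"
  unfolding is_lie_ideal_def
proof (intro conjI ballI allI)
  show "is_subspace (lie_radical Q \<theta>)"
    unfolding is_subspace_def lie_radical_def
    by (simp add: lie_component_def lin_ext_add lin_ext_scale radical_ideal)
next
  fix f g assume f: "f \<in> lie_radical Q \<theta>"
  show "bracket f g \<in> lie_radical Q \<theta>"
  proof (induction g rule: poly_mapping_single_add_induct)
    case (single v c)
    show ?case using f by (simp add: lie_radical_def lie_component_bracket_right radical_ideal)
  next
    case (add g h)
    thus ?case by (simp add: lie_radical_def bracket_simps(2) lie_component_def lin_ext_add radical_ideal)
  qed
  show "bracket g f \<in> lie_radical Q \<theta>"
  proof (induction g rule: poly_mapping_single_add_induct)
    case (single v c)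
    show ?case using f by (simp add: lie_radical_def lie_component_bracket_left radical_ideal)
  next
    case (add g h)
    thus ?case by (simp add: lie_radical_def bracket_simps(1) lie_component_def lin_ext_add radical_ideal)
  qed
qed

lemma lie_component_homogeneous:
  assumes "\<And>u. u \<in> keys f \<Longrightarrow> lie_degree u = d"
  shows "lie_component Q \<delta> f = (if \<delta> = d then lin_ext (lie_expand Q) f else 0)"
  unfolding lie_component_def lin_ext_def using assms by (auto intro!: sum.neutral)

lemma lie_radicalI:
  assumes "\<And>u. u \<in> keys f \<Longrightarrow> lie_degree u = d" and "lin_ext (lie_expand Q) f \<in> radical \<theta>"
  shows "f \<in> lie_radical Q \<theta>"
  using assms(2) lie_component_homogeneous[of f d Q] assms(1) by (simp add: lie_radical_def radical_ideal)

lemma lie_relations_radical: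
  assumes Q: "symmetric_quiver Q" and \<theta>: "correlator Q \<theta>"
  shows "lie_relations Q \<subseteq> lie_radical Q \<theta>"
  unfolding lie_relations_def
proof (rule hull_minimal, intro Un_least subsetI)
  fix f assume "f \<in> antisymmetry_relations Q"
  then obtain u v where f: "f = single (Br u v) 1 + single (Br v u) (braid_sign Q (lie_degree u) (lie_degree v))"
    unfolding antisymmetry_relations_def by blast
  \<comment> \<open>The signs for \<open>(u, v)\<close> and \<open>(v, u)\<close> agree because the
    Euler form is symmetric, and their product is 1.\<close>
  have "lin_ext (lie_expand Q) f = 0"
    using braid_sign_cases[of Q "lie_degree u" "lie_degree v"] braid_sign_commute[OF Q, of "lie_degree u" "lie_degree v"]
    by (auto simp: f lin_ext_add scale_diff scale_minus_one)
  moreover have "lie_degree w = lie_degree (Br u v)" if "w \<in> keys f" for w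
  proof -
    have "w \<in> {Br u v, Br v u}"
      using that by (auto simp: f in_keys_iff lookup_add lookup_single_if split: if_splits)
    thus ?thesis by (auto simp: add.commute)
  qed
  ultimately show "f \<in> lie_radical Q \<theta>"
    by (intro lie_radicalI[where d = "lie_degree (Br u v)"]) (simp_all only: radical_ideal(1))
next
  fix f assume "f \<in> jacobi_relations Q"
  then obtain u v w where f: "f = single (Br u (Br v w)) 1 - single (Br (Br u v) w) 1
        - single (Br v (Br u w)) (braid_sign Q (lie_degree u) (lie_degree v))"
    unfolding jacobi_relations_def by blast
  have s: "braid_sign Q (lie_degree v) (lie_degree u) = braid_sign Q (lie_degree u) (lie_degree v)"
    by (rule braid_sign_commute[OF Q])
  \<comment> \<open>The signs are multiplicative in each argument, so those of the three pairs
    determine all others; in each of the eight cases the terms cancel by associativity.\<close>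
  have "lin_ext (lie_expand Q) f = 0"
    using braid_sign_cases[of Q "lie_degree u" "lie_degree v"] braid_sign_cases[of Q "lie_degree u" "lie_degree w"]
      braid_sign_cases[of Q "lie_degree v" "lie_degree w"]
    unfolding f
    by (elim disjE) (simp_all add: lin_ext_add lin_ext_diff scale_diff scale_minus_one scale_add scale_uminus braid_sign_add_left braid_sign_add_right
      scale_mult_left scale_mult_right s algebra_simps)
  moreover have "lie_degree x = lie_degree (Br u (Br v w))" if "x \<in> keys f" for x
  proof -
    have "x \<in> {Br u (Br v w), Br (Br u v) w, Br v (Br u w)}"
      using that by (auto simp: f in_keys_iff lookup_minus lookup_single_if split: if_splits)
    thus ?thesis by (auto simp: algebra_simps)
  qed
  ultimately show "f \<in> lie_radical Q \<theta>"
    by (intro lie_radicalI[where d = "lie_degree (Br u (Br v w))"]) (simp_all only: radical_ideal(1))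
next
  fix f assume "f \<in> locality_relations Q"
  then obtain i j m n where f: "f = (\<Sum>k=0..locality_pos Q i j.
         single (Br (Gen (i, m - int k)) (Gen (j, n + int k)))
           ((-1) ^ k * of_nat (locality_pos Q i j choose k)))"
    unfolding locality_relations_def by blast
  have "lin_ext (lie_expand Q) f = locality_element Q i j m n"
    unfolding f locality_element_def by (simp add: lin_ext_sum)
  moreover have "lie_degree x = (\<lambda>k. basis_vec i k + basis_vec j k)" if "x \<in> keys f" for x
  proof -
    have "x \<in> (\<Union>k\<in>{0..locality_pos Q i j}. keys (single (Br (Gen (i, m - int k)) (Gen (j, n + int k)))
           ((-1) ^ k * of_nat (locality_pos Q i j choose k) :: rat)))"
      using that[unfolded f] by (rule subsetD[OF Poly_Mapping.keys_sum])
    then obtain k where "x \<in> keys (single (Br (Gen (i, m - int k)) (Gen (j, n + int k)))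
        ((-1) ^ k * of_nat (locality_pos Q i j choose k) :: rat))" by blast
    hence "x = Br (Gen (i, m - int k)) (Gen (j, n + int k))" by (simp split: if_splits)
    thus ?thesis by simp
  qed
  ultimately show "f \<in> lie_radical Q \<theta>"
    using locality_element_radical[OF \<theta>] by (intro lie_radicalI[where d = "\<lambda>k. basis_vec i k + basis_vec j k"]) simp_all
qed (rule lie_radical_ideal)

section \<open>Descent of correlators to functionals on the module\<close>

lemma is_ideal_INT: "(\<And>J. J \<in> F \<Longrightarrow> is_ideal J) \<Longrightarrow> is_ideal (\<Inter>F)"
  unfolding is_ideal_def by blast

lemma is_left_ideal_INT: "(\<And>J. J \<in> F \<Longrightarrow> is_left_ideal J) \<Longrightarrow> is_left_ideal (\<Inter>F)"
  unfolding is_left_ideal_def by blast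

lemma enveloping_ideal: "is_ideal (enveloping_ideal Q)"
  unfolding enveloping_ideal_def by (rule hull_in) (blast intro: is_ideal_INT)

lemma vacuum_ideal: "is_left_ideal (vacuum_ideal Q)"
  unfolding vacuum_ideal_def by (rule hull_in) (blast intro: is_left_ideal_INT)

lemma enveloping_subset_vacuum: "enveloping_ideal Q \<subseteq> vacuum_ideal Q"
  unfolding vacuum_ideal_def by (meson hull_subset le_sup_iff)

text \<open>Expansion sends the commutator relations of the enveloping algebra to 0 and the Lie
  relations into \<open>radical\<close>, degree by degree.\<close>

lemma enveloping_ideal_radical:
  assumes Q: "symmetric_quiver Q" and \<theta>: "correlator Q \<theta>" and a: "a \<in> enveloping_ideal Q"
  shows "expand Q a \<in> radical \<theta>"
proof -
  have "enveloping_ideal Q \<subseteq> {a. expand Q a \<in> radical \<theta>}"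
    unfolding enveloping_ideal_def
  proof (rule hull_minimal, intro Un_least subsetI)
    fix a assume "a \<in> incl ` lie_relations Q"
    then obtain f where f: "f \<in> lie_relations Q" "a = incl f" by blast
    have "f \<in> lie_radical Q \<theta>" using f lie_relations_radical[OF Q \<theta>] by blast
    thus "a \<in> {a. expand Q a \<in> radical \<theta>}"
      by (simp add: f(2) expand_incl_components lie_radical_def radical_sum)
  next
    fix a assume "a \<in> {letter u * letter v
         - scale (braid_sign Q (lie_degree u) (lie_degree v)) (letter v * letter u)
         - letter (Br u v) | u v. True}"
    hence "expand Q a = 0" by (auto simp: expand_linear expand_mult expand_letter)
    thus "a \<in> {a. expand Q a \<in> radical \<theta>}" by (simp add: radical_ideal)
  next
    show "is_ideal {a. expand Q a \<in> radical \<theta>}"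
      by (simp add: is_ideal_def expand_linear expand_mult radical_ideal)
  qed
  thus ?thesis using a by blast
qed

text \<open>The test set multiplies on the left only: \<open>vacuum_ideal\<close> is a left ideal,
  and the vanishing condition in \<open>correlator\<close> concerns the last letter of a
  word.\<close>

lemma vacuum_ideal_pairing:
  assumes Q: "symmetric_quiver Q" and \<theta>: "correlator Q \<theta>" and a: "a \<in> vacuum_ideal Q"
  shows "pairing \<theta> (expand Q a) = 0"
proof -
  let ?W = "{a. \<forall>x. pairing \<theta> (x * expand Q a) = 0}"
  have "vacuum_ideal Q \<subseteq> ?W"
    unfolding vacuum_ideal_def
  proof (rule hull_minimal, intro Un_least subsetI)
    fix a assume "a \<in> enveloping_ideal Q"
    hence "expand Q a \<in> radical \<theta>" by (rule enveloping_ideal_radical[OF Q \<theta>])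
    hence "pairing \<theta> (x * expand Q a * 1) = 0" for x unfolding radical_def by blast
    thus "a \<in> ?W" by simp
  next
    fix a :: "'a tensor_alg" assume "a \<in> {letter (Gen (i, n)) | i n. n \<ge> 0}"
    then obtain i n where a: "a = letter (Gen (i, n))" "n \<ge> 0" by blast
    have e: "expand Q a = single (Word [Gen (i, n)]) 1"
      by (simp add: a(1) expand_letter) (simp add: letter_def)
    have "pairing \<theta> (single (Word u) 1 * expand Q a) = 0" for u
    proof (cases "u \<in> range (map Gen)")
      case True
      then obtain x where x: "u = map Gen x" by auto
      have "word_fun \<theta> (Word (u @ [Gen (i, n)])) = \<theta> (x @ [(i, n)])"
        using word_fun_gen[of \<theta> "x @ [(i, n)]"] by (simp add: x)
      thus ?thesis using \<theta> a(2) by (simp add: e mult_single plus_tensor_word_def correlator_def)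
    next
      case False
      hence "word_fun \<theta> (Word (u @ [Gen (i, n)])) = 0"
        by (simp add: word_fun_nongen map_Gen_append_iff)
      thus ?thesis by (simp add: e mult_single plus_tensor_word_def)
    qed
    thus "a \<in> ?W" using pairing_zero_by_words by blast
  next
    show "is_left_ideal ?W"
      by (simp add: is_left_ideal_def expand_linear expand_mult distrib_left pairing_add mult.assoc[symmetric])
  qed
  hence "pairing \<theta> (1 * expand Q a) = 0" using a by blast
  thus ?thesis by simp
qed

lemma vacuum_ideal_diff: "a \<in> vacuum_ideal Q \<Longrightarrow> b \<in> vacuum_ideal Q \<Longrightarrow> a - b \<in> vacuum_ideal Q"
  using vacuum_ideal[of Q] unfolding is_left_ideal_def
  by (metis add_uminus_conv_diff mult_minus1)

lemma pcls_self: "u \<in> pcls Q u"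
  using vacuum_ideal[of Q] by (simp add: pcls_def coset_def is_left_ideal_def)

lemma pcls_eq_iff: "pcls Q u = pcls Q v \<longleftrightarrow> u - v \<in> vacuum_ideal Q"
proof
  assume "pcls Q u = pcls Q v"
  hence "v \<in> pcls Q u" using pcls_self by simp
  thus "u - v \<in> vacuum_ideal Q" by (simp add: pcls_def coset_def)
next
  assume h: "u - v \<in> vacuum_ideal Q"
  have "v - w \<in> vacuum_ideal Q" if "u - w \<in> vacuum_ideal Q" for w
    using vacuum_ideal_diff[OF that h] by simp
  moreover have "u - w \<in> vacuum_ideal Q" if "v - w \<in> vacuum_ideal Q" for w
  proof -
    have "(v - w) + (u - v) \<in> vacuum_ideal Q"
      using that h vacuum_ideal[of Q] by (simp only: is_left_ideal_def)
    thus ?thesis by simp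
  qed
  ultimately have "u - w \<in> vacuum_ideal Q \<longleftrightarrow> v - w \<in> vacuum_ideal Q" for w by blast
  thus "pcls Q u = pcls Q v" by (auto simp: pcls_def coset_def)
qed

definition functional_of ::
  "('i::finite, 'a) pre_digraph \<Rightarrow> ('i gen list \<Rightarrow> rat) \<Rightarrow> 'i tensor_alg set \<Rightarrow> rat" where
  "functional_of Q \<theta> X = (if X \<in> principal Q then pairing \<theta> (expand Q (SOME u. u \<in> X)) else 0)"

text \<open>Two representatives differ by an element of \<open>vacuum_ideal\<close>, which the
  pairing does not see, so the choice in \<open>functional_of\<close> is harmless.\<close>

lemma functional_of_pcls:
  assumes Q: "symmetric_quiver Q" and \<theta>: "correlator Q \<theta>"
  shows "functional_of Q \<theta> (pcls Q u) = pairing \<theta> (expand Q u)"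
proof -
  define v where "v = (SOME v. v \<in> pcls Q u)"
  have "v \<in> pcls Q u" unfolding v_def by (rule someI[of _ u]) (rule pcls_self)
  hence "u - v \<in> vacuum_ideal Q" by (simp add: pcls_def coset_def)
  hence "pairing \<theta> (expand Q (u - v)) = 0" by (rule vacuum_ideal_pairing[OF Q \<theta>])
  thus ?thesis unfolding functional_of_def v_def[symmetric]
    by (simp add: principal_def expand_linear pairing_diff)
qed

lemma functional_of_functionals:
  assumes "symmetric_quiver Q" "correlator Q \<theta>"
  shows "functional_of Q \<theta> \<in> functionals Q"
  unfolding functionals_def using functional_of_pcls[OF assms]
  by (auto simp: expand_linear pairing_add pairing_scale functional_of_def)

definition correlator_of ::
  "('i::finite, 'a) pre_digraph \<Rightarrow> ('i tensor_alg set \<Rightarrow> rat) \<Rightarrow> 'i gen list \<Rightarrow> rat" where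
  "correlator_of Q \<xi> xs = \<xi> (pcls Q (gen_word xs))"

lemma expand_gen_word: "expand Q (gen_word xs) = gen_word xs"
proof (induction xs)
  case Nil
  show ?case
    using expand_linear(5)[of Q "0 :: 'a gen lie_word tensor_word" 1]
    by (simp add: gen_word_Nil word_expand_def) (simp add: zero_tensor_word_def)
next
  case (Cons x xs)
  have "gen_word (x # xs) = letter (Gen x) * gen_word xs"
    using gen_word_append[of "[x]" xs] by (simp add: gen_word_single)
  thus ?case using Cons by (simp add: expand_mult expand_letter)
qed

lemma correlator_of_functional_of:
  assumes "symmetric_quiver Q" "correlator Q \<theta>"
  shows "correlator_of Q (functional_of Q \<theta>) = \<theta>"
  by (rule ext) (simp add: correlator_of_def functional_of_pcls[OF assms] expand_gen_word, simp add: gen_word_def)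

section \<open>Reduction of arbitrary elements to words in generators\<close>

lemma enveloping_ideal_closed:
  "0 \<in> enveloping_ideal Q"
  "a \<in> enveloping_ideal Q \<Longrightarrow> b \<in> enveloping_ideal Q \<Longrightarrow> a + b \<in> enveloping_ideal Q"
  "a \<in> enveloping_ideal Q \<Longrightarrow> x * a \<in> enveloping_ideal Q"
  "a \<in> enveloping_ideal Q \<Longrightarrow> a * x \<in> enveloping_ideal Q"
  using enveloping_ideal[of Q] unfolding is_ideal_def by blast+

lemma enveloping_ideal_scale: "a \<in> enveloping_ideal Q \<Longrightarrow> scale c a \<in> enveloping_ideal Q"
  using enveloping_ideal_closed(3)[of a Q "scale c 1"] by (simp only: scale_mult_left mult_1_left)

lemma enveloping_ideal_diff:
  "a \<in> enveloping_ideal Q \<Longrightarrow> b \<in> enveloping_ideal Q \<Longrightarrow> a - b \<in> enveloping_ideal Q"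
  using enveloping_ideal_closed(2)[of a Q "scale (-1) b"] enveloping_ideal_scale[of b Q "-1"]
  by (simp add: scale_minus_one)

text \<open>In the enveloping algebra a bracket is the braided commutator of its entries, so
  unfolding brackets recursively stays in one class.\<close>

lemma letter_minus_expand: "letter u - lie_expand Q u \<in> enveloping_ideal Q"
proof (induction u)
  case (Gen x)
  show ?case by (simp add: enveloping_ideal_closed)
next
  case (Br u v)
  let ?s = "braid_sign Q (lie_degree u) (lie_degree v)"
  let ?E = "enveloping_ideal Q"
  have 1: "letter u * letter v - scale ?s (letter v * letter u) - letter (Br u v) \<in> ?E"
    unfolding enveloping_ideal_def
    by (rule subsetD[OF hull_subset], rule UnI2) blast
  have p: "a * b - c * d \<in> ?E" if "a - c \<in> ?E" "b - d \<in> ?E" for a b c d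
  proof -
    have "a * b - c * d = (a - c) * b + c * (b - d)" by (simp add: algebra_simps)
    thus ?thesis using that by (simp add: enveloping_ideal_closed)
  qed
  have e: "letter (Br u v) - lie_expand Q (Br u v) =
     (letter u * letter v - lie_expand Q u * lie_expand Q v)
      - scale ?s (letter v * letter u - lie_expand Q v * lie_expand Q u)
      - (letter u * letter v - scale ?s (letter v * letter u) - letter (Br u v))"
    by (simp add: scale_diff)
  show ?case unfolding e by (intro enveloping_ideal_diff enveloping_ideal_scale p Br 1)
qed

text \<open>Every element is thus congruent to a combination of words in generators; this is why
  functionals are determined by their values on such words.\<close>

lemma minus_expand: "f - expand Q f \<in> enveloping_ideal Q"
proof (induction f rule: poly_mapping_single_add_induct)
  case (single w c)
  have "single (Word us) 1 - word_expand Q (Word us) \<in> enveloping_ideal Q" for us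
  proof (induction us)
    case Nil
    have "word_expand Q (Word []) = 1" by (simp add: word_expand_def)
    thus ?case by (simp add: zero_tensor_word_def[symmetric] enveloping_ideal_closed)
  next
    case (Cons u us)
    have e: "single (Word (u # us)) 1 - word_expand Q (Word (u # us)) =
      (letter u - lie_expand Q u) * single (Word us) 1 + lie_expand Q u * (single (Word us) 1 - word_expand Q (Word us))"
      by (simp add: word_expand_def letter_def left_diff_distrib right_diff_distrib mult_single plus_tensor_word_def)
    show ?case unfolding e by (intro enveloping_ideal_closed(2-4) Cons letter_minus_expand)
  qed
  hence "scale c (single (Word (letters w)) 1 - word_expand Q (Word (letters w))) \<in> enveloping_ideal Q"
    by (rule enveloping_ideal_scale)
  thus ?case by (simp add: expand_linear scale_diff)
next
  case (add f g)
  thus ?case using enveloping_ideal_closed(2)[OF add] by (simp add: expand_linear algebra_simps)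
qed

definition gen_homogeneous ::
  "('i::finite, 'a) pre_digraph \<Rightarrow> ('i \<Rightarrow> int) \<Rightarrow> rat \<Rightarrow> 'i tensor_alg set" where
  "gen_homogeneous Q \<delta> t =
     {f. \<forall>w\<in>keys f. letters w \<in> range (map Gen) \<and> word_degree w = \<delta> \<and> word_weight Q w = t}"

lemma gen_homogeneous_closed:
  "f \<in> gen_homogeneous Q \<delta> t \<Longrightarrow> g \<in> gen_homogeneous Q \<delta> t \<Longrightarrow> f - g \<in> gen_homogeneous Q \<delta> t"
  "f \<in> gen_homogeneous Q \<delta> t \<Longrightarrow> scale c f \<in> gen_homogeneous Q \<delta> t"
  unfolding gen_homogeneous_def by (fastforce simp: in_keys_iff lookup_minus)+

lemma gen_homogeneous_mult:
  assumes "f \<in> gen_homogeneous Q \<delta> t" "g \<in> gen_homogeneous Q \<epsilon> s"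
  shows "f * g \<in> gen_homogeneous Q (\<lambda>i. \<delta> i + \<epsilon> i) (t + s)"
  unfolding gen_homogeneous_def
proof (intro CollectI ballI)
  fix w assume "w \<in> keys (f * g)"
  then obtain u v where uv: "w = u + v" "u \<in> keys f" "v \<in> keys g" using keys_mult by blast
  have "letters u \<in> range (map Gen)" "letters v \<in> range (map Gen)"
    "word_degree u = \<delta>" "word_degree v = \<epsilon>" "word_weight Q u = t" "word_weight Q v = s"
    using assms uv(2,3) unfolding gen_homogeneous_def by auto
  thus "letters w \<in> range (map Gen) \<and> word_degree w = (\<lambda>i. \<delta> i + \<epsilon> i) \<and> word_weight Q w = t + s"
    by (auto simp: uv(1) plus_tensor_word_def map_Gen_append_iff word_degree_def word_weight_def)
qed

text \<open>Each word of the expansion lists the generators of \<open>u\<close> in some order, and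
  degree and weight are sums over these generators.\<close>

lemma lie_expand_homogeneous: "lie_expand Q u \<in> gen_homogeneous Q (lie_degree u) (lie_weight Q u)"
proof (induction u)
  case (Gen x)
  have "[Gen x] \<in> range (map Gen)" by (rule image_eqI[of _ _ "[x]"]) auto
  thus ?case by (simp add: gen_homogeneous_def letter_def word_degree_def word_weight_def)
next
  case (Br u v)
  show ?case
    using gen_homogeneous_mult[OF Br] gen_homogeneous_mult[OF Br(2,1)]
    by (simp add: gen_homogeneous_closed add.commute)
qed

lemma word_expand_homogeneous: "word_expand Q w \<in> gen_homogeneous Q (word_degree w) (word_weight Q w)"
proof -
  have "word_expand Q (Word us) \<in> gen_homogeneous Q (word_degree (Word us)) (word_weight Q (Word us))" for us
  proof (induction us)
    case Nil
    show ?case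
      by (simp add: word_expand_def gen_homogeneous_def word_degree_def word_weight_def zero_tensor_word_def)
  next
    case (Cons u us)
    thus ?case using gen_homogeneous_mult[OF lie_expand_homogeneous Cons]
      by (simp add: word_expand_def word_degree_def word_weight_def)
  qed
  from this[of "letters w"] show ?thesis by simp
qed

section \<open>Functionals and their correlators\<close>

lemma functional_linear:
  assumes "\<xi> \<in> functionals Q"
  shows "\<xi> (pcls Q (f + g)) = \<xi> (pcls Q f) + \<xi> (pcls Q g)"
    and "\<xi> (pcls Q (scale c f)) = c * \<xi> (pcls Q f)"
    and "\<xi> (pcls Q 0) = 0"
    and "\<xi> (pcls Q (f - g)) = \<xi> (pcls Q f) - \<xi> (pcls Q g)"
    and "\<xi> (pcls Q (sum h A)) = (\<Sum>x\<in>A. \<xi> (pcls Q (h x)))"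
proof -
  show 1: "\<xi> (pcls Q (f + g)) = \<xi> (pcls Q f) + \<xi> (pcls Q g)" for f g
    using assms unfolding functionals_def by blast
  show 2: "\<xi> (pcls Q (scale c f)) = c * \<xi> (pcls Q f)" for c f
    using assms unfolding functionals_def by blast
  show 3: "\<xi> (pcls Q 0) = 0" using 2[of 0 0] by simp
  show "\<xi> (pcls Q (f - g)) = \<xi> (pcls Q f) - \<xi> (pcls Q g)"
    using 1[of "f - g" g] by simp
  show "\<xi> (pcls Q (sum h A)) = (\<Sum>x\<in>A. \<xi> (pcls Q (h x)))"
    by (induction A rule: infinite_finite_induct) (simp_all add: 1 3)
qed

lemma functional_vacuum_ideal:
  assumes "\<xi> \<in> functionals Q" "a \<in> vacuum_ideal Q"
  shows "\<xi> (pcls Q a) = 0"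
proof -
  have "pcls Q a = pcls Q 0" using assms(2) by (simp add: pcls_eq_iff)
  thus ?thesis using functional_linear(3)[OF assms(1)] by simp
qed

lemma functional_eq_pairing:
  assumes \<xi>: "\<xi> \<in> functionals Q"
  shows "\<xi> (pcls Q f) = pairing (correlator_of Q \<xi>) (expand Q f)"
proof -
  have "\<xi> (pcls Q g) = pairing (correlator_of Q \<xi>) g" if g: "\<And>w. w \<in> keys g \<Longrightarrow> letters w \<in> range (map Gen)" for g
  proof -
    have e: "g = (\<Sum>w\<in>keys g. scale (lookup g w) (single w 1))"
      by (rule poly_mapping_eqI) (auto simp: lookup_sum lookup_single_if in_keys_iff sum.delta)
    have "\<xi> (pcls Q g) = (\<Sum>w\<in>keys g. lookup g w * \<xi> (pcls Q (single w 1)))"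
      by (subst e) (simp only: functional_linear(5,2)[OF \<xi>])
    also have "\<dots> = pairing (correlator_of Q \<xi>) g"
      unfolding pairing_def
    proof (intro sum.cong refl arg_cong2[of _ _ _ _ "(*)"])
      fix w assume "w \<in> keys g"
      then obtain xs where "letters w = map Gen xs" using g by blast
      hence w: "w = Word (map Gen xs)" by (metis tensor_word.collapse)
      show "\<xi> (pcls Q (single w 1)) = word_fun (correlator_of Q \<xi>) w"
        unfolding w by (simp add: correlator_of_def gen_word_def)
    qed
    finally show ?thesis .
  qed
  note gens = this
  have w: "\<xi> (pcls Q (word_expand Q w)) = pairing (correlator_of Q \<xi>) (word_expand Q w)" for w
    by (rule gens) (use word_expand_homogeneous[of Q w] in \<open>auto simp: gen_homogeneous_def\<close>)
  have "\<xi> (pcls Q (f - expand Q f)) = 0"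
    using functional_vacuum_ideal[OF \<xi>] minus_expand enveloping_subset_vacuum by blast
  hence "\<xi> (pcls Q f) = \<xi> (pcls Q (expand Q f))" by (simp add: functional_linear(4)[OF \<xi>])
  also have "\<dots> = pairing (correlator_of Q \<xi>) (expand Q f)"
    by (induction f rule: poly_mapping_single_add_induct)
       (simp_all add: expand_linear functional_linear[OF \<xi>] pairing_add pairing_scale w)
  finally show ?thesis .
qed

lemma functional_eqI:
  assumes "\<xi> \<in> functionals Q" "\<eta> \<in> functionals Q" "correlator_of Q \<xi> = correlator_of Q \<eta>"
  shows "\<xi> = \<eta>"
proof
  fix X show "\<xi> X = \<eta> X"
  proof (cases "X \<in> principal Q")
    case True
    then obtain f where "X = pcls Q f" unfolding principal_def by blast
    thus ?thesis using functional_eq_pairing assms by metis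
  next
    case False
    thus ?thesis using assms(1,2) by (simp add: functionals_def)
  qed
qed

lemma locality_element_enveloping: "locality_element Q i j m n \<in> enveloping_ideal Q"
proof -
  define f where "f = (\<Sum>k=0..locality_pos Q i j.
         single (Br (Gen (i, m - int k)) (Gen (j, n + int k)))
           ((-1) ^ k * of_nat (locality_pos Q i j choose k) :: rat))"
  have "f \<in> locality_relations Q" unfolding locality_relations_def f_def by blast
  hence "f \<in> lie_relations Q"
    unfolding lie_relations_def by (intro subsetD[OF hull_subset]) blast
  hence 1: "incl f \<in> enveloping_ideal Q"
    unfolding enveloping_ideal_def by (intro subsetD[OF hull_subset]) blast
  have "locality_element Q i j m n = expand Q (incl f)"
    unfolding expand_incl f_def locality_element_def by (simp add: lin_ext_sum)
  also have "\<dots> = incl f - (incl f - expand Q (incl f))" by simp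
  finally show ?thesis using 1 minus_expand[of "incl f" Q] by (simp only: enveloping_ideal_diff)
qed

lemma correlator_correlator_of:
  assumes \<xi>: "\<xi> \<in> functionals Q"
  shows "correlator Q (correlator_of Q \<xi>)"
  unfolding correlator_def
proof (intro conjI allI impI)
  fix x y :: "'a gen list" and i j m n
  let ?s = "braid_sign Q (basis_vec i) (basis_vec j)"
  have g: "gen_word (x @ [g, h] @ y) = gen_word x * (letter (Gen g) * letter (Gen h)) * gen_word y" for g h
  proof -
    have "gen_word [g, h] = letter (Gen g) * letter (Gen h)"
      using gen_word_append[of "[g]" "[h]"] by (simp add: gen_word_single)
    thus ?thesis by (simp only: gen_word_append mult.assoc)
  qed
  have "gen_word x * locality_element Q i j m n * gen_word y \<in> vacuum_ideal Q"
    using enveloping_ideal_closed(3,4) locality_element_enveloping enveloping_subset_vacuum by blast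
  hence 0: "\<xi> (pcls Q (gen_word x * locality_element Q i j m n * gen_word y)) = 0"
    by (rule functional_vacuum_ideal[OF \<xi>])
  have "gen_word x * locality_element Q i j m n * gen_word y = 
     (\<Sum>k=0..locality_pos Q i j. scale ((-1) ^ k * of_nat (locality_pos Q i j choose k))
        (gen_word (x @ [(i, m - int k), (j, n + int k)] @ y)
         - scale ?s (gen_word (x @ [(j, n + int k), (i, m - int k)] @ y))))"
    unfolding g locality_element_def
    by (simp add: sum_distrib_left sum_distrib_right scale_mult_left scale_mult_right left_diff_distrib right_diff_distrib)
  from 0[unfolded this]
  show "(\<Sum>k=0..locality_pos Q i j. (-1) ^ k * of_nat (locality_pos Q i j choose k) *
        (correlator_of Q \<xi> (x @ [(i, m - int k), (j, n + int k)] @ y)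
         - ?s * correlator_of Q \<xi> (x @ [(j, n + int k), (i, m - int k)] @ y))) = 0"
    by (simp only: correlator_of_def functional_linear[OF \<xi>])
next
  fix x :: "'a gen list" and i and n :: int assume n: "n \<ge> 0"
  have "letter (Gen (i, n)) \<in> vacuum_ideal Q"
    unfolding vacuum_ideal_def by (rule subsetD[OF hull_subset]) (use n in blast)
  hence "gen_word x * letter (Gen (i, n)) \<in> vacuum_ideal Q"
    using vacuum_ideal[of Q] unfolding is_left_ideal_def by blast
  thus "correlator_of Q \<xi> (x @ [(i, n)]) = 0"
    unfolding correlator_of_def gen_word_append gen_word_single by (rule functional_vacuum_ideal[OF \<xi>])
qed

text \<open>Used to read off the dual support: expansion preserves degree and weight, so a non-zero
  value on a homogeneous class comes from a word in generators of the same degree and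
  weight.\<close>

lemma functional_of_homogeneous:
  assumes "symmetric_quiver Q" "correlator Q \<theta>"
    and u: "\<And>w. w \<in> keys u \<Longrightarrow> word_degree w = \<delta> \<and> word_weight Q w = t"
    and ne: "functional_of Q \<theta> (pcls Q u) \<noteq> 0"
  obtains xs where "\<theta> xs \<noteq> 0" "word_degree (Word (map Gen xs)) = \<delta>" "word_weight Q (Word (map Gen xs)) = t"
proof -
  have "pairing \<theta> (expand Q u) = (\<Sum>w\<in>keys u. lookup u w * pairing \<theta> (word_expand Q w))"
    unfolding expand_def lin_ext_def by (simp add: pairing_sum pairing_scale)
  then obtain w where w: "w \<in> keys u" "pairing \<theta> (word_expand Q w) \<noteq> 0"
    using ne functional_of_pcls[OF assms(1,2)] by (metis (mono_tags, lifting) mult_zero_right sum.neutral)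
  then obtain w' where w': "w' \<in> keys (word_expand Q w)" "word_fun \<theta> w' \<noteq> 0"
    unfolding pairing_def by (metis (mono_tags, lifting) mult_zero_right sum.neutral)
  have h: "letters w' \<in> range (map Gen)" "word_degree w' = \<delta>" "word_weight Q w' = t"
    using word_expand_homogeneous[of Q w] w'(1) u[OF w(1)] unfolding gen_homogeneous_def by auto
  then obtain xs where "letters w' = map Gen xs" by blast
  hence "w' = Word (map Gen xs)" by (metis tensor_word.collapse)
  thus ?thesis using that h w'(2) by auto
qed

text \<open>All products lie in one class because \<open>vacuum_ideal\<close> is closed under left
  multiplication; the union over representatives is that class.\<close>

lemma gen_action_pcls: "gen_action Q i n (pcls Q u) = pcls Q (letter (Gen (i, n)) * u)"
proof -
  have "pcls Q (letter (Gen (i, n)) * v) = pcls Q (letter (Gen (i, n)) * u)" if "v \<in> pcls Q u" for v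
  proof -
    have "u - v \<in> vacuum_ideal Q" using that by (simp add: pcls_def coset_def)
    hence "letter (Gen (i, n)) * (u - v) \<in> vacuum_ideal Q"
      using vacuum_ideal[of Q] unfolding is_left_ideal_def by blast
    hence "pcls Q (letter (Gen (i, n)) * u) = pcls Q (letter (Gen (i, n)) * v)"
      by (simp add: pcls_eq_iff right_diff_distrib)
    thus ?thesis ..
  qed
  thus ?thesis unfolding gen_action_def using pcls_self by blast
qed

lemma foldr_field_coeff:
  "foldr (\<lambda>k X. field_coeff Q (v k) (lookup e k) X) ks (vacuum Q) =
     pcls Q (gen_word (map (\<lambda>k. (v k, - lookup e k - 1)) ks))"
proof (induction ks)
  case Nil
  show ?case by (simp add: vacuum_def gen_word_Nil)
next
  case (Cons k ks)
  have "gen_word (x # xs) = letter (Gen x) * gen_word xs" for x and xs :: "'a gen list"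
    using gen_word_append[of "[x]" xs] by (simp add: gen_word_single)
  thus ?case using Cons by (simp add: field_coeff_def gen_action_pcls)
qed

section \<open>Symmetry of the correlation functions\<close>

definition corr :: "('i gen list \<Rightarrow> rat) \<Rightarrow> nat \<Rightarrow> (nat \<Rightarrow> 'i) \<Rightarrow> zseries" where
  "corr \<theta> p v e = (if keys e \<subseteq> {..<p} then \<theta> (map (\<lambda>k. (v k, - lookup e k - 1)) [0..<p]) else 0)"

lemma correlator_vacuum: "correlator Q \<theta> \<Longrightarrow> n \<ge> 0 \<Longrightarrow> \<theta> (x @ [(i, n)]) = 0"
  unfolding correlator_def by blast

lemma correlator_locality:
  "correlator Q \<theta> \<Longrightarrow> (\<Sum>k=0..locality_pos Q i j. (-1) ^ k * of_nat (locality_pos Q i j choose k) *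
        (\<theta> (x @ [(i, m - int k), (j, n + int k)] @ y)
         - braid_sign Q (basis_vec i) (basis_vec j) * \<theta> (x @ [(j, n + int k), (i, m - int k)] @ y))) = 0"
  unfolding correlator_def by blast

text \<open>Every \<open>i(n)\<close> with \<open>n\<close> large enough kills a given vector; locality expresses \<open>i(n) j(m) y\<close> through
  terms with larger \<open>m\<close>, which vanish eventually.\<close>

lemma correlator_field:
  assumes \<theta>: "correlator Q \<theta>"
  shows "\<exists>b. \<forall>n\<ge>b. \<forall>x. \<theta> (x @ (i, n) # y) = 0"
proof (induction y arbitrary: i)
  case Nil
  show ?case using correlator_vacuum[OF \<theta>] by blast
next
  case (Cons jm y)
  obtain j m where jm: "jm = (j, m)" by fastforce
  obtain M where M: "\<And>n x. n \<ge> M \<Longrightarrow> \<theta> (x @ (j, n) # y) = 0" using Cons[of j] by blast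
  obtain B where B: "\<And>n x. n \<ge> B \<Longrightarrow> \<theta> (x @ (i, n) # y) = 0" using Cons[of i] by blast
  have "\<exists>b. \<forall>n\<ge>b. \<forall>x. \<theta> (x @ (i, n) # (j, m) # y) = 0" for m
  \<comment> \<open>Downward induction on \<open>m\<close>: from \<open>M\<close> on,
    \<open>j(m)\<close> itself kills the tail \<open>y\<close>, and locality reduces smaller
    \<open>m\<close> to larger ones.\<close>
  proof (induction "nat (M - m)" arbitrary: m rule: less_induct)
    case less
    show ?case
    proof (cases "m \<ge> M")
      case True
      have "\<theta> (x @ (i, n) # (j, m) # y) = 0" for n x
        using M[OF True, of "x @ [(i, n)]"] by simp
      thus ?thesis by blast
    next
      case False
      let ?N = "locality_pos Q i j"
      have "\<exists>b. \<forall>n\<ge>b. \<forall>x. \<theta> (x @ (i, n) # (j, m + int (Suc k)) # y) = 0" for k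
        using less[of "m + int (Suc k)"] False by force
      then obtain b where b: "\<And>k n x. n \<ge> b k \<Longrightarrow> \<theta> (x @ (i, n) # (j, m + int (Suc k)) # y) = 0"
        by metis
      \<comment> \<open>In the relation with leading mode \<open>n\<close>, the modes of
        \<open>i\<close> go down to \<open>n - ?N\<close>; the summand \<open>int ?N\<close> keeps
        them above the bounds \<open>B\<close> and \<open>b k\<close>, so only the term with
        \<open>k = 0\<close> survives.\<close>
      define b' where "b' = Max (insert B (b ` {..<?N})) + int ?N"
      have "\<theta> (x @ (i, n) # (j, m) # y) = 0" if n: "n \<ge> b'" for n x
      proof -
        have le: "b k \<le> n - int ?N" if "k < ?N" for k
        proof -
          have "b k \<le> Max (insert B (b ` {..<?N}))" by (rule Max_ge) (use that in auto)
          thus ?thesis using n unfolding b'_def by linarith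
        qed
        have leB: "B \<le> n - int ?N"
        proof -
          have "B \<le> Max (insert B (b ` {..<?N}))" by (rule Max_ge) auto
          thus ?thesis using n unfolding b'_def by linarith
        qed
        have z1: "\<theta> (x @ [(j, m + int k), (i, n - int k)] @ y) = 0" if "k \<le> ?N" for k
          using B[of "n - int k" "x @ [(j, m + int k)]"] leB that by simp
        have z2: "\<theta> (x @ [(i, n - int (Suc k)), (j, m + int (Suc k))] @ y) = 0" if "k < ?N" for k
          using b[of k "n - int (Suc k)" x] le[OF that] that by simp
        let ?t = "\<lambda>k. (-1) ^ k * of_nat (?N choose k) *
           (\<theta> (x @ [(i, n - int k), (j, m + int k)] @ y)
            - braid_sign Q (basis_vec i) (basis_vec j) * \<theta> (x @ [(j, m + int k), (i, n - int k)] @ y))"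
        have "(\<Sum>k=0..?N. ?t k) = ?t 0 + (\<Sum>k\<in>{0<..?N}. ?t k)"
          by (rule sum.head) simp
        moreover have "?t k = 0" if "k \<in> {0<..?N}" for k
          using z1[of k] z2[of "k - 1"] that by (cases k) auto
        ultimately have "(\<Sum>k=0..?N. ?t k) = ?t 0" by simp
        thus ?thesis using z1[of 0] correlator_locality[OF \<theta>, where i=i and j=j and x=x and m=n and n=m and y=y] by simp
      qed
      thus ?thesis by blast
    qed
  qed
  thus ?case by (simp add: jm)
qed

text \<open>Fixing the exponents above \<open>l\<close> fixes the tail \<open>y\<close> of
  \<open>correlator_field\<close>, whose bound is uniform in everything to the left.\<close>

lemma corr_laurent:
  assumes \<theta>: "correlator Q \<theta>"
  shows "corr \<theta> p v \<in> laurent p"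
proof (rule laurentI)
  fix e assume "corr \<theta> p v e \<noteq> 0"
  thus "keys e \<subseteq> {..<p}" by (simp add: corr_def split: if_splits)
next
  fix l e assume l: "l < p"
  let ?g = "\<lambda>e k. (v k, - lookup e k - 1)"
  obtain b where b: "\<And>n x. n \<ge> b \<Longrightarrow> \<theta> (x @ (v l, n) # map (?g e) [Suc l..<p]) = 0"
    using correlator_field[OF \<theta>] by blast
  have "- b \<le> lookup e' l" if e': "\<forall>j>l. lookup e' j = lookup e j" "corr \<theta> p v e' \<noteq> 0" for e'
  proof -
    have "[0..<p] = [0..<l] @ l # [Suc l..<p]"
      using l by (metis le0 less_imp_le_nat upt_add_eq_append upt_conv_Cons le_add_diff_inverse)
    hence "map (?g e') [0..<p] = map (?g e') [0..<l] @ ?g e' l # map (?g e) [Suc l..<p]"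
      using e'(1) by simp
    moreover have "\<theta> (map (?g e') [0..<p]) \<noteq> 0" using e'(2) by (simp add: corr_def split: if_splits)
    ultimately have "\<theta> (map (?g e') [0..<l] @ ?g e' l # map (?g e) [Suc l..<p]) \<noteq> 0" by simp
    hence "\<not> - lookup e' l - 1 \<ge> b" using b[of "- lookup e' l - 1" "map (?g e') [0..<l]"] by blast
    thus ?thesis by simp
  qed
  thus "\<exists>b. \<forall>e'. (\<forall>j>l. lookup e' j = lookup e j) \<longrightarrow> corr \<theta> p v e' \<noteq> 0 \<longrightarrow> b \<le> lookup e' l" by blast
qed

lemma corr_cong: "(\<And>k. k < p \<Longrightarrow> v k = v' k) \<Longrightarrow> corr \<theta> p v = corr \<theta> p v'"
proof
  fix e :: "nat \<Rightarrow>\<^sub>0 int" assume h: "\<And>k. k < p \<Longrightarrow> v k = v' k"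
  have "map (\<lambda>k. (v k, - lookup e k - 1)) [0..<p] = map (\<lambda>k. (v' k, - lookup e k - 1)) [0..<p]"
    using h by simp
  thus "corr \<theta> p v e = corr \<theta> p v' e" by (simp only: corr_def)
qed

abbreviation adj :: "nat \<Rightarrow> nat \<Rightarrow> nat" where
  "adj a \<equiv> Transposition.transpose a (Suc a)"

lemma inv_transpose [simp]: "inv (Transposition.transpose a b) = Transposition.transpose a b"
  by (rule inv_unique_comp) simp_all

lemma lookup_permute_transpose [simp]:
  "lookup (permute_exps (Transposition.transpose a b) e) k = lookup e (Transposition.transpose a b k)"
  by (simp add: lookup_map_key)

lemma permute_exps_adj_twice [simp]: "permute_exps (adj a) (permute_exps (adj a) e) = e"
  by (rule poly_mapping_eqI) simp

text \<open>The coefficient of \<open>z\<^sup>e\<close> in \<open>(z\<^sub>a - z\<^sub>a\<^sub>+\<^sub>1)\<^sup>N (c(z) - s c'(z'))\<close>, where \<open>N = N\<^sub>+(i,j)\<close>, \<open>s\<close> is the braiding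
  sign, and \<open>z'\<close> is \<open>z\<close> with \<open>z\<^sub>a\<close> and \<open>z\<^sub>a\<^sub>+\<^sub>1\<close> exchanged.\<close>

definition locality_sum ::
  "('i::finite, 'a) pre_digraph \<Rightarrow> 'i \<Rightarrow> 'i \<Rightarrow> nat \<Rightarrow> zseries \<Rightarrow> zseries \<Rightarrow> (nat \<Rightarrow>\<^sub>0 int) \<Rightarrow> rat" where
  "locality_sum Q i j a c c' e = (\<Sum>k\<le>locality_pos Q i j. (-1) ^ k * of_nat (locality_pos Q i j choose k) *
     (c (shifted a (Suc a) (int (locality_pos Q i j)) e k)
      - braid_sign Q (basis_vec i) (basis_vec j) *
         c' (permute_exps (adj a) (shifted a (Suc a) (int (locality_pos Q i j)) e k))))"

lemma locality_sum_corr: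
  assumes \<theta>: "correlator Q \<theta>" and a: "Suc a < p"
  shows "locality_sum Q (v a) (v (Suc a)) a (corr \<theta> p v) (corr \<theta> p (v \<circ> adj a)) e = 0"
proof (cases "keys e \<subseteq> {..<p}")
  case True
  let ?N = "locality_pos Q (v a) (v (Suc a))"
  define x where "x = map (\<lambda>k. (v k, - lookup e k - 1)) [0..<a]"
  define y where "y = map (\<lambda>k. (v k, - lookup e k - 1)) [Suc (Suc a)..<p]"
  \<comment> \<open>\<open>shifted\<close> lowers the exponents at \<open>a\<close> and
    \<open>Suc a\<close> by \<open>?N - k\<close> and \<open>k\<close>; the corresponding modes are
    then \<open>m - k\<close> and \<open>n + k\<close>.\<close>
  define m where "m = int ?N - lookup e a - 1"
  define n where "n = - lookup e (Suc a) - 1"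
  have up: "[0..<p] = [0..<a] @ [a, Suc a] @ [Suc (Suc a)..<p]"
    using a upt_add_eq_append[of 0 a "p - a"] upt_conv_Cons[of a p] upt_conv_Cons[of "Suc a" p] by simp
  have k0: "lookup e j = 0" if "j \<ge> p" for j
    using True that by (meson in_keys_iff lessThan_iff not_le subsetD)
  have ks: "keys (shifted a (Suc a) (int ?N) e k) \<subseteq> {..<p}" for k
    using a k0 by (auto simp: in_keys_iff lookup_shifted not_le[symmetric])
  have ks': "keys (permute_exps (adj a) (shifted a (Suc a) (int ?N) e k)) \<subseteq> {..<p}" for k
    using a k0 by (auto simp: in_keys_iff lookup_shifted not_le[symmetric] transpose_def split: if_splits)
  have "map (\<lambda>j. (v j, - lookup (shifted a (Suc a) (int ?N) e k) j - 1)) [0..<p] =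
      x @ [(v a, m - int k), (v (Suc a), n + int k)] @ y" for k
    unfolding up map_append x_def y_def m_def n_def
    by (intro arg_cong2[of _ _ _ _ append]) (auto simp: lookup_shifted)
  hence "corr \<theta> p v (shifted a (Suc a) (int ?N) e k) = \<theta> (x @ [(v a, m - int k), (v (Suc a), n + int k)] @ y)" for k
    using ks[of k] unfolding corr_def by simp
  moreover have "map (\<lambda>j. ((v \<circ> adj a) j, - lookup (permute_exps (adj a) (shifted a (Suc a) (int ?N) e k)) j - 1)) [0..<p] =
      x @ [(v (Suc a), n + int k), (v a, m - int k)] @ y" for k
    unfolding up map_append x_def y_def m_def n_def
    by (intro arg_cong2[of _ _ _ _ append]) (auto simp: lookup_shifted)
  hence "corr \<theta> p (v \<circ> adj a) (permute_exps (adj a) (shifted a (Suc a) (int ?N) e k)) =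
      \<theta> (x @ [(v (Suc a), n + int k), (v a, m - int k)] @ y)" for k
    using ks'[of k] unfolding corr_def by simp
  ultimately show ?thesis
    using correlator_locality[OF \<theta>, of "v a" "v (Suc a)" x m n y]
    by (simp add: locality_sum_def atLeast0AtMost)
next
  case False
  then obtain j where j: "j \<ge> p" "lookup e j \<noteq> 0" by (auto simp: in_keys_iff not_less subset_eq)
  let ?N = "locality_pos Q (v a) (v (Suc a))"
  have "j \<in> keys (shifted a (Suc a) (int ?N) e k)" "j \<in> keys (permute_exps (adj a) (shifted a (Suc a) (int ?N) e k))" for k
    using j a by (auto simp: in_keys_iff lookup_shifted)
  hence "corr \<theta> p v (shifted a (Suc a) (int ?N) e k) = 0"
    "corr \<theta> p (v \<circ> adj a) (permute_exps (adj a) (shifted a (Suc a) (int ?N) e k)) = 0" for k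
    using j(1) unfolding corr_def by (auto simp: subset_eq) force+
  thus ?thesis by (simp add: locality_sum_def)
qed

text \<open>Reversing \<open>m\<close> to \<open>n - m\<close> expresses
  \<open>(z_b - z_a)^n = (-1)^n (z_a - z_b)^n\<close> for \<open>b = Suc a\<close>, an identity of
  polynomials because \<open>n\<close> is natural.\<close>

lemma sum_adj_eq_dmul:
  assumes "g \<in> laurent p" "Suc a < p"
  shows "(\<Sum>m\<le>n. (-1) ^ m * of_nat (n choose m) * g (permute_exps (adj a) (shifted a (Suc a) (int n) e m))) =
     (-1) ^ n * dmul a (Suc a) (int n) g (permute_exps (adj a) e)"
proof -
  have s: "shifted a (Suc a) (int n) (permute_exps (adj a) e) (n - m) = permute_exps (adj a) (shifted a (Suc a) (int n) e m)"
    if "m \<le> n" for m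
    using that by (intro poly_mapping_eqI) (auto simp: lookup_shifted transpose_def)
  have "dmul a (Suc a) (int n) g (permute_exps (adj a) e) =
     (\<Sum>m\<le>n. (-1) ^ m * of_nat (n choose m) * g (shifted a (Suc a) (int n) (permute_exps (adj a) e) m))"
    by (rule dmul_nat[OF assms(1)]) (use assms(2) in auto)
  also have "\<dots> = (\<Sum>m\<le>n. (-1) ^ (n - m) * of_nat (n choose (n - m)) * g (shifted a (Suc a) (int n) (permute_exps (adj a) e) (n - m)))"
    by (rule sum.nat_diff_reindex[symmetric, where n = "Suc n", simplified lessThan_Suc_atMost diff_Suc_Suc, simplified])
  also have "\<dots> = (\<Sum>m\<le>n. (-1) ^ n * ((-1) ^ m * of_nat (n choose m) * g (permute_exps (adj a) (shifted a (Suc a) (int n) e m))))"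
  proof (intro sum.cong refl)
    fix m assume m: "m \<in> {..n}"
    hence "(-1 :: rat) ^ (n - m) = (-1) ^ n * (-1) ^ m" 
      by (simp add: minus_one_power_iff)
    thus "(-1) ^ (n - m) * of_nat (n choose (n - m)) * g (shifted a (Suc a) (int n) (permute_exps (adj a) e) (n - m)) =
       (-1) ^ n * ((-1) ^ m * of_nat (n choose m) * g (permute_exps (adj a) (shifted a (Suc a) (int n) e m)))"
      using m s[of m] binomial_symmetric[of m n] by simp
  qed
  finally have "dmul a (Suc a) (int n) g (permute_exps (adj a) e) =
     (-1) ^ n * (\<Sum>m\<le>n. (-1) ^ m * of_nat (n choose m) * g (permute_exps (adj a) (shifted a (Suc a) (int n) e m)))"
    by (simp only: sum_distrib_left)
  moreover have "(-1 :: rat) ^ n * (-1) ^ n = 1" by (simp add: minus_one_power_iff)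
  ultimately show ?thesis by (simp add: mult.assoc[symmetric])
qed

section \<open>Ordered pairs and the exchange of neighbours\<close>

definition pair_list :: "nat \<Rightarrow> (nat \<times> nat) list" where
  "pair_list p = [(k, l). l \<leftarrow> [0..<p], k \<leftarrow> [0..<l]]"

definition other_pairs :: "nat \<Rightarrow> nat \<Rightarrow> (nat \<times> nat) list" where
  "other_pairs p a = filter (\<lambda>x. x \<noteq> (a, Suc a)) (pair_list p)"

lemma set_pair_list: "set (pair_list p) = ordered_pairs p"
  by (auto simp: pair_list_def ordered_pairs_def)

lemma distinct_pair_list: "distinct (pair_list p)"
proof (induction p)
  case (Suc p)
  have "pair_list (Suc p) = pair_list p @ map (\<lambda>k. (k, p)) [0..<p]"
    by (simp add: pair_list_def)
  thus ?case using Suc by (auto simp: set_pair_list ordered_pairs_def distinct_map inj_on_def)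
qed (simp add: pair_list_def)

lemma other_pairs_subset: "set (other_pairs p a) \<subseteq> ordered_pairs p"
  by (auto simp: other_pairs_def set_pair_list)

lemma mset_pair_list:
  assumes "Suc a < p"
  shows "mset (pair_list p) = mset (other_pairs p a @ [(a, Suc a)])"
proof -
  have "(a, Suc a) \<in> set (pair_list p)" using assms by (simp add: set_pair_list ordered_pairs_def)
  hence "mset (pair_list p) = mset ((a, Suc a) # remove1 (a, Suc a) (pair_list p))" by simp
  also have "remove1 (a, Suc a) (pair_list p) = other_pairs p a"
    unfolding other_pairs_def using distinct_pair_list by (simp add: distinct_remove1_removeAll removeAll_filter_not_eq)
       (rule filter_cong, auto)
  finally show ?thesis by simp
qed

text \<open>Only \<open>(a, Suc a)\<close> is reversed by the exchange; the remaining pairs are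
  permuted among themselves and keep their direction of expansion.\<close>

lemma mset_other_pairs_adj:
  assumes "Suc a < p"
  shows "mset (map (map_prod (adj a) (adj a)) (other_pairs p a)) = mset (other_pairs p a)"
proof (rule set_eq_iff_mset_eq_distinct[THEN iffD1])
  let ?f = "map_prod (adj a) (adj a)"
  have inj: "inj ?f" by (simp add: prod.inj_map)
  show "distinct (map ?f (other_pairs p a))"
    unfolding distinct_map using inj_on_subset[OF inj] by (simp add: other_pairs_def distinct_pair_list)
  show "distinct (other_pairs p a)" by (simp add: other_pairs_def distinct_pair_list)
  have sub: "?f ` set (other_pairs p a) \<subseteq> set (other_pairs p a)"
    using assms by (auto simp: other_pairs_def set_pair_list ordered_pairs_def transpose_def split: if_splits)
  have inv: "x = ?f (?f x)" for x by (cases x) simp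
  have "set (other_pairs p a) \<subseteq> ?f ` set (other_pairs p a)"
  proof
    fix x assume "x \<in> set (other_pairs p a)"
    hence "?f x \<in> set (other_pairs p a)" using sub by blast
    thus "x \<in> ?f ` set (other_pairs p a)" by (rule image_eqI[where f = ?f, rotated]) (rule inv)
  qed
  thus "set (map ?f (other_pairs p a)) = set (other_pairs p a)" using sub by auto
qed

definition loc_weight :: "('i::finite, 'a) pre_digraph \<Rightarrow> (nat \<Rightarrow> 'i) \<Rightarrow> nat \<times> nat \<Rightarrow> int" where
  "loc_weight Q v x = locality Q (v (fst x)) (v (snd x))"

lemma dmul_pair_list:
  assumes "g \<in> laurent p" "Suc a < p"
  shows "dmul_list (pair_list p) w g = dmul_list (other_pairs p a) w (dmul a (Suc a) (w (a, Suc a)) g)"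
  using dmul_list_mset[OF assms(1) _ mset_pair_list[OF assms(2)], of w]
  by (simp add: set_pair_list dmul_list_append)

lemma dmul_other_pairs_adj:
  assumes g: "g \<in> laurent p" and a: "Suc a < p" and w: "\<And>x. w' x = w (map_prod (adj a) (adj a) x)"
  shows "dmul_list (other_pairs p a) w (\<lambda>e. g (permute_exps (adj a) e)) e =
     dmul_list (other_pairs p a) w' g (permute_exps (adj a) e)"
proof -
  let ?qs = "map (map_prod (adj a) (adj a)) (other_pairs p a)"
  have b: "bij (adj a)" by simp
  have sub: "set ?qs \<subseteq> ordered_pairs p"
    using mset_eq_setD[OF mset_other_pairs_adj[OF a]] other_pairs_subset by metis
  have w': "w' = (\<lambda>x. w (map_prod (adj a) (adj a) x))" using w by (rule ext)
  have "dmul_list (other_pairs p a) w (\<lambda>e. g (permute_exps (adj a) e)) e =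
      dmul_list ?qs w' g (permute_exps (adj a) e)"
    unfolding dmul_list_permute[OF b] w' inv_transpose ..
  thus ?thesis using dmul_list_mset[OF g sub mset_other_pairs_adj[OF a]] by simp
qed

text \<open>The exponent and its positive part differ in the second case only. There the relation
  says just that the modes of a field anticommute, while the prefactor of \<open>F\<close> has a
  pole.\<close>

lemma locality_cases:
  obtains (nonneg) n where "locality Q i j = int n" "locality_pos Q i j = n"
      "braid_sign Q (basis_vec i) (basis_vec j) = (-1) ^ n"
  | (neg) "locality Q i j = -1" "locality_pos Q i j = 0" "i = j"
      "braid_sign Q (basis_vec i) (basis_vec j) = -1"
proof (cases "locality Q i j \<ge> 0")
  case True
  thus ?thesis using nonneg[of "nat (locality Q i j)"] by (simp add: locality_pos_def braid_sign_basis_vec)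
next
  case False
  hence "i = j" "locality Q i j = -1" using locality_neg[of Q i j] by linarith+
  moreover from this have "locality_pos Q i j = 0" "braid_sign Q (basis_vec i) (basis_vec j) = -1"
    by (simp_all only: locality_pos_def braid_sign_basis_vec) simp_all
  ultimately show ?thesis by (intro neg)
qed

lemma shifted_0 [simp]: "shifted k l 0 e 0 = e"
  by (simp add: shifted_def)

text \<open>In the fermionic case \<open>N = -1\<close> locality says that \<open>c\<close> is antisymmetric, and the quotient
  \<open>h = c / (z\<^sub>a - z\<^sub>a\<^sub>+\<^sub>1)\<close> is symmetric: the difference of \<open>h\<close> and its mirror image is killed by
  \<open>z\<^sub>a - z\<^sub>a\<^sub>+\<^sub>1\<close>, hence constant along antidiagonals, hence both symmetric and antisymmetric.\<close>

lemma dmul_locality_symmetric: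
  assumes c: "c \<in> laurent p" and c': "c' \<in> laurent p" and a: "Suc a < p"
    and loc: "\<And>e. locality_sum Q i j a c c' e = 0" and eq: "i = j \<Longrightarrow> c' = c"
  shows "dmul a (Suc a) (locality Q i j) c e = dmul a (Suc a) (locality Q i j) c' (permute_exps (adj a) e)"
proof (cases rule: locality_cases[of Q i j])
  case (nonneg n)
  have a': "a < Suc a" by simp
  have s1: "(-1 :: rat) ^ n * (-1) ^ n = 1" by (simp add: minus_one_power_iff)
  have "0 = (\<Sum>k\<le>n. (-1) ^ k * of_nat (n choose k) * (c (shifted a (Suc a) (int n) e k)))
      - (-1) ^ n * (\<Sum>k\<le>n. (-1) ^ k * of_nat (n choose k) * c' (permute_exps (adj a) (shifted a (Suc a) (int n) e k)))"
    using loc[of e] unfolding locality_sum_def nonneg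
    by (simp add: sum_subtractf[symmetric] sum_distrib_left algebra_simps)
  also have "\<dots> = dmul a (Suc a) (int n) c e - dmul a (Suc a) (int n) c' (permute_exps (adj a) e)"
    unfolding sum_adj_eq_dmul[OF c' a] dmul_nat[OF c a' a, symmetric] mult.assoc[symmetric] s1 by simp
  finally show ?thesis by (simp add: nonneg)
next
  case neg
  have a': "a < Suc a" by simp
  have cc: "c' = c" using eq neg by simp
  have anti: "c (permute_exps (adj a) e) = - c e" for e
    using loc[of e] unfolding locality_sum_def neg(1,2,4) cc by simp
  let ?s = "permute_exps (adj a)"
  define h where "h = dmul a (Suc a) (-1) c"
  have h: "h \<in> laurent p" unfolding h_def by (rule dmul_laurent[OF c a' a])
  have Dh: "diff_op a (Suc a) h = c"
    unfolding h_def using diff_op_dmul[OF c a' a, of "-1"] dmul_0[OF c a' a] by simp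
  define g where "g e = h e - h (?s e)" for e
  have shift: "g (e - single a 1) = g (e - single (Suc a) 1)" for e
  proof -
    have p1: "?s (e - single a 1) = ?s e - single (Suc a) 1"
      by (rule poly_mapping_eqI) (simp add: lookup_minus lookup_single_if transpose_def)
    have p2: "?s (e - single (Suc a) 1) = ?s e - single a 1"
      by (rule poly_mapping_eqI) (auto simp: lookup_minus lookup_single_if transpose_def)
    have "h (e - single a 1) - h (e - single (Suc a) 1) = c e"
      using fun_cong[OF Dh, of e] by (simp add: diff_op_def)
    moreover have "h (?s e - single a 1) - h (?s e - single (Suc a) 1) = c (?s e)"
      using fun_cong[OF Dh, of "?s e"] by (simp add: diff_op_def)
    ultimately show ?thesis unfolding g_def p1 p2 anti by linarith
  qed
  have const: "g (shifted a (Suc a) 0 e t) = g e" for e t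
  proof (induction t)
    case (Suc t)
    let ?e = "shifted a (Suc a) 0 e t + single a 1"
    have "?e - single a 1 = shifted a (Suc a) 0 e t" by simp
    moreover have "?e - single (Suc a) 1 = shifted a (Suc a) 0 e (Suc t)"
      by (rule poly_mapping_eqI) (simp add: lookup_shifted lookup_minus lookup_add lookup_single_if)
    ultimately show ?case using shift[of ?e] Suc by simp
  qed simp
  \<comment> \<open>The mirror point lies on the same antidiagonal, but \<open>const\<close> only
    moves exponent from \<open>Suc a\<close> to \<open>a\<close>; the other half is obtained by
    starting from the mirror point.\<close>
  have sym: "g (?s e) = g e" if "lookup e a \<le> lookup e (Suc a)" for e
  proof -
    have "shifted a (Suc a) 0 e (nat (lookup e (Suc a) - lookup e a)) = ?s e"
      by (rule poly_mapping_eqI) (use that in \<open>auto simp: lookup_shifted transpose_def\<close>)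
    thus ?thesis using const by metis
  qed
  have anti_g: "g (?s e) = - g e" for e by (simp add: g_def)
  have "g e = 0" for e
  proof (cases "lookup e a \<le> lookup e (Suc a)")
    case True
    thus ?thesis using sym[OF True] anti_g[of e] by simp
  next
    case False
    hence "g (?s (?s e)) = g (?s e)" by (intro sym) simp
    thus ?thesis using anti_g[of e] by simp
  qed
  hence "h e = h (?s e)" by (simp add: g_def)
  thus ?thesis unfolding neg(1) cc h_def .
qed

text \<open>The converse, for building correlators. For natural exponents the two powers cancel; for
  exponent -1 the symmetric pair is multiplied by \<open>z_a - z_b\<close> with
  \<open>b = Suc a\<close>, which changes sign under the exchange.\<close>

lemma locality_sum_of_symmetric:
  assumes h: "h \<in> laurent p" and h': "h' \<in> laurent p" and a: "Suc a < p"
    and sym: "\<And>e. h e = h' (permute_exps (adj a) e)"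
  shows "locality_sum Q i j a (dmul a (Suc a) (- locality Q i j) h) (dmul a (Suc a) (- locality Q i j) h') e = 0"
proof (cases rule: locality_cases[of Q i j])
  case (nonneg n)
  have a': "a < Suc a" by simp
  let ?c = "dmul a (Suc a) (- int n) h" and ?c' = "dmul a (Suc a) (- int n) h'"
  have c: "?c \<in> laurent p" "?c' \<in> laurent p" by (rule dmul_laurent[OF h a' a] dmul_laurent[OF h' a' a])+
  have s1: "(-1 :: rat) ^ n * (-1) ^ n = 1" by (simp add: minus_one_power_iff)
  have "locality_sum Q i j a ?c ?c' e = (\<Sum>k\<le>n. (-1) ^ k * of_nat (n choose k) * (?c (shifted a (Suc a) (int n) e k)))
      - (-1) ^ n * (\<Sum>k\<le>n. (-1) ^ k * of_nat (n choose k) * ?c' (permute_exps (adj a) (shifted a (Suc a) (int n) e k)))"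
    unfolding locality_sum_def nonneg
    by (simp add: sum_subtractf[symmetric] sum_distrib_left algebra_simps)
  also have "\<dots> = dmul a (Suc a) (int n) ?c e - dmul a (Suc a) (int n) ?c' (permute_exps (adj a) e)"
    unfolding sum_adj_eq_dmul[OF c(2) a] dmul_nat[OF c(1) a' a, symmetric] mult.assoc[symmetric] s1 by simp
  also have "\<dots> = 0"
    using dmul_dmul[OF h a' a] dmul_dmul[OF h' a' a] dmul_0[OF h a' a] dmul_0[OF h' a' a] sym by simp
  finally show ?thesis by (simp add: nonneg)
next
  case neg
  have a': "a < Suc a" by simp
  let ?s = "permute_exps (adj a)"
  have D: "dmul a (Suc a) 1 f e = f (e - single a 1) - f (e - single (Suc a) 1)" if "f \<in> laurent p" for f e
    using diff_op_dmul[OF that a' a, of 0] dmul_0[OF that a' a] by (simp add: diff_op_def fun_eq_iff)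
  have p1: "?s (e - single a 1) = ?s e - single (Suc a) 1"
    by (rule poly_mapping_eqI) (simp add: lookup_minus lookup_single_if transpose_def)
  have p2: "?s (e - single (Suc a) 1) = ?s e - single a 1"
    by (rule poly_mapping_eqI) (auto simp: lookup_minus lookup_single_if transpose_def)
  show ?thesis
    unfolding locality_sum_def neg(1,2,4) by (simp add: D[OF h] D[OF h'] sym p1 p2)
qed

text \<open>The series \<open>F\<close> for any sequence of vertices; the theorem concerns the
  sequence \<open>vertex_at vs d\<close>, but an exchange may lead out of it.\<close>

definition F_corr :: "('i::finite, 'a) pre_digraph \<Rightarrow> ('i gen list \<Rightarrow> rat) \<Rightarrow> nat \<Rightarrow> (nat \<Rightarrow> 'i) \<Rightarrow> zseries" where
  "F_corr Q \<theta> p v = dmul_list (pair_list p) (loc_weight Q v) (corr \<theta> p v)"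

lemma F_corr_laurent: "correlator Q \<theta> \<Longrightarrow> F_corr Q \<theta> p v \<in> laurent p"
  unfolding F_corr_def by (intro dmul_list_laurent corr_laurent) (simp_all add: set_pair_list)

text \<open>The factor at \<open>(a, Suc a)\<close> absorbs the exchange by locality, and the
  product over the other pairs is merely rearranged.\<close>

lemma F_corr_adj:
  assumes Q: "symmetric_quiver Q" and \<theta>: "correlator Q \<theta>" and a: "Suc a < p"
  shows "F_corr Q \<theta> p (v \<circ> adj a) (permute_exps (adj a) e) = F_corr Q \<theta> p v e"
proof -
  have a': "a < Suc a" by simp
  let ?v = "v \<circ> adj a" and ?N = "locality Q (v a) (v (Suc a))"
  let ?c = "corr \<theta> p v" and ?c' = "corr \<theta> p ?v"
  have c: "?c \<in> laurent p" "?c' \<in> laurent p" by (rule corr_laurent[OF \<theta>])+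
  have c'_eq: "?c' = ?c" if "v a = v (Suc a)"
    by (rule corr_cong) (use that in \<open>auto simp: transpose_def\<close>)
  have "dmul a (Suc a) ?N ?c = (\<lambda>e. dmul a (Suc a) ?N ?c' (permute_exps (adj a) e))"
    by (rule ext, rule dmul_locality_symmetric[OF c a locality_sum_corr[OF \<theta> a] c'_eq])
  moreover have "F_corr Q \<theta> p v = dmul_list (other_pairs p a) (loc_weight Q v) (dmul a (Suc a) ?N ?c)"
    unfolding F_corr_def dmul_pair_list[OF c(1) a] by (simp add: loc_weight_def)
  moreover have "F_corr Q \<theta> p ?v = dmul_list (other_pairs p a) (loc_weight Q ?v) (dmul a (Suc a) ?N ?c')"
    unfolding F_corr_def dmul_pair_list[OF c(2) a] using locality_commute[OF Q] by (simp add: loc_weight_def)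
  moreover have "dmul_list (other_pairs p a) (loc_weight Q v) (\<lambda>e. dmul a (Suc a) ?N ?c' (permute_exps (adj a) e)) e =
     dmul_list (other_pairs p a) (loc_weight Q ?v) (dmul a (Suc a) ?N ?c') (permute_exps (adj a) e)"
    by (rule dmul_other_pairs_adj[OF dmul_laurent[OF c(2) a' a] a]) (simp add: loc_weight_def)
  ultimately show ?thesis by simp
qed

section \<open>From exchanges of neighbours to all permutations\<close>

definition perm_invariant ::
  "(nat \<Rightarrow> (nat \<Rightarrow> 'i) \<Rightarrow> zseries) \<Rightarrow> nat \<Rightarrow> (nat \<Rightarrow> nat) \<Rightarrow> bool" where
  "perm_invariant G p s \<longleftrightarrow> inj s \<and> (\<forall>v e. G p (v \<circ> s) (permute_exps s e) = G p v e)"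

lemma perm_invariant_comp:
  assumes "perm_invariant G p s" "perm_invariant G p t"
  shows "perm_invariant G p (s \<circ> t)"
proof -
  have "permute_exps (s \<circ> t) e = permute_exps t (permute_exps s e)" for e
    using assms map_key_compose[of t s e] by (simp add: perm_invariant_def)
  moreover have "G p (v \<circ> (s \<circ> t)) (permute_exps t (permute_exps s e)) = G p v e" for v e
    using assms unfolding perm_invariant_def comp_assoc[symmetric] by metis
  moreover have "inj (s \<circ> t)" using assms by (simp add: perm_invariant_def inj_compose)
  ultimately show ?thesis by (simp add: perm_invariant_def)
qed

text \<open>Conjugating the transposition of \<open>a\<close> and \<open>b\<close> by the exchange
  of \<open>b\<close> and \<open>Suc b\<close> gives the one of \<open>a\<close> and
  \<open>Suc b\<close>.\<close>

lemma perm_invariant_transpose: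
  assumes adj: "\<And>a. Suc a < p \<Longrightarrow> perm_invariant G p (adj a)" and "a < b" "b < p"
  shows "perm_invariant G p (Transposition.transpose a b)"
  using assms(2,3)
proof (induction b)
  case (Suc b)
  show ?case
  proof (cases "a = b")
    case True
    thus ?thesis using adj Suc by simp
  next
    case False
    hence "perm_invariant G p (Transposition.transpose a b)" using Suc by simp
    hence "perm_invariant G p (adj b \<circ> (Transposition.transpose a b \<circ> adj b))"
      using adj[of b] Suc.prems by (intro perm_invariant_comp) auto
    moreover have "adj b \<circ> (Transposition.transpose a b \<circ> adj b) = Transposition.transpose a (Suc b)"
      using False Suc.prems by (auto simp: fun_eq_iff transpose_def)
    ultimately show ?thesis by simp
  qed
qed simp

lemma perm_invariant_permutes:
  assumes adj: "\<And>a. Suc a < p \<Longrightarrow> perm_invariant G p (adj a)" and s: "s permutes {..<p}"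
  shows "perm_invariant G p s"
proof -
  show ?thesis
    using finite_lessThan[of p] s
  proof (induction rule: permutes_rev_induct)
    case id
    show ?case by (simp add: perm_invariant_def id_def map_key_id comp_def)
  next
    case (swap a b q)
    have "perm_invariant G p (Transposition.transpose a b)"
      using perm_invariant_transpose[OF adj, of a b] perm_invariant_transpose[OF adj, of b a] swap
      by (cases "a < b") (auto simp: transpose_commute)
    thus ?case using swap perm_invariant_comp by blast
  qed
qed

lemma F_corr_permutes:
  assumes "symmetric_quiver Q" "correlator Q \<theta>" "s permutes {..<p}"
  shows "F_corr Q \<theta> p (v \<circ> s) (permute_exps s e) = F_corr Q \<theta> p v e"
proof -
  have "perm_invariant (F_corr Q \<theta>) p s"
    by (rule perm_invariant_permutes[OF _ assms(3)])
       (simp add: perm_invariant_def F_corr_adj[OF assms(1,2)])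
  thus ?thesis by (simp add: perm_invariant_def)
qed

lemma F_corr_nonneg:
  assumes Q: "symmetric_quiver Q" and \<theta>: "correlator Q \<theta>" and k: "k < p" and ne: "F_corr Q \<theta> p v e \<noteq> 0"
  shows "lookup e k \<ge> 0"
proof -
  obtain q where q: "p = Suc q" using k by (cases p) auto
  have last: "lookup e q \<ge> 0" if "F_corr Q \<theta> p v e \<noteq> 0" for v e
  proof (rule dmul_list_nonneg_last)
    show "set (pair_list p) \<subseteq> ordered_pairs (Suc q)" by (simp add: set_pair_list q)
    show "dmul_list (pair_list p) (loc_weight Q v) (corr \<theta> p v) e \<noteq> 0" using that by (simp add: F_corr_def)
    fix e' assume ne': "corr \<theta> p v e' \<noteq> 0"
    show "lookup e' q \<ge> 0"
    proof (rule ccontr)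
      assume "\<not> lookup e' q \<ge> 0"
      hence "\<theta> (map (\<lambda>k. (v k, - lookup e' k - 1)) [0..<q] @ [(v q, - lookup e' q - 1)]) = 0"
        by (intro correlator_vacuum[OF \<theta>]) simp
      thus False using ne' by (simp add: corr_def q split: if_splits)
    qed
  qed
  let ?s = "Transposition.transpose k q"
  have s: "?s permutes {..<p}" using k q by (intro permutes_swap_id) auto
  have "F_corr Q \<theta> p (v \<circ> ?s) (permute_exps ?s e) \<noteq> 0"
    using F_corr_permutes[OF Q \<theta> s] ne by simp
  from last[OF this] show ?thesis by simp
qed

lemma F_corr_eq_0D:
  assumes \<theta>: "correlator Q \<theta>" and "F_corr Q \<theta> p v = (\<lambda>e. 0)"
  shows "corr \<theta> p v = (\<lambda>e. 0)"
proof -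
  have "corr \<theta> p v = dmul_list (pair_list p) (\<lambda>x. - loc_weight Q v x) (F_corr Q \<theta> p v)"
    using dmul_list_inverse[OF corr_laurent[OF \<theta>], where ps = "pair_list p" and w = "\<lambda>x. - loc_weight Q v x"]
    by (simp add: F_corr_def set_pair_list)
  moreover have "dmul_list ps w (\<lambda>e. 0) = (\<lambda>e. 0)" for ps w
    by (induction ps) (simp_all add: dmul_def fun_eq_iff)
  ultimately show ?thesis using assms(2) by simp
qed

section \<open>Identification with \<open>correlation\<close> and \<open>F_series\<close>\<close>

lemma foldr_series_mult:
  assumes "g \<in> laurent p" "set ps \<subseteq> ordered_pairs p"
  shows "foldr (\<lambda>(k, l). series_mult (diff_power k l (w (k, l)))) ps g = dmul_list ps w g"
  using assms(2)
proof (induction ps)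
  case (Cons x ps)
  have x: "fst x < snd x" "snd x < p" and ps: "set ps \<subseteq> ordered_pairs p"
    using Cons.prems by (auto simp: ordered_pairs_def)
  show ?case
    using Cons.IH[OF ps] series_mult_diff_power[OF dmul_list_laurent[OF assms(1) ps] x]
    by (cases x) simp
qed simp

lemma correlation_eq: "correlation Q vs d \<xi> = corr (correlator_of Q \<xi>) (num_vars d) (vertex_at vs d)"
  by (rule ext) (simp only: correlation_def corr_def foldr_field_coeff correlator_of_def)

lemma F_series_eq:
  assumes "\<xi> \<in> functionals Q"
  shows "F_series Q vs d \<xi> = F_corr Q (correlator_of Q \<xi>) (num_vars d) (vertex_at vs d)"
proof -
  have "set (pair_list p) \<subseteq> ordered_pairs p" for p by (simp add: set_pair_list)
  from foldr_series_mult[OF corr_laurent[OF correlator_correlator_of[OF assms]] this, of "loc_weight Q (vertex_at vs d)"]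
  show ?thesis
    unfolding F_series_def F_corr_def correlation_eq pair_list_def loc_weight_def by simp
qed

section \<open>Exponent vectors and monomials\<close>

definition monom_of :: "(nat \<Rightarrow> 'v) \<Rightarrow> nat \<Rightarrow> (nat \<Rightarrow>\<^sub>0 int) \<Rightarrow> ('v \<Rightarrow>\<^sub>0 nat)" where
  "monom_of \<beta> p e = (\<Sum>k<p. single (\<beta> k) (nat (lookup e k)))"

lemma lookup_monom_of: "lookup (monom_of \<beta> p e) x = (\<Sum>k<p. if \<beta> k = x then nat (lookup e k) else 0)"
  by (simp add: monom_of_def lookup_sum lookup_single_if eq_commute)

lemma lookup_monom_of_inj:
  assumes "inj_on \<beta> {..<p}" "k < p"
  shows "lookup (monom_of \<beta> p e) (\<beta> k) = nat (lookup e k)"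
proof -
  have "(\<Sum>j<p. if \<beta> j = \<beta> k then nat (lookup e j) else 0) = (\<Sum>j<p. if j = k then nat (lookup e j) else 0)"
    by (rule sum.cong) (use assms in \<open>auto simp: inj_on_def\<close>)
  thus ?thesis using assms by (simp add: lookup_monom_of sum.delta)
qed

lemma keys_monom_of: "keys (monom_of \<beta> p e) \<subseteq> \<beta> ` {..<p}"
proof
  fix x assume "x \<in> keys (monom_of \<beta> p e)"
  hence "(\<Sum>k<p. if \<beta> k = x then nat (lookup e k) else 0) \<noteq> 0" by (simp add: in_keys_iff lookup_monom_of)
  then obtain k where "k \<in> {..<p}" "(if \<beta> k = x then nat (lookup e k) else 0) \<noteq> 0"
    by (rule sum.not_neutral_contains_not_neutral)
  hence "k < p" "\<beta> k = x" by (auto split: if_splits)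
  thus "x \<in> \<beta> ` {..<p}" by blast
qed

lemma mono_degree_monom_of:
  assumes "\<And>k. k < p \<Longrightarrow> lookup e k \<ge> 0"
  shows "int (mono_degree (monom_of \<beta> p e)) = exp_sum p e"
proof -
  let ?m = "monom_of \<beta> p e"
  have "mono_degree ?m = (\<Sum>x\<in>\<beta> ` {..<p}. lookup ?m x)"
    unfolding mono_degree_def by (rule sum.mono_neutral_left) (use keys_monom_of[of \<beta> p e] in \<open>auto simp: in_keys_iff\<close>)
  also have "\<dots> = (\<Sum>k<p. \<Sum>x\<in>\<beta> ` {..<p}. if \<beta> k = x then nat (lookup e k) else 0)"
    unfolding lookup_monom_of by (rule sum.swap)
  also have "\<dots> = (\<Sum>k<p. nat (lookup e k))"
    by (rule sum.cong) (auto simp: sum.delta')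
  finally show ?thesis using assms by (simp add: exp_sum_def)
qed

lemma length_positions:
  assumes "distinct vs" "set vs = UNIV"
  shows "length (positions vs d) = num_vars d"
proof -
  have "length (positions vs d) = (\<Sum>j\<leftarrow>vs. d j)"
    unfolding positions_def by (simp add: length_concat comp_def del: upt_Suc)
  also have "\<dots> = num_vars d"
    using assms by (simp add: num_vars_def sum_list_distinct_conv_sum_set)
  finally show ?thesis .
qed

lemma set_positions:
  assumes "set vs = UNIV"
  shows "set (positions vs d) = vars d"
proof -
  have "set (positions vs d) = (\<Union>j\<in>set vs. (\<lambda>k. (j, k)) ` {1..<Suc (d j)})"
    unfolding positions_def by (simp del: upt_Suc)
  thus ?thesis using assms by (auto simp: vars_def image_iff less_Suc_eq_le)
qed

lemma card_vars: "card (vars (d :: 'i::finite \<Rightarrow> nat)) = num_vars d"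
proof -
  have "vars d = Sigma UNIV (\<lambda>i. {1..d i})" by (auto simp: vars_def)
  thus ?thesis by (simp add: num_vars_def)
qed

lemma bij_betw_positions:
  fixes vs :: "'i::finite list"
  assumes "distinct vs" "set vs = UNIV"
  shows "bij_betw ((!) (positions vs d)) {..<num_vars d} (vars d)"
proof -
  have "distinct (positions vs d)"
    by (rule card_distinct) (simp add: set_positions[OF assms(2)] card_vars length_positions[OF assms])
  hence "bij_betw ((!) (positions vs d)) {..<length (positions vs d)} (set (positions vs d))"
    by (rule bij_betw_nth) auto
  thus ?thesis by (simp add: length_positions[OF assms] set_positions[OF assms(2)])
qed

lemma poly_series_eq:
  "poly_series vs d f e = (if keys e \<subseteq> {..<num_vars d} \<and> (\<forall>k. 0 \<le> lookup e k)
     then lookup f (monom_of ((!) (positions vs d)) (num_vars d) e) else 0)"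
  by (simp add: poly_series_def monom_of_def)

definition exps_of_monom :: "(nat \<Rightarrow> 'v) \<Rightarrow> nat \<Rightarrow> ('v \<Rightarrow>\<^sub>0 nat) \<Rightarrow> (nat \<Rightarrow>\<^sub>0 int)" where
  "exps_of_monom \<beta> p m = (\<Sum>k<p. single k (int (lookup m (\<beta> k))))"

lemma lookup_exps_of_monom: "lookup (exps_of_monom \<beta> p m) k = (if k < p then int (lookup m (\<beta> k)) else 0)"
  by (simp add: exps_of_monom_def lookup_sum lookup_single_if sum.delta)

lemma keys_exps_of_monom: "keys (exps_of_monom \<beta> p m) \<subseteq> {..<p}"
  by (auto simp: in_keys_iff lookup_exps_of_monom split: if_splits)

lemma monom_of_exps_of_monom:
  assumes "bij_betw \<beta> {..<p} V" "keys m \<subseteq> V"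
  shows "monom_of \<beta> p (exps_of_monom \<beta> p m) = m"
proof (rule poly_mapping_eqI)
  fix x show "lookup (monom_of \<beta> p (exps_of_monom \<beta> p m)) x = lookup m x"
  proof (cases "x \<in> V")
    case True
    then obtain k where k: "k < p" "x = \<beta> k" using assms(1) by (auto simp: bij_betw_def)
    have "inj_on \<beta> {..<p}" using assms(1) by (simp add: bij_betw_def)
    from lookup_monom_of_inj[OF this k(1)] show ?thesis using k by (simp add: lookup_exps_of_monom)
  next
    case False
    hence "x \<notin> keys m" "x \<notin> keys (monom_of \<beta> p (exps_of_monom \<beta> p m))"
      using keys_monom_of[of \<beta> p "exps_of_monom \<beta> p m"] assms by (auto simp: bij_betw_def)
    thus ?thesis by (simp add: in_keys_iff)
  qed
qed

lemma exps_of_monom_monom_of: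
  assumes "inj_on \<beta> {..<p}" "keys e \<subseteq> {..<p}" "\<And>k. lookup e k \<ge> 0"
  shows "exps_of_monom \<beta> p (monom_of \<beta> p e) = e"
proof (rule poly_mapping_eqI)
  fix k
  have "lookup e k = 0" if "\<not> k < p" using assms(2) that by (meson in_keys_iff lessThan_iff subsetD)
  thus "lookup (exps_of_monom \<beta> p (monom_of \<beta> p e)) k = lookup e k"
    using lookup_monom_of_inj[OF assms(1)] assms(3) by (simp add: lookup_exps_of_monom)
qed

lemma sym_polys_eqI:
  fixes vs :: "'i::finite list"
  assumes vs: "distinct vs" "set vs = UNIV" and "f \<in> sym_polys d" "g \<in> sym_polys d"
    and "poly_series vs d f = poly_series vs d g"
  shows "f = g"
proof (rule poly_mapping_eqI)
  fix m
  show "lookup f m = lookup g m"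
  proof (cases "keys m \<subseteq> vars d")
    case True
    let ?e = "exps_of_monom ((!) (positions vs d)) (num_vars d) m"
    have "poly_series vs d h ?e = lookup h m" for h
      unfolding poly_series_eq
      by (simp add: monom_of_exps_of_monom[OF bij_betw_positions[OF vs] True] keys_exps_of_monom lookup_exps_of_monom)
    thus ?thesis using assms(5) by metis
  next
    case False
    thus ?thesis using assms(3,4) by (metis (mono_tags, lifting) in_keys_iff mem_Collect_eq sym_polys_def)
  qed
qed

lemma finite_bounded_exps:
  "finite {e :: nat \<Rightarrow>\<^sub>0 int. keys e \<subseteq> {..<p} \<and> (\<forall>k<p. 0 \<le> lookup e k \<and> lookup e k \<le> B)}" (is "finite ?S")
proof (rule finite_imageD)
  let ?f = "\<lambda>e :: nat \<Rightarrow>\<^sub>0 int. map (lookup e) [0..<p]"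
  have "?f ` ?S \<subseteq> {xs. set xs \<subseteq> {0..B} \<and> length xs = p}" by auto
  thus "finite (?f ` ?S)" by (rule finite_subset) (simp add: finite_lists_length_eq)
  show "inj_on ?f ?S"
  proof (rule inj_onI, rule poly_mapping_eqI)
    fix e e' :: "nat \<Rightarrow>\<^sub>0 int" and k assume h: "e \<in> ?S" "e' \<in> ?S" "?f e = ?f e'"
    show "lookup e k = lookup e' k"
    proof (cases "k < p")
      case True
      thus ?thesis using h(3) by simp
    next
      case False
      hence "k \<notin> keys e" "k \<notin> keys e'" using h by auto
      thus ?thesis by (simp add: in_keys_iff)
    qed
  qed
qed

text \<open>Permutations inside the blocks of equal vertices are permutations of the positions that
  fix the vertex sequence. Hence the symmetry of a polynomial is the part of the permutation
  invariance that keeps the sequence.\<close>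

lemma exists_position_permutation:
  fixes vs :: "'i::finite list"
  assumes vs: "distinct vs" "set vs = UNIV" and \<sigma>: "\<forall>i. \<sigma> i permutes {1..d i}"
  obtains s where "s permutes {..<num_vars d}" "vertex_at vs d \<circ> s = vertex_at vs d"
    "\<And>k. k < num_vars d \<Longrightarrow> positions vs d ! s k = (\<lambda>(i, k). (i, \<sigma> i k)) (positions vs d ! k)"
proof -
  let ?P = "(!) (positions vs d)" and ?p = "num_vars d"
  let ?\<tau> = "\<lambda>(i, k). (i, \<sigma> i k)"
  have bij: "bij_betw ?P {..<?p} (vars d)" by (rule bij_betw_positions[OF vs])
  have \<tau>: "bij_betw ?\<tau> (vars d) (vars d)"
  proof (rule bij_betw_imageI)
    show "inj_on ?\<tau> (vars d)"
      using \<sigma> by (auto simp: inj_on_def dest: permutes_inj injD)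
    show "?\<tau> ` vars d = vars d"
    proof
      show "?\<tau> ` vars d \<subseteq> vars d"
      proof
        fix x assume "x \<in> ?\<tau> ` vars d"
        then obtain i k where x: "x = (i, \<sigma> i k)" "k \<in> {1..d i}" by (auto simp: vars_def)
        have "\<sigma> i k \<in> {1..d i}" using permutes_in_image[OF \<sigma>[rule_format], of i k] x(2) by blast
        thus "x \<in> vars d" by (simp add: x(1) vars_def)
      qed
      show "vars d \<subseteq> ?\<tau> ` vars d"
      proof
        fix x assume "x \<in> vars d"
        then obtain i k where x: "x = (i, k)" "k \<in> {1..d i}" by (auto simp: vars_def)
        then obtain l where "l \<in> {1..d i}" "k = \<sigma> i l"
          using permutes_image[OF \<sigma>[rule_format, of i]] by blast
        thus "x \<in> ?\<tau> ` vars d" by (intro image_eqI[of _ _ "(i, l)"]) (auto simp: vars_def x)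
      qed
    qed
  qed
  define s where "s k = (if k < ?p then inv_into {..<?p} ?P (?\<tau> (?P k)) else k)" for k
  have sP: "?P (s k) = ?\<tau> (?P k)" "s k < ?p" if "k < ?p" for k
  proof -
    have "?P k \<in> vars d" by (rule bij_betw_apply[OF bij]) (use that in simp)
    hence "?\<tau> (?P k) \<in> ?P ` {..<?p}"
      using bij_betw_apply[OF \<tau>] unfolding bij_betw_imp_surj_on[OF bij] by blast
    thus "?P (s k) = ?\<tau> (?P k)" "s k < ?p"
      using that f_inv_into_f[of "?\<tau> (?P k)" ?P "{..<?p}"] inv_into_into[of "?\<tau> (?P k)" ?P "{..<?p}"] by (simp_all add: s_def)
  qed
  have "bij_betw s {..<?p} {..<?p}"
  proof (rule bij_betw_imageI)
    show inj: "inj_on s {..<?p}"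
    proof (rule inj_onI)
      fix j k assume h: "j \<in> {..<?p}" "k \<in> {..<?p}" "s j = s k"
      hence "?\<tau> (?P j) = ?\<tau> (?P k)" using sP(1)[of j] sP(1)[of k] by simp
      moreover have "?P j \<in> vars d" "?P k \<in> vars d"
        by (rule bij_betw_apply[OF bij h(1)], rule bij_betw_apply[OF bij h(2)])
      ultimately have "?P j = ?P k" by (rule inj_onD[OF bij_betw_imp_inj_on[OF \<tau>]])
      thus "j = k" by (rule inj_onD[OF bij_betw_imp_inj_on[OF bij] _ h(1,2)])
    qed
    show "s ` {..<?p} = {..<?p}"
      by (rule endo_inj_surj[OF _ _ inj]) (use sP(2) in auto)
  qed
  hence s: "s permutes {..<?p}" by (rule bij_imp_permutes) (simp add: s_def)
  have "vertex_at vs d (s k) = vertex_at vs d k" for k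
  proof (cases "k < ?p")
    case True
    thus ?thesis using sP(1)[OF True] by (simp add: vertex_at_def split: prod.splits)
  qed (simp add: s_def)
  thus ?thesis using that[OF s] sP(1) by (simp add: fun_eq_iff)
qed

text \<open>Non-negative exponents with finitely many total degrees leave finitely many monomials.
  Invariance is demanded only for permutations that fix the vertex sequence.\<close>

lemma exists_poly_series:
  fixes vs :: "'i::finite list"
  assumes vs: "distinct vs" "set vs = UNIV"
    and supp: "\<And>e. G e \<noteq> 0 \<Longrightarrow> keys e \<subseteq> {..<num_vars d} \<and> (\<forall>k. 0 \<le> lookup e k)"
    and fin: "finite (exp_sum (num_vars d) ` {e. G e \<noteq> 0})"
    and sym: "\<And>s e. s permutes {..<num_vars d} \<Longrightarrow> vertex_at vs d \<circ> s = vertex_at vs d \<Longrightarrow>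
       G (permute_exps s e) = G e"
  obtains f where "f \<in> sym_polys d" "poly_series vs d f = G"
    "\<And>m. m \<in> keys f \<Longrightarrow> \<exists>e. G e \<noteq> 0 \<and> int (mono_degree m) = exp_sum (num_vars d) e"
proof -
  let ?p = "num_vars d" and ?P = "(!) (positions vs d)"
  have bij: "bij_betw ?P {..<?p} (vars d)" by (rule bij_betw_positions[OF vs])
  hence inj: "inj_on ?P {..<?p}" by (simp add: bij_betw_def)
  define c where "c m = (if keys m \<subseteq> vars d then G (exps_of_monom ?P ?p m) else 0)" for m
  obtain B where B: "\<And>e. G e \<noteq> 0 \<Longrightarrow> exp_sum ?p e \<le> B"
    using fin by (metis (mono_tags, lifting) Max_ge image_eqI mem_Collect_eq)
  have "lookup e k \<le> B" if "G e \<noteq> 0" "k < ?p" for e k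
  proof -
    have "lookup e k \<le> exp_sum ?p e"
      unfolding exp_sum_def by (rule member_le_sum) (use supp[OF that(1)] that(2) in auto)
    thus ?thesis using B[OF that(1)] by linarith
  qed
  hence "{e. G e \<noteq> 0} \<subseteq> {e. keys e \<subseteq> {..<?p} \<and> (\<forall>k<?p. 0 \<le> lookup e k \<and> lookup e k \<le> B)}"
    using supp by blast
  hence finG: "finite {e. G e \<noteq> 0}" using finite_bounded_exps finite_subset by blast
  have "{m. c m \<noteq> 0} \<subseteq> monom_of ?P ?p ` {e. G e \<noteq> 0}"
  proof
    fix m assume "m \<in> {m. c m \<noteq> 0}"
    hence "keys m \<subseteq> vars d" "G (exps_of_monom ?P ?p m) \<noteq> 0" by (auto simp: c_def split: if_splits)
    thus "m \<in> monom_of ?P ?p ` {e. G e \<noteq> 0}"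
      by (intro image_eqI[of _ _ "exps_of_monom ?P ?p m"]) (simp_all add: monom_of_exps_of_monom[OF bij])
  qed
  hence finc: "finite {m. c m \<noteq> 0}" using finG finite_surj by blast
  define f where "f = Abs_poly_mapping c"
  have lf: "lookup f = c" unfolding f_def by (rule lookup_Abs_poly_mapping[OF finc])
  show ?thesis
  proof (rule that[of f])
    show "f \<in> sym_polys d"
      unfolding sym_polys_def
    proof (intro CollectI conjI ballI allI impI)
      fix m assume "m \<in> keys f"
      thus "keys m \<subseteq> vars d" by (simp add: in_keys_iff lf c_def split: if_splits)
    next
      fix \<sigma> :: "'i \<Rightarrow> nat \<Rightarrow> nat" and m :: "'i \<times> nat \<Rightarrow>\<^sub>0 nat"
      assume \<sigma>: "\<forall>i. \<sigma> i permutes {1..d i}"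
      let ?\<tau> = "\<lambda>(i, k). (i, \<sigma> i k)"
      obtain s where s: "s permutes {..<?p}" "vertex_at vs d \<circ> s = vertex_at vs d"
        "\<And>k. k < ?p \<Longrightarrow> ?P (s k) = ?\<tau> (?P k)"
        using exists_position_permutation[OF vs \<sigma>] by blast
      have "b = c" if "\<sigma> i b = \<sigma> i c" for i b c
        using permutes_inj[OF \<sigma>[rule_format, of i]] that by (rule injD)
      hence inj\<tau>: "inj ?\<tau>" by (auto simp: inj_def)
      have mem: "?\<tau> x \<in> vars d \<longleftrightarrow> x \<in> vars d" for x
      proof (cases x)
        case (Pair i k)
        have "\<sigma> i k \<in> {1..d i} \<longleftrightarrow> k \<in> {1..d i}" by (rule permutes_in_image[OF \<sigma>[rule_format]])
        thus ?thesis by (simp add: Pair vars_def)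
      qed
      have surj: "y \<in> range ?\<tau>" for y
      proof (cases y)
        case (Pair i k)
        obtain l where "k = \<sigma> i l" using permutes_surj[OF \<sigma>[rule_format, of i]] by (metis surjD)
        thus ?thesis by (intro image_eqI[of _ _ "(i, l)"]) (auto simp: Pair)
      qed
      have k: "keys (Poly_Mapping.map_key ?\<tau> m) \<subseteq> vars d \<longleftrightarrow> keys m \<subseteq> vars d"
        unfolding keys_map_key[OF inj\<tau>]
      proof
        assume h: "?\<tau> -` keys m \<subseteq> vars d"
        show "keys m \<subseteq> vars d"
        proof
          fix y assume y: "y \<in> keys m"
          obtain x where x: "y = ?\<tau> x" using surj by blast
          hence "x \<in> vars d" using h y by blast
          thus "y \<in> vars d" using mem x by simp
        qed
      next
        assume "keys m \<subseteq> vars d"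
        thus "?\<tau> -` keys m \<subseteq> vars d" using mem by blast
      qed
      have "exps_of_monom ?P ?p (Poly_Mapping.map_key ?\<tau> m) = permute_exps s (exps_of_monom ?P ?p m)"
      proof (rule poly_mapping_eqI)
        fix k
        have "s k < ?p \<longleftrightarrow> k < ?p" using permutes_in_image[OF s(1), of k] by simp
        thus "lookup (exps_of_monom ?P ?p (Poly_Mapping.map_key ?\<tau> m)) k = lookup (permute_exps s (exps_of_monom ?P ?p m)) k"
          using s(3)[of k]
          by (simp only: lookup_map_key[OF inj\<tau>] lookup_map_key[OF permutes_inj[OF s(1)]] lookup_exps_of_monom) simp
      qed
      hence "c (Poly_Mapping.map_key ?\<tau> m) = c m"
        using sym[OF s(1,2)] by (simp only: c_def k)
      thus "lookup f (Poly_Mapping.map_key ?\<tau> m) = lookup f m" by (simp only: lf)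
    qed
    show "poly_series vs d f = G"
    proof
      fix e
      show "poly_series vs d f e = G e"
      proof (cases "keys e \<subseteq> {..<?p} \<and> (\<forall>k. 0 \<le> lookup e k)")
        case True
        have "keys (monom_of ?P ?p e) \<subseteq> vars d" using keys_monom_of[of ?P ?p e] bij by (simp add: bij_betw_def)
        thus ?thesis unfolding poly_series_eq lf c_def
          using exps_of_monom_monom_of[OF inj, of e] True by simp
      next
        case False
        hence "G e = 0" using supp by blast
        thus ?thesis using False unfolding poly_series_eq by auto
      qed
    qed
    fix m assume "m \<in> keys f"
    hence m: "keys m \<subseteq> vars d" "G (exps_of_monom ?P ?p m) \<noteq> 0"
      by (auto simp: in_keys_iff lf c_def split: if_splits)
    have "int (mono_degree (monom_of ?P ?p (exps_of_monom ?P ?p m))) = exp_sum ?p (exps_of_monom ?P ?p m)"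
      by (rule mono_degree_monom_of) (simp add: lookup_exps_of_monom)
    thus "\<exists>e. G e \<noteq> 0 \<and> int (mono_degree m) = exp_sum ?p e"
      using m(2) by (auto simp: monom_of_exps_of_monom[OF bij m(1)])
  qed
qed

section \<open>Correlation functions from symmetric polynomials\<close>

definition content :: "nat \<Rightarrow> (nat \<Rightarrow> 'i) \<Rightarrow> 'i \<Rightarrow> nat" where
  "content p v i = card {k. k < p \<and> v k = i}"

text \<open>Names each position by a variable of its vertex. No labelling of a general sequence is
  canonical; for the sorted one, \<open>positions\<close> provides one.\<close>

definition labelling :: "nat \<Rightarrow> (nat \<Rightarrow> 'i) \<Rightarrow> (nat \<Rightarrow> 'i \<times> nat) \<Rightarrow> bool" where
  "labelling p v \<beta> \<longleftrightarrow> bij_betw \<beta> {..<p} (vars (content p v)) \<and> (\<forall>k<p. fst (\<beta> k) = v k)"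

lemma labelling_exists: "\<exists>\<beta>. labelling p v \<beta>"
proof -
  let ?K = "\<lambda>i. {k. k < p \<and> v k = i}"
  have "\<exists>b. bij_betw b (?K i) {1..content p v i}" for i
    using ex_bij_betw_nat_finite_1[of "?K i"] bij_betw_inv by (fastforce simp: content_def)
  then obtain b where b: "\<And>i. bij_betw (b i) (?K i) {1..content p v i}" by metis
  define \<beta> where "\<beta> k = (v k, b (v k) k)" for k
  have "bij_betw \<beta> {..<p} (vars (content p v))"
  proof (rule bij_betw_imageI)
    show "inj_on \<beta> {..<p}"
    proof (rule inj_onI)
      fix j k assume h: "j \<in> {..<p}" "k \<in> {..<p}" "\<beta> j = \<beta> k"
      hence "v j = v k" "b (v k) j = b (v k) k" by (auto simp: \<beta>_def)
      thus "j = k" using inj_onD[OF bij_betw_imp_inj_on[OF b[of "v k"]], of j k] h(1,2) by simp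
    qed
    show "\<beta> ` {..<p} = vars (content p v)"
    proof (intro equalityI subsetI)
      fix x assume "x \<in> \<beta> ` {..<p}"
      then obtain k where k: "k < p" "x = \<beta> k" by blast
      have "b (v k) k \<in> {1..content p v (v k)}" by (rule bij_betw_apply[OF b]) (use k in simp)
      thus "x \<in> vars (content p v)" by (simp add: k vars_def \<beta>_def)
    next
      fix x assume "x \<in> vars (content p v)"
      then obtain i l where x: "x = (i, l)" "l \<in> {1..content p v i}" by (auto simp: vars_def)
      then obtain k where "k \<in> ?K i" "l = b i k" using bij_betw_imp_surj_on[OF b[of i]] by blast
      thus "x \<in> \<beta> ` {..<p}" by (intro image_eqI[of _ _ k]) (auto simp: \<beta>_def x)
    qed
  qed
  thus ?thesis unfolding labelling_def by (intro exI[of _ \<beta>]) (simp add: \<beta>_def)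
qed

lemma sym_polys_labelling:
  assumes f: "f \<in> sym_polys (content p v)" and \<beta>: "labelling p v \<beta>" and \<gamma>: "labelling p v \<gamma>"
  shows "lookup f (monom_of \<beta> p e) = lookup f (monom_of \<gamma> p e)"
proof -
  let ?d = "content p v"
  have bij: "bij_betw \<beta> {..<p} (vars ?d)" "bij_betw \<gamma> {..<p} (vars ?d)"
    and fst: "\<And>k. k < p \<Longrightarrow> fst (\<beta> k) = v k" "\<And>k. k < p \<Longrightarrow> fst (\<gamma> k) = v k"
    using \<beta> \<gamma> by (auto simp: labelling_def)
  define ix where "ix i k = inv_into {..<p} \<beta> (i, k)" for i k
  have ix: "ix i k < p \<and> \<beta> (ix i k) = (i, k)" if "k \<in> {1..?d i}" for i k
  proof -
    have m: "(i, k) \<in> \<beta> ` {..<p}" using that bij(1) by (simp add: bij_betw_def vars_def)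
    thus ?thesis unfolding ix_def using f_inv_into_f[OF m] inv_into_into[OF m] by simp
  qed
  \<comment> \<open>Two labellings differ, block by block, by a permutation: the position labelled
    \<open>(i, k)\<close> by \<beta> is labelled \<open>(i, \<sigma> i k)\<close> by
    \<gamma>.\<close>
  define \<sigma> where "\<sigma> i k = (if k \<in> {1..?d i} then snd (\<gamma> (ix i k)) else k)" for i k
  have \<sigma>: "\<gamma> (ix i k) = (i, \<sigma> i k) \<and> \<sigma> i k \<in> {1..?d i}" if "k \<in> {1..?d i}" for i k
  proof -
    have "v (ix i k) = i" using fst(1) ix[OF that] by fastforce
    hence 1: "\<gamma> (ix i k) = (i, \<sigma> i k)" using that fst(2) ix[OF that] by (simp add: \<sigma>_def prod_eq_iff)
    moreover have "\<gamma> (ix i k) \<in> vars ?d" by (rule bij_betw_apply[OF bij(2)]) (use ix[OF that] in simp)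
    ultimately show ?thesis by (simp add: vars_def)
  qed
  have perm: "\<sigma> i permutes {1..?d i}" for i
  proof (rule bij_imp_permutes)
    have inj: "inj_on (\<sigma> i) {1..?d i}"
    proof (rule inj_onI)
      fix k l assume h: "k \<in> {1..?d i}" "l \<in> {1..?d i}" "\<sigma> i k = \<sigma> i l"
      hence "\<gamma> (ix i k) = \<gamma> (ix i l)" using \<sigma>[OF h(1), THEN conjunct1] \<sigma>[OF h(2), THEN conjunct1] by (simp only:)
      hence "ix i k = ix i l"
        by (rule inj_onD[OF bij_betw_imp_inj_on[OF bij(2)]]) (simp_all only: lessThan_iff ix[OF h(1)] ix[OF h(2)])
      hence "(i, k) = (i, l)" using ix[OF h(1), THEN conjunct2] ix[OF h(2), THEN conjunct2] by (simp only:)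
      thus "k = l" by simp
    qed
    moreover have "\<sigma> i ` {1..?d i} = {1..?d i}"
      by (rule endo_inj_surj[OF _ _ inj]) (use \<sigma> in blast)+
    ultimately show "bij_betw (\<sigma> i) {1..?d i} {1..?d i}" by (simp add: bij_betw_def)
  qed (auto simp: \<sigma>_def)
  let ?\<tau> = "\<lambda>(i, k). (i, \<sigma> i k)"
  have "b = c" if "\<sigma> i b = \<sigma> i c" for i b c
    using permutes_inj[OF perm[of i]] that by (rule injD)
  hence inj\<tau>: "inj ?\<tau>" by (auto simp: inj_def)
  have inj: "inj_on \<beta> {..<p}" "inj_on \<gamma> {..<p}" using bij by (simp_all add: bij_betw_def)
  have "Poly_Mapping.map_key ?\<tau> (monom_of \<gamma> p e) = monom_of \<beta> p e"
  proof (rule poly_mapping_eqI)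
    fix x :: "'a \<times> nat"
    obtain i k where x: "x = (i, k)" by fastforce
    show "lookup (Poly_Mapping.map_key ?\<tau> (monom_of \<gamma> p e)) x = lookup (monom_of \<beta> p e) x"
    proof (cases "k \<in> {1..?d i}")
      case True
      have "lookup (monom_of \<gamma> p e) (i, \<sigma> i k) = nat (lookup e (ix i k))"
        using lookup_monom_of_inj[OF inj(2), of "ix i k" e] ix[OF True] \<sigma>[OF True] by simp
      moreover have "lookup (monom_of \<beta> p e) (i, k) = nat (lookup e (ix i k))"
        using lookup_monom_of_inj[OF inj(1), of "ix i k" e] ix[OF True] by simp
      ultimately show ?thesis by (simp add: lookup_map_key[OF inj\<tau>] x)
    next
      case False
      hence "(i, k) \<notin> vars ?d" "\<sigma> i k = k" by (auto simp: vars_def \<sigma>_def)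
      moreover have "keys (monom_of \<beta> p e) \<subseteq> vars ?d" "keys (monom_of \<gamma> p e) \<subseteq> vars ?d"
        using keys_monom_of[of \<beta> p e] keys_monom_of[of \<gamma> p e] bij by (simp_all add: bij_betw_def)
      ultimately have "lookup (monom_of \<beta> p e) (i, k) = 0" "lookup (monom_of \<gamma> p e) (i, k) = 0"
        by (auto simp: in_keys_iff)
      thus ?thesis using \<open>\<sigma> i k = k\<close> by (simp add: lookup_map_key[OF inj\<tau>] x)
    qed
  qed
  moreover have "lookup f (Poly_Mapping.map_key ?\<tau> (monom_of \<gamma> p e)) = lookup f (monom_of \<gamma> p e)"
    using f perm unfolding sym_polys_def by blast
  ultimately show ?thesis by simp
qed

text \<open>The choice of the labelling is immaterial by \<open>sym_polys_labelling\<close>.\<close>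

definition poly_family :: "(('i \<Rightarrow> nat) \<Rightarrow> 'i xpoly) \<Rightarrow> nat \<Rightarrow> (nat \<Rightarrow> 'i) \<Rightarrow> zseries" where
  "poly_family h p v e = (if keys e \<subseteq> {..<p} \<and> (\<forall>k. 0 \<le> lookup e k)
     then lookup (h (content p v)) (monom_of (SOME \<beta>. labelling p v \<beta>) p e) else 0)"

lemma poly_family_labelling:
  assumes "h (content p v) \<in> sym_polys (content p v)" "labelling p v \<beta>"
  shows "poly_family h p v e = (if keys e \<subseteq> {..<p} \<and> (\<forall>k. 0 \<le> lookup e k)
     then lookup (h (content p v)) (monom_of \<beta> p e) else 0)"
  using sym_polys_labelling[OF assms(1) someI_ex[OF labelling_exists] assms(2)] by (simp add: poly_family_def)

lemma content_cong: "(\<And>k. k < p \<Longrightarrow> v k = v' k) \<Longrightarrow> content p v = content p v'"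
  unfolding content_def by (rule ext) (rule arg_cong[where f = card], auto)

lemma poly_family_cong:
  assumes "\<And>k. k < p \<Longrightarrow> v k = v' k"
  shows "poly_family h p v = poly_family h p v'"
proof -
  have "labelling p v = labelling p v'"
    using assms by (simp add: labelling_def fun_eq_iff content_cong[OF assms])
  hence "poly_family h p v e = poly_family h p v' e" for e
    by (simp only: poly_family_def content_cong[OF assms])
  thus ?thesis by (rule ext)
qed

lemma content_permutes:
  assumes s: "s permutes {..<p}"
  shows "content p (v \<circ> s) = content p v"
proof
  fix i
  have m: "s k < p \<longleftrightarrow> k < p" for k using permutes_in_image[OF s, of k] by simp
  have "{k. k < p \<and> v k = i} = s ` {k. k < p \<and> (v \<circ> s) k = i}"
  proof (intro equalityI subsetI)
    fix k assume k: "k \<in> {k. k < p \<and> v k = i}"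
    obtain l where "k = s l" using permutes_surj[OF s] by (metis surjD)
    thus "k \<in> s ` {k. k < p \<and> (v \<circ> s) k = i}" using k m by auto
  qed (use m in auto)
  thus "content p (v \<circ> s) i = content p v i"
    unfolding content_def using card_image[OF inj_on_subset[OF permutes_inj[OF s] subset_UNIV]] by metis
qed

text \<open>If \<beta> labels \<open>v\<close>, then \<open>\<beta> \<circ> s\<close> labels
  \<open>v \<circ> s\<close>, and it assigns the same monomial to the permuted exponents.\<close>

lemma poly_family_permutes:
  assumes h: "\<And>d. h d \<in> sym_polys d" and s: "s permutes {..<p}"
  shows "poly_family h p (v \<circ> s) (permute_exps s e) = poly_family h p v e"
proof -
  obtain \<beta> where \<beta>: "labelling p v \<beta>" using labelling_exists by blast
  have m: "s k < p \<longleftrightarrow> k < p" for k using permutes_in_image[OF s, of k] by simp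
  have inj: "inj s" by (rule permutes_inj[OF s])
  have surj: "\<exists>l. k = s l" for k using permutes_surj[OF s] by (metis surjD)
  have "labelling p (v \<circ> s) (\<beta> \<circ> s)"
    using \<beta> bij_betw_trans[OF permutes_imp_bij[OF s]] m
    by (auto simp: labelling_def content_permutes[OF s])
  moreover have "monom_of (\<beta> \<circ> s) p (permute_exps s e) = monom_of \<beta> p e"
    unfolding monom_of_def lookup_map_key[OF inj]
    using sum.permute[OF s, of "\<lambda>k. single (\<beta> k) (nat (lookup e k))"] by (simp add: comp_def)
  moreover have "keys (permute_exps s e) \<subseteq> {..<p} \<longleftrightarrow> keys e \<subseteq> {..<p}"
    unfolding keys_map_key[OF inj] subset_eq using m surj by (metis lessThan_iff vimage_eq)
  moreover have "(\<forall>k. 0 \<le> lookup (permute_exps s e) k) \<longleftrightarrow> (\<forall>k. 0 \<le> lookup e k)"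
    unfolding lookup_map_key[OF inj] using surj by metis
  ultimately show ?thesis
    using poly_family_labelling[of h p "v \<circ> s" "\<beta> \<circ> s" "permute_exps s e"]
      poly_family_labelling[of h p v \<beta> e] h \<beta> by (simp only: content_permutes[OF s])
qed

lemma poly_family_laurent: "poly_family h p v \<in> laurent p"
  by (rule laurentI) (auto simp: poly_family_def split: if_splits)

definition exps_of :: "'i gen list \<Rightarrow> (nat \<Rightarrow>\<^sub>0 int)" where
  "exps_of ws = (\<Sum>k<length ws. single k (- snd (ws ! k) - 1))"

lemma lookup_exps_of: "lookup (exps_of ws) k = (if k < length ws then - snd (ws ! k) - 1 else 0)"
  by (simp add: exps_of_def lookup_sum lookup_single_if sum.delta)

definition quotient_series ::
  "('i::finite, 'a) pre_digraph \<Rightarrow> (('i \<Rightarrow> nat) \<Rightarrow> 'i xpoly) \<Rightarrow> nat \<Rightarrow> (nat \<Rightarrow> 'i) \<Rightarrow> zseries" where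
  "quotient_series Q h p v = dmul_list (pair_list p) (\<lambda>x. - loc_weight Q v x) (poly_family h p v)"

text \<open>The value on a word is a coefficient of the polynomial divided by the product of
  differences, at the exponents \<open>-n-1\<close> that belong to the modes of the word.\<close>

definition correlator_of_family ::
  "('i::finite, 'a) pre_digraph \<Rightarrow> (('i \<Rightarrow> nat) \<Rightarrow> 'i xpoly) \<Rightarrow> 'i gen list \<Rightarrow> rat" where
  "correlator_of_family Q h ws = quotient_series Q h (length ws) (\<lambda>k. fst (ws ! k)) (exps_of ws)"

lemma quotient_series_laurent: "quotient_series Q h p v \<in> laurent p"
  unfolding quotient_series_def by (intro dmul_list_laurent poly_family_laurent) (simp add: set_pair_list)

lemma quotient_series_cong:
  assumes "\<And>k. k < p \<Longrightarrow> v k = v' k"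
  shows "quotient_series Q h p v = quotient_series Q h p v'"
proof -
  have "poly_family h p v = poly_family h p v'" by (rule poly_family_cong[OF assms])
  thus ?thesis unfolding quotient_series_def
    by (simp only:) (rule dmul_list_cong, use assms in \<open>auto simp: set_pair_list ordered_pairs_def loc_weight_def\<close>)
qed

lemma correlator_of_family_eq:
  assumes "length ws = p" "\<And>k. k < p \<Longrightarrow> v k = fst (ws ! k)"
  shows "correlator_of_family Q h ws = quotient_series Q h p v (exps_of ws)"
  unfolding correlator_of_family_def assms(1) by (subst quotient_series_cong[of p v "\<lambda>k. fst (ws ! k)"]) (simp_all add: assms(2))

lemma corr_correlator_of_family: "corr (correlator_of_family Q h) p v = quotient_series Q h p v"
proof
  fix e
  show "corr (correlator_of_family Q h) p v e = quotient_series Q h p v e"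
  proof (cases "keys e \<subseteq> {..<p}")
    case True
    let ?w = "map (\<lambda>k. (v k, - lookup e k - 1)) [0..<p]"
    have "exps_of ?w = e"
    proof (rule poly_mapping_eqI)
      fix k show "lookup (exps_of ?w) k = lookup e k"
      proof (cases "k < p")
        case False
        hence "k \<notin> keys e" using True by auto
        thus ?thesis using False by (simp add: lookup_exps_of in_keys_iff)
      qed (simp add: lookup_exps_of)
    qed
    moreover have "correlator_of_family Q h ?w = quotient_series Q h p v (exps_of ?w)"
      by (rule correlator_of_family_eq) simp_all
    ultimately show ?thesis using True by (simp add: corr_def)
  next
    case False
    thus ?thesis using laurent_keys[OF quotient_series_laurent, of Q h p v e] by (auto simp: corr_def)
  qed
qed

text \<open>By this, the functional built from a family of polynomials has that family as its
  image.\<close>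

lemma F_corr_correlator_of_family: "F_corr Q (correlator_of_family Q h) p v = poly_family h p v"
  unfolding F_corr_def corr_correlator_of_family quotient_series_def
  by (rule dmul_list_inverse[OF poly_family_laurent]) (simp add: set_pair_list)

text \<open>The factor at \<open>(a, Suc a)\<close> is split off; the rest \<open>H\<close> is
  symmetric under the exchange, so \<open>locality_sum_of_symmetric\<close> applies.\<close>

lemma quotient_series_locality:
  assumes Q: "symmetric_quiver Q" and h: "\<And>d. h d \<in> sym_polys d" and a: "Suc a < p"
  shows "locality_sum Q (v a) (v (Suc a)) a (quotient_series Q h p v) (quotient_series Q h p (v \<circ> adj a)) e = 0"
proof -
  have a': "a < Suc a" by simp
  let ?v = "v \<circ> adj a" and ?P = "poly_family h p"
  let ?w = "\<lambda>v x. - loc_weight Q v x"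
  define H where "H v = dmul_list (other_pairs p a) (?w v) (?P v)" for v
  have H: "H v \<in> laurent p" for v
    unfolding H_def by (rule dmul_list_laurent[OF poly_family_laurent other_pairs_subset])
  have q: "quotient_series Q h p v = dmul a (Suc a) (?w v (a, Suc a)) (H v)" for v
    unfolding quotient_series_def H_def dmul_pair_list[OF poly_family_laurent a]
      dmul_dmul_list[OF poly_family_laurent other_pairs_subset a' a] ..
  have s: "adj a permutes {..<p}" using a by (intro permutes_swap_id) auto
  have P: "?P v = (\<lambda>e. ?P ?v (permute_exps (adj a) e))"
    using poly_family_permutes[OF h s] by (simp add: fun_eq_iff)
  have "H v e = H ?v (permute_exps (adj a) e)" for e
    unfolding H_def by (subst P, rule dmul_other_pairs_adj[OF poly_family_laurent a]) (simp add: loc_weight_def)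
  hence "locality_sum Q (v a) (v (Suc a)) a (dmul a (Suc a) (- locality Q (v a) (v (Suc a))) (H v))
     (dmul a (Suc a) (- locality Q (v a) (v (Suc a))) (H ?v)) e = 0"
    by (rule locality_sum_of_symmetric[OF H H a])
  thus ?thesis unfolding q using locality_commute[OF Q] by (simp add: loc_weight_def)
qed

lemma correlator_correlator_of_family:
  assumes Q: "symmetric_quiver Q" and h: "\<And>d. h d \<in> sym_polys d"
  shows "correlator Q (correlator_of_family Q h)"
  unfolding correlator_def
proof (intro conjI allI impI)
  fix x y :: "'a gen list" and i j m n
  let ?N = "locality_pos Q i j" and ?a = "length x"
  \<comment> \<open>The first mode is lowered by \<open>?N\<close> so that the \<open>k\<close>-th
    shift, which lowers its exponent by \<open>?N - k\<close>, leads to mode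
    \<open>m - k\<close>.\<close>
  define ws where "ws = x @ [(i, m - int ?N), (j, n)] @ y"
  define p where "p = length ws"
  define v where "v k = fst (ws ! k)" for k
  have a: "Suc ?a < p" by (simp add: p_def ws_def)
  have va: "v ?a = i" "v (Suc ?a) = j" by (simp_all add: v_def ws_def nth_append)
  have 1: "correlator_of_family Q h (x @ [(i, m - int k), (j, n + int k)] @ y) =
     quotient_series Q h p v (shifted ?a (Suc ?a) (int ?N) (exps_of ws) k)" for k
  proof -
    have "exps_of (x @ [(i, m - int k), (j, n + int k)] @ y) = shifted ?a (Suc ?a) (int ?N) (exps_of ws) k"
      by (rule poly_mapping_eqI)
         (auto simp: lookup_shifted lookup_exps_of ws_def nth_append nth_Cons split: nat.splits)
    moreover have "correlator_of_family Q h (x @ [(i, m - int k), (j, n + int k)] @ y) =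
       quotient_series Q h p v (exps_of (x @ [(i, m - int k), (j, n + int k)] @ y))"
      by (rule correlator_of_family_eq) (auto simp: p_def v_def ws_def nth_append nth_Cons split: nat.splits)
    ultimately show ?thesis by simp
  qed
  have 2: "correlator_of_family Q h (x @ [(j, n + int k), (i, m - int k)] @ y) =
     quotient_series Q h p (v \<circ> adj ?a) (permute_exps (adj ?a) (shifted ?a (Suc ?a) (int ?N) (exps_of ws) k))" for k
  proof -
    have "exps_of (x @ [(j, n + int k), (i, m - int k)] @ y) = permute_exps (adj ?a) (shifted ?a (Suc ?a) (int ?N) (exps_of ws) k)"
      by (rule poly_mapping_eqI)
         (auto simp: lookup_shifted lookup_exps_of ws_def nth_append nth_Cons transpose_def split: nat.splits)
    moreover have "correlator_of_family Q h (x @ [(j, n + int k), (i, m - int k)] @ y) =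
       quotient_series Q h p (v \<circ> adj ?a) (exps_of (x @ [(j, n + int k), (i, m - int k)] @ y))"
      by (rule correlator_of_family_eq)
         (auto simp: p_def v_def ws_def nth_append nth_Cons transpose_def split: nat.splits)
    ultimately show ?thesis by simp
  qed
  show "(\<Sum>k=0..?N. (-1) ^ k * of_nat (?N choose k) *
        (correlator_of_family Q h (x @ [(i, m - int k), (j, n + int k)] @ y)
         - braid_sign Q (basis_vec i) (basis_vec j) * correlator_of_family Q h (x @ [(j, n + int k), (i, m - int k)] @ y))) = 0"
    using quotient_series_locality[OF Q h a, of v "exps_of ws"]
    unfolding 1 2 va locality_sum_def atLeast0AtMost .
next
  fix x :: "'a gen list" and i and n :: int assume n: "n \<ge> 0"
  let ?ws = "x @ [(i, n)]" and ?v = "\<lambda>k. fst ((x @ [(i, n)]) ! k)"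
  \<comment> \<open>The last exponent is \<open>-n-1 < 0\<close>, while dividing by differences
    never produces negative powers of the last variable.\<close>
  have "lookup (exps_of ?ws) (length x) \<ge> 0"
    if "quotient_series Q h (Suc (length x)) ?v (exps_of ?ws) \<noteq> 0"
    by (rule dmul_list_nonneg_last[OF _ that[unfolded quotient_series_def]])
       (auto simp: set_pair_list poly_family_def split: if_splits)
  thus "correlator_of_family Q h ?ws = 0"
    using n by (auto simp: correlator_of_family_def lookup_exps_of)
qed

section \<open>The graded isomorphism\<close>

lemma pair_list_Suc: "pair_list (Suc p) = pair_list p @ map (\<lambda>k. (k, p)) [0..<p]"
  by (simp add: pair_list_def)

lemma content_eq_sum: "int (content p v i) = (\<Sum>k<p. basis_vec (v k) i)"
proof -
  have "(\<Sum>k<p. basis_vec (v k) i) = (\<Sum>k\<in>{k\<in>{..<p}. v k = i}. 1)"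
    by (subst sum.inter_filter) (auto simp: basis_vec_def intro!: sum.cong)
  thus ?thesis by (simp add: content_def)
qed

text \<open>The diagonal terms are what the generators contribute to twice the weight; the
  off-diagonal ones come in equal pairs and amount to the degree of the product of differences.
  Together they form the shift in \<open>coha_comp\<close>.\<close>

lemma euler_content:
  assumes Q: "symmetric_quiver Q"
  shows "euler Q (\<lambda>i. int (content p v i)) (\<lambda>i. int (content p v i)) =
    (\<Sum>k<p. euler Q (basis_vec (v k)) (basis_vec (v k))) - 2 * sum_list (map (loc_weight Q v) (pair_list p))"
proof -
  let ?c = "\<lambda>k l. euler Q (basis_vec (v k)) (basis_vec (v l))"
  have "(\<Sum>k<p. \<Sum>l<p. ?c k l) = (\<Sum>k<p. ?c k k) - 2 * sum_list (map (loc_weight Q v) (pair_list p))"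
  proof (induction p)
    case (Suc p)
    have "(\<Sum>k<p. ?c p k) = (\<Sum>k<p. ?c k p)" by (rule sum.cong) (simp_all add: euler_commute[OF Q])
    moreover have "sum_list (map (loc_weight Q v) (map (\<lambda>k. (k, p)) [0..<p])) = - (\<Sum>k<p. ?c k p)"
      by (simp add: comp_def loc_weight_def locality_def interv_sum_list_conv_sum_set_nat sum_negf atLeast0LessThan)
    ultimately show ?case using Suc by (simp add: pair_list_Suc sum.distrib)
  qed (simp add: pair_list_def)
  thus ?thesis by (simp add: content_eq_sum euler_sum_basis_vec)
qed

lemma word_degree_gen:
  "word_degree (Word (map Gen ws)) = (\<lambda>i. int (content (length ws) (\<lambda>k. fst (ws ! k)) i))"
proof
  fix i
  have "word_degree (Word (map Gen ws)) i = (\<Sum>x\<leftarrow>ws. basis_vec (fst x) i)"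
    by (simp add: word_degree_def comp_def)
  also have "\<dots> = (\<Sum>k<length ws. basis_vec (fst (ws ! k)) i)"
    by (simp add: sum_list_sum_nth atLeast0LessThan)
  finally show "word_degree (Word (map Gen ws)) i = int (content (length ws) (\<lambda>k. fst (ws ! k)) i)"
    by (simp add: content_eq_sum)
qed

text \<open>Doubled, because weights are half-integral and the cohomological degree is minus twice
  the weight. The exponent \<open>-n-1\<close> absorbs the constant in the weight of
  \<open>i(n)\<close>.\<close>

lemma word_weight_gen:
  "2 * word_weight Q (Word (map Gen ws)) = of_int
    ((\<Sum>k<length ws. euler Q (basis_vec (fst (ws ! k))) (basis_vec (fst (ws ! k)))) + 2 * exp_sum (length ws) (exps_of ws))"
proof -
  have "word_weight Q (Word (map Gen ws)) =
     (\<Sum>x\<leftarrow>ws. of_int (euler Q (basis_vec (fst x)) (basis_vec (fst x))) / 2 - of_int (snd x) - 1)"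
    by (simp add: word_weight_def comp_def)
  also have "\<dots> = (\<Sum>k<length ws. of_int (euler Q (basis_vec (fst (ws ! k))) (basis_vec (fst (ws ! k)))) / 2 + of_int (lookup (exps_of ws) k))"
    by (simp add: sum_list_sum_nth atLeast0LessThan lookup_exps_of algebra_simps)
  finally show ?thesis
    by (simp add: exp_sum_def sum.distrib sum_distrib_left distrib_left)
qed

lemma gen_word_principal_comp:
  assumes Q: "symmetric_quiver Q"
  shows "pcls Q (gen_word ws) \<in> principal_comp Q (content (length ws) (\<lambda>k. fst (ws ! k)))
    (- ((\<Sum>k<length ws. euler Q (basis_vec (fst (ws ! k))) (basis_vec (fst (ws ! k)))) + 2 * exp_sum (length ws) (exps_of ws)))"
  unfolding principal_comp_def
proof (rule imageI, intro CollectI ballI)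
  fix w assume "w \<in> keys (gen_word ws)"
  hence w: "w = Word (map Gen ws)" by (simp add: gen_word_def)
  show "word_degree w = (\<lambda>i. int (content (length ws) (\<lambda>k. fst (ws ! k)) i)) \<and>
    of_int (- ((\<Sum>k<length ws. euler Q (basis_vec (fst (ws ! k))) (basis_vec (fst (ws ! k)))) + 2 * exp_sum (length ws) (exps_of ws)))
     = - 2 * word_weight Q w"
    using word_degree_gen[of ws] word_weight_gen[of Q ws] unfolding w by simp
qed

lemma corr_word:
  "corr \<theta> (length ws) (\<lambda>k. fst (ws ! k)) (exps_of ws) = \<theta> ws"
proof -
  have "keys (exps_of ws) \<subseteq> {..<length ws}" by (auto simp: in_keys_iff lookup_exps_of split: if_splits)
  moreover have "map (\<lambda>k. (fst (ws ! k), - lookup (exps_of ws) k - 1)) [0..<length ws] = ws"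
    by (rule nth_equalityI) (simp_all add: lookup_exps_of)
  ultimately show ?thesis by (simp add: corr_def)
qed

text \<open>The product of differences shifts the total degree by its own degree, and
  \<open>euler_content\<close> combines this with the weight of an underlying word.\<close>

lemma F_corr_support:
  assumes Q: "symmetric_quiver Q" and ne: "F_corr Q (correlator_of Q \<xi>) p v e \<noteq> 0"
  shows "(content p v, euler Q (\<lambda>i. int (content p v i)) (\<lambda>i. int (content p v i)) + 2 * exp_sum p e) \<in> dual_support Q \<xi>"
proof -
  let ?\<theta> = "correlator_of Q \<xi>"
  obtain e' where e': "corr ?\<theta> p v e' \<noteq> 0"
    and tot: "exp_sum p e = exp_sum p e' + sum_list (map (loc_weight Q v) (pair_list p))"
    using dmul_list_exp_sum[OF _ ne[unfolded F_corr_def]] by (auto simp: set_pair_list)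
  define ws where "ws = map (\<lambda>k. (v k, - lookup e' k - 1)) [0..<p]"
  have len: "length ws = p" by (simp add: ws_def)
  have v: "fst (ws ! k) = v k" "lookup (exps_of ws) k = lookup e' k" if "k < p" for k
    using that by (simp_all add: ws_def lookup_exps_of)
  have "?\<theta> ws \<noteq> 0" using e' by (simp add: corr_def ws_def split: if_splits)
  hence ne': "\<xi> (pcls Q (gen_word ws)) \<noteq> 0" by (simp add: correlator_of_def)
  have c: "content (length ws) (\<lambda>k. fst (ws ! k)) = content p v"
    unfolding len by (rule content_cong) (rule v)
  have t: "exp_sum (length ws) (exps_of ws) = exp_sum p e'" by (simp add: exp_sum_def len v)
  have s: "(\<Sum>k<length ws. euler Q (basis_vec (fst (ws ! k))) (basis_vec (fst (ws ! k)))) = (\<Sum>k<p. euler Q (basis_vec (v k)) (basis_vec (v k)))"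
    by (simp add: len v)
  have "(content p v, (\<Sum>k<p. euler Q (basis_vec (v k)) (basis_vec (v k))) + 2 * exp_sum p e') \<in> dual_support Q \<xi>"
    unfolding dual_support_def using gen_word_principal_comp[OF Q, of ws, unfolded c t s] ne' by blast
  thus ?thesis using tot euler_content[OF Q, of p v] by (simp add: algebra_simps)
qed

section \<open>Sorted vertex sequences, and linearity\<close>

lemma content_vertex_at:
  fixes vs :: "'i::finite list"
  assumes vs: "distinct vs" "set vs = UNIV"
  shows "content (num_vars d) (vertex_at vs d) = d"
proof
  fix i
  let ?P = "(!) (positions vs d)" and ?K = "{k. k < num_vars d \<and> vertex_at vs d k = i}"
  have bij: "bij_betw ?P {..<num_vars d} (vars d)" by (rule bij_betw_positions[OF vs])
  have "?P ` ?K = {i} \<times> {1..d i}"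
  proof (intro equalityI subsetI)
    fix x assume "x \<in> ?P ` ?K"
    then obtain k where k: "k < num_vars d" "fst (?P k) = i" "x = ?P k" by (auto simp: vertex_at_def)
    have "?P k \<in> vars d" by (rule bij_betw_apply[OF bij]) (use k in simp)
    thus "x \<in> {i} \<times> {1..d i}" using k by (auto simp: vars_def)
  next
    fix x assume x: "x \<in> {i} \<times> {1..d i}"
    hence "x \<in> ?P ` {..<num_vars d}" unfolding bij_betw_imp_surj_on[OF bij] by (auto simp: vars_def)
    then obtain k where k: "k < num_vars d" "x = ?P k" by blast
    thus "x \<in> ?P ` ?K" using x by (intro image_eqI[of _ _ k]) (auto simp: vertex_at_def)
  qed
  moreover have "inj_on ?P ?K" by (rule inj_on_subset[OF bij_betw_imp_inj_on[OF bij]]) auto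
  ultimately have "card ?K = card ({i} \<times> {1..d i})" using card_image[of ?P ?K] by (simp only:)
  thus "content (num_vars d) (vertex_at vs d) i = d i" by (simp add: content_def)
qed

lemma labelling_positions:
  fixes vs :: "'i::finite list"
  assumes vs: "distinct vs" "set vs = UNIV"
  shows "labelling (num_vars d) (vertex_at vs d) ((!) (positions vs d))"
  unfolding labelling_def content_vertex_at[OF vs] using bij_betw_positions[OF vs] by (simp add: vertex_at_def)

lemma poly_family_standard:
  fixes vs :: "'i::finite list"
  assumes vs: "distinct vs" "set vs = UNIV" and h: "\<And>d. h d \<in> sym_polys d"
  shows "poly_family h (num_vars d) (vertex_at vs d) = poly_series vs d (h d)"
proof
  fix e
  show "poly_family h (num_vars d) (vertex_at vs d) e = poly_series vs d (h d) e"
    using poly_family_labelling[of h, OF _ labelling_positions[OF vs], of d e]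
    by (simp add: content_vertex_at[OF vs] h poly_series_eq)
qed

lemma F_corr_cong:
  assumes "\<And>k. k < p \<Longrightarrow> v k = v' k"
  shows "F_corr Q \<theta> p v = F_corr Q \<theta> p v'"
proof -
  have c: "corr \<theta> p v = corr \<theta> p v'" by (rule corr_cong[OF assms])
  show ?thesis unfolding F_corr_def c
    by (rule dmul_list_cong) (use assms in \<open>auto simp: set_pair_list ordered_pairs_def loc_weight_def\<close>)
qed

text \<open>A labelling of \<open>v\<close> and the standard labelling of the sorted sequence have
  the same variables as targets; composing one with the inverse of the other gives
  \<open>s\<close>.\<close>

lemma exists_standardization:
  fixes vs :: "'i::finite list"
  assumes vs: "distinct vs" "set vs = UNIV"
  obtains s where "s permutes {..<p}" "num_vars (content p v) = p"
    "\<And>k. k < p \<Longrightarrow> (v \<circ> s) k = vertex_at vs (content p v) k"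
proof -
  let ?d = "content p v"
  let ?P = "(!) (positions vs ?d)"
  obtain \<beta> where \<beta>: "bij_betw \<beta> {..<p} (vars ?d)" "\<And>k. k < p \<Longrightarrow> fst (\<beta> k) = v k"
    using labelling_exists[of p v] unfolding labelling_def by blast
  have n: "num_vars ?d = p" using bij_betw_same_card[OF \<beta>(1)] by (simp add: card_vars)
  have P: "bij_betw ?P {..<p} (vars ?d)" using bij_betw_positions[OF vs, of ?d] by (simp add: n)
  define s where "s k = (if k < p then inv_into {..<p} \<beta> (?P k) else k)" for k
  have "bij_betw (inv_into {..<p} \<beta> \<circ> ?P) {..<p} {..<p}"
    by (rule bij_betw_trans[OF P bij_betw_inv_into[OF \<beta>(1)]])
  hence "bij_betw s {..<p} {..<p}" by (rule bij_betw_cong[THEN iffD1, rotated]) (simp add: s_def)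
  hence s: "s permutes {..<p}" by (rule bij_imp_permutes) (simp add: s_def)
  have "(v \<circ> s) k = vertex_at vs ?d k" if k: "k < p" for k
  proof -
    have "?P k \<in> vars ?d" by (rule bij_betw_apply[OF P]) (use k in simp)
    hence "\<beta> (s k) = ?P k" using bij_betw_inv_into_right[OF \<beta>(1)] k by (simp add: s_def)
    moreover have "s k < p" using permutes_in_image[OF s, of k] k by simp
    ultimately show ?thesis using \<beta>(2)[of "s k"] by (simp add: vertex_at_def)
  qed
  thus ?thesis using that s n by blast
qed

lemma functionals_combination:
  assumes "\<xi> \<in> functionals Q" "\<eta> \<in> functionals Q"
  shows "(\<lambda>X. a * \<xi> X + b * \<eta> X) \<in> functionals Q"
  using assms unfolding functionals_def by (simp add: algebra_simps)

lemma dual_support_combination: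
  "dual_support Q (\<lambda>X. a * \<xi> X + b * \<eta> X) \<subseteq> dual_support Q \<xi> \<union> dual_support Q \<eta>"
  unfolding dual_support_def by force

lemma graded_dual_combination:
  assumes "\<xi> \<in> graded_dual Q" "\<eta> \<in> graded_dual Q"
  shows "(\<lambda>X. a * \<xi> X + b * \<eta> X) \<in> graded_dual Q"
  using assms functionals_combination[of \<xi> Q \<eta>] finite_subset[OF dual_support_combination]
  unfolding graded_dual_def by blast

lemma F_series_combination:
  assumes "\<xi> \<in> functionals Q" "\<eta> \<in> functionals Q"
  shows "F_series Q vs d (\<lambda>X. a * \<xi> X + b * \<eta> X) = (\<lambda>e. a * F_series Q vs d \<xi> e + b * F_series Q vs d \<eta> e)"
proof -
  let ?c = "\<lambda>\<xi>. corr (correlator_of Q \<xi>) (num_vars d) (vertex_at vs d)"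
  have "?c (\<lambda>X. a * \<xi> X + b * \<eta> X) = (\<lambda>e. a * ?c \<xi> e + b * ?c \<eta> e)"
    by (auto simp: corr_def correlator_of_def fun_eq_iff)
  thus ?thesis
    unfolding F_series_eq[OF assms(1)] F_series_eq[OF assms(2)] F_series_eq[OF functionals_combination[OF assms]] F_corr_def
    using dmul_list_linear[OF corr_laurent[OF correlator_correlator_of[OF assms(1)]] corr_laurent[OF correlator_correlator_of[OF assms(2)]]]
    by (simp add: set_pair_list)
qed

lemma sym_polys_combination:
  assumes "f \<in> sym_polys d" "g \<in> sym_polys d"
  shows "scale a f + scale b g \<in> sym_polys d"
proof -
  have "keys (scale a f + scale b g) \<subseteq> keys f \<union> keys g" by (auto simp: in_keys_iff lookup_add)
  hence "\<forall>m\<in>keys (scale a f + scale b g). keys m \<subseteq> vars d"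
    using assms unfolding sym_polys_def by blast
  thus ?thesis using assms unfolding sym_polys_def by (simp add: lookup_add)
qed

lemma poly_series_combination:
  "poly_series vs d (scale a f + scale b g) = (\<lambda>e. a * poly_series vs d f e + b * poly_series vs d g e)"
  by (auto simp: poly_series_def lookup_add fun_eq_iff)

lemma zero_sym_polys: "0 \<in> sym_polys d"
  by (simp add: sym_polys_def)

section \<open>The map from the graded dual and its inverse\<close>

abbreviation self_euler :: "('i::finite, 'a) pre_digraph \<Rightarrow> ('i \<Rightarrow> nat) \<Rightarrow> int" where
  "self_euler Q d \<equiv> euler Q (\<lambda>i. int (d i)) (\<lambda>i. int (d i))"

text \<open>Such a polynomial exists when \<xi> lies in \<open>graded_dual Q\<close>, and it is
  unique by \<open>sym_polys_eqI\<close>.\<close>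

definition coha_poly ::
  "('i::finite, 'a) pre_digraph \<Rightarrow> 'i list \<Rightarrow> ('i \<Rightarrow> nat) \<Rightarrow> ('i tensor_alg set \<Rightarrow> rat) \<Rightarrow> 'i xpoly" where
  "coha_poly Q vs d \<xi> = (SOME f. f \<in> sym_polys d \<and> poly_series vs d f = F_series Q vs d \<xi>)"

lemma coha_poly_unique:
  fixes vs :: "'i::finite list"
  assumes vs: "distinct vs" "set vs = UNIV"
    and f: "f \<in> sym_polys d" "poly_series vs d f = F_series Q vs d \<xi>"
  shows "coha_poly Q vs d \<xi> = f"
proof -
  have "coha_poly Q vs d \<xi> \<in> sym_polys d \<and> poly_series vs d (coha_poly Q vs d \<xi>) = F_series Q vs d \<xi>"
    unfolding coha_poly_def by (rule someI[of _ f]) (simp add: f)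
  thus ?thesis using sym_polys_eqI[OF vs _ f(1)] f(2) by simp
qed

lemma coha_poly:
  fixes Q :: "('i::finite, 'a) pre_digraph"
  assumes Q: "symmetric_quiver Q" and vs: "distinct vs" "set vs = UNIV" and \<xi>: "\<xi> \<in> graded_dual Q"
  shows "coha_poly Q vs d \<xi> \<in> sym_polys d"
    and "poly_series vs d (coha_poly Q vs d \<xi>) = F_series Q vs d \<xi>"
    and "m \<in> keys (coha_poly Q vs d \<xi>) \<Longrightarrow> (d, self_euler Q d + 2 * int (mono_degree m)) \<in> dual_support Q \<xi>"
proof -
  let ?p = "num_vars d" and ?v = "vertex_at vs d" and ?\<theta> = "correlator_of Q \<xi>"
  let ?G = "F_series Q vs d \<xi>"
  have fn: "\<xi> \<in> functionals Q" and fin: "finite (dual_support Q \<xi>)" using \<xi> by (auto simp: graded_dual_def)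
  have \<theta>: "correlator Q ?\<theta>" by (rule correlator_correlator_of[OF fn])
  have G: "?G = F_corr Q ?\<theta> ?p ?v" by (rule F_series_eq[OF fn])
  have dsup: "(d, self_euler Q d + 2 * exp_sum ?p e) \<in> dual_support Q \<xi>" if "?G e \<noteq> 0" for e
    using F_corr_support[OF Q, of \<xi> ?p ?v e] that unfolding G content_vertex_at[OF vs] by blast
  have supp: "keys e \<subseteq> {..<?p} \<and> (\<forall>k. 0 \<le> lookup e k)" if ne: "?G e \<noteq> 0" for e
  proof -
    have k: "keys e \<subseteq> {..<?p}" using laurent_keys[OF F_corr_laurent[OF \<theta>]] ne unfolding G by blast
    have "0 \<le> lookup e k" for k
    proof (cases "k < ?p")
      case True
      thus ?thesis using F_corr_nonneg[OF Q \<theta> True] ne unfolding G by blast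
    next
      case False
      hence "k \<notin> keys e" using k by auto
      thus ?thesis by (simp add: in_keys_iff)
    qed
    thus ?thesis using k by blast
  qed
  \<comment> \<open>The total degree of a term is recovered from its place in the finite dual
    support; the division by 2 is exact there.\<close>
  have "exp_sum ?p ` {e. ?G e \<noteq> 0} \<subseteq> (\<lambda>x. (snd x - self_euler Q d) div 2) ` dual_support Q \<xi>"
  proof
    fix t assume "t \<in> exp_sum ?p ` {e. ?G e \<noteq> 0}"
    then obtain e where "?G e \<noteq> 0" "t = exp_sum ?p e" by blast
    thus "t \<in> (\<lambda>x. (snd x - self_euler Q d) div 2) ` dual_support Q \<xi>"
      using dsup by (intro image_eqI[of _ _ "(d, self_euler Q d + 2 * exp_sum ?p e)"]) simp_all
  qed
  hence fint: "finite (exp_sum ?p ` {e. ?G e \<noteq> 0})" using fin finite_surj by blast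
  have sym: "?G (permute_exps s e) = ?G e" if "s permutes {..<?p}" "?v \<circ> s = ?v" for s e
    using F_corr_permutes[OF Q \<theta> that(1), of ?v e] unfolding G that(2) .
  obtain f where f: "f \<in> sym_polys d" "poly_series vs d f = ?G"
    "\<And>m. m \<in> keys f \<Longrightarrow> \<exists>e. ?G e \<noteq> 0 \<and> int (mono_degree m) = exp_sum ?p e"
    using exists_poly_series[OF vs supp fint sym] by blast
  have c: "coha_poly Q vs d \<xi> = f" by (rule coha_poly_unique[OF vs f(1,2)])
  show "coha_poly Q vs d \<xi> \<in> sym_polys d" "poly_series vs d (coha_poly Q vs d \<xi>) = F_series Q vs d \<xi>"
    using f c by simp_all
  show "(d, self_euler Q d + 2 * int (mono_degree m)) \<in> dual_support Q \<xi>" if "m \<in> keys (coha_poly Q vs d \<xi>)"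
    using f(3)[of m] that dsup unfolding c by fastforce
qed

definition coha_map ::
  "('i::finite, 'a) pre_digraph \<Rightarrow> 'i list \<Rightarrow> ('i tensor_alg set \<Rightarrow> rat) \<Rightarrow> 'i coha" where
  "coha_map Q vs \<xi> = Abs_poly_mapping (\<lambda>d. coha_poly Q vs d \<xi>)"

text \<open>Each \<open>d\<close> with a non-zero polynomial occurs in the finite dual support, so
  \<open>Abs_poly_mapping\<close> is applied to a finitely supported function.\<close>

lemma lookup_coha_map:
  fixes Q :: "('i::finite, 'a) pre_digraph"
  assumes Q: "symmetric_quiver Q" and vs: "distinct vs" "set vs = UNIV" and \<xi>: "\<xi> \<in> graded_dual Q"
  shows "lookup (coha_map Q vs \<xi>) d = coha_poly Q vs d \<xi>"
proof -
  have "{d. coha_poly Q vs d \<xi> \<noteq> 0} \<subseteq> fst ` dual_support Q \<xi>"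
  proof
    fix d assume "d \<in> {d. coha_poly Q vs d \<xi> \<noteq> 0}"
    hence "keys (coha_poly Q vs d \<xi>) \<noteq> {}" by simp
    then obtain m where "m \<in> keys (coha_poly Q vs d \<xi>)" by blast
    from coha_poly(3)[OF Q vs \<xi> this] show "d \<in> fst ` dual_support Q \<xi>" by force
  qed
  hence "finite {d. coha_poly Q vs d \<xi> \<noteq> 0}"
    using \<xi> finite_surj unfolding graded_dual_def by blast
  thus ?thesis by (simp add: coha_map_def)
qed

lemma coha_poly_combination:
  fixes Q :: "('i::finite, 'a) pre_digraph"
  assumes Q: "symmetric_quiver Q" and vs: "distinct vs" "set vs = UNIV"
    and \<xi>: "\<xi> \<in> graded_dual Q" and \<eta>: "\<eta> \<in> graded_dual Q"
  shows "coha_poly Q vs d (\<lambda>X. a * \<xi> X + b * \<eta> X) = scale a (coha_poly Q vs d \<xi>) + scale b (coha_poly Q vs d \<eta>)"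
proof (rule coha_poly_unique[OF vs])
  show "scale a (coha_poly Q vs d \<xi>) + scale b (coha_poly Q vs d \<eta>) \<in> sym_polys d"
    by (rule sym_polys_combination[OF coha_poly(1)[OF Q vs \<xi>] coha_poly(1)[OF Q vs \<eta>]])
  have "\<xi> \<in> functionals Q" "\<eta> \<in> functionals Q" using \<xi> \<eta> by (auto simp: graded_dual_def)
  thus "poly_series vs d (scale a (coha_poly Q vs d \<xi>) + scale b (coha_poly Q vs d \<eta>)) =
      F_series Q vs d (\<lambda>X. a * \<xi> X + b * \<eta> X)"
    by (simp add: poly_series_combination F_series_combination coha_poly(2)[OF Q vs \<xi>] coha_poly(2)[OF Q vs \<eta>])
qed

text \<open>\<open>F_series\<close> sees sorted vertex sequences only. Permutation invariance
  carries the vanishing over to all sequences, and inverting the product of differences carries it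
  back to the correlations.\<close>

lemma functional_eq_zero:
  fixes Q :: "('i::finite, 'a) pre_digraph"
  assumes Q: "symmetric_quiver Q" and vs: "distinct vs" "set vs = UNIV"
    and \<xi>: "\<xi> \<in> functionals Q" and z: "\<And>d. F_series Q vs d \<xi> = (\<lambda>e. 0)"
  shows "\<xi> = (\<lambda>X. 0)"
proof (rule functional_eqI[OF \<xi>])
  show z': "(\<lambda>X. 0) \<in> functionals Q" by (simp add: functionals_def)
  let ?\<theta> = "correlator_of Q \<xi>"
  have \<theta>: "correlator Q ?\<theta>" by (rule correlator_correlator_of[OF \<xi>])
  have "?\<theta> ws = 0" for ws
  proof -
    define p where "p = length ws"
    define v where "v = (\<lambda>k. fst (ws ! k))"
    obtain s where s: "s permutes {..<p}" "num_vars (content p v) = p"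
      "\<And>k. k < p \<Longrightarrow> (v \<circ> s) k = vertex_at vs (content p v) k"
      using exists_standardization[OF vs] by blast
    have "F_corr Q ?\<theta> p (v \<circ> s) = F_corr Q ?\<theta> p (vertex_at vs (content p v))" by (rule F_corr_cong[OF s(3)])
    also have "\<dots> = (\<lambda>e. 0)" using F_series_eq[OF \<xi>, of vs "content p v"] z[of "content p v"] by (simp add: s(2))
    finally have "F_corr Q ?\<theta> p v e = 0" for e using F_corr_permutes[OF Q \<theta> s(1), of v e] by simp
    hence "corr ?\<theta> p v = (\<lambda>e. 0)" by (intro F_corr_eq_0D[OF \<theta>] ext)
    thus ?thesis using corr_word[of ?\<theta> ws] by (simp add: p_def v_def)
  qed
  thus "?\<theta> = correlator_of Q (\<lambda>X. 0)" by (simp add: fun_eq_iff correlator_of_def)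
qed

lemma coha_map_inj:
  fixes Q :: "('i::finite, 'a) pre_digraph"
  assumes Q: "symmetric_quiver Q" and vs: "distinct vs" "set vs = UNIV"
    and \<xi>: "\<xi> \<in> graded_dual Q" and \<eta>: "\<eta> \<in> graded_dual Q" and eq: "coha_map Q vs \<xi> = coha_map Q vs \<eta>"
  shows "\<xi> = \<eta>"
proof -
  let ?\<zeta> = "\<lambda>X. 1 * \<xi> X + (-1) * \<eta> X"
  have \<zeta>: "?\<zeta> \<in> graded_dual Q" by (rule graded_dual_combination[OF \<xi> \<eta>])
  have "coha_poly Q vs d \<xi> = coha_poly Q vs d \<eta>" for d
    using eq lookup_coha_map[OF Q vs \<xi>] lookup_coha_map[OF Q vs \<eta>] by metis
  hence "coha_poly Q vs d ?\<zeta> = 0" for d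
    unfolding coha_poly_combination[OF Q vs \<xi> \<eta>] by (simp add: scale_minus_one)
  hence "F_series Q vs d ?\<zeta> = poly_series vs d 0" for d
    using coha_poly(2)[OF Q vs \<zeta>, of d] by (simp only:)
  hence "F_series Q vs d ?\<zeta> = (\<lambda>e. 0)" for d by (simp only:) (simp add: poly_series_def fun_eq_iff)
  hence "?\<zeta> = (\<lambda>X. 0)"
    using \<zeta> by (intro functional_eq_zero[OF Q vs]) (auto simp: graded_dual_def)
  thus ?thesis by (simp add: fun_eq_iff)
qed

text \<open>The last conclusion controls the dual support: inside the proof it yields finiteness,
  later it locates the preimages of homogeneous elements.\<close>

lemma coha_map_surj:
  fixes Q :: "('i::finite, 'a) pre_digraph"
  assumes Q: "symmetric_quiver Q" and vs: "distinct vs" "set vs = UNIV" and h: "h \<in> coha"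
  obtains \<xi> where "\<xi> \<in> graded_dual Q" "coha_map Q vs \<xi> = h"
    "\<And>d n. (d, n) \<in> dual_support Q \<xi> \<Longrightarrow>
       \<exists>m\<in>keys (lookup h d). n = self_euler Q d + 2 * int (mono_degree m)"
proof -
  let ?H = "lookup h"
  have H: "?H d \<in> sym_polys d" for d using h by (simp add: coha_def)
  define \<theta> where "\<theta> = correlator_of_family Q ?H"
  define \<xi> where "\<xi> = functional_of Q \<theta>"
  have \<theta>: "correlator Q \<theta>" unfolding \<theta>_def by (rule correlator_correlator_of_family[OF Q H])
  have fn: "\<xi> \<in> functionals Q" unfolding \<xi>_def by (rule functional_of_functionals[OF Q \<theta>])
  have supp: "\<exists>m\<in>keys (?H d). n = self_euler Q d + 2 * int (mono_degree m)" if dn: "(d, n) \<in> dual_support Q \<xi>" for d n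
  proof -
    obtain u where u: "\<And>w. w \<in> keys u \<Longrightarrow> word_degree w = (\<lambda>i. int (d i)) \<and> of_int (- n) = - 2 * word_weight Q w"
      and ne: "\<xi> (pcls Q u) \<noteq> 0"
      using dn unfolding dual_support_def principal_comp_def by auto
    have u': "\<And>w. w \<in> keys u \<Longrightarrow> word_degree w = (\<lambda>i. int (d i)) \<and> word_weight Q w = of_int n / 2"
      using u by fastforce
    obtain ws where ws: "\<theta> ws \<noteq> 0" "word_degree (Word (map Gen ws)) = (\<lambda>i. int (d i))"
      "word_weight Q (Word (map Gen ws)) = of_int n / 2"
      using functional_of_homogeneous[OF Q \<theta> u' ne[unfolded \<xi>_def]] by blast
    define p where "p = length ws"
    define v where "v k = fst (ws ! k)" for k
    have d: "content p v = d" using ws(2) unfolding word_degree_gen p_def v_def by (simp add: fun_eq_iff)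
    have "of_int n = (of_int ((\<Sum>k<p. euler Q (basis_vec (v k)) (basis_vec (v k))) + 2 * exp_sum p (exps_of ws)) :: rat)"
      using word_weight_gen[of Q ws] ws(3) by (simp add: p_def v_def)
    hence n: "n = (\<Sum>k<p. euler Q (basis_vec (v k)) (basis_vec (v k))) + 2 * exp_sum p (exps_of ws)"
      by (simp only: of_int_eq_iff)
    have ne': "dmul_list (pair_list p) (\<lambda>x. - loc_weight Q v x) (poly_family ?H p v) (exps_of ws) \<noteq> 0"
      using ws(1) unfolding \<theta>_def correlator_of_family_def quotient_series_def p_def v_def .
    obtain e where e: "poly_family ?H p v e \<noteq> 0"
      "exp_sum p (exps_of ws) = exp_sum p e + sum_list (map (\<lambda>x. - loc_weight Q v x) (pair_list p))"
      using dmul_list_exp_sum[OF _ ne', of p] unfolding set_pair_list by blast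
    obtain \<beta> where \<beta>: "labelling p v \<beta>" using labelling_exists by blast
    have pos: "\<forall>k. 0 \<le> lookup e k" and m: "monom_of \<beta> p e \<in> keys (?H d)"
      using e(1) poly_family_labelling[of ?H, OF H \<beta>, of e] by (auto simp: d in_keys_iff split: if_splits)
    have "sum_list (map (\<lambda>x. - loc_weight Q v x) (pair_list p)) = - sum_list (map (loc_weight Q v) (pair_list p))"
      by (induction "pair_list p") (simp_all add: uminus_sum_list_map comp_def)
    hence "n = self_euler Q d + 2 * exp_sum p e"
      using n e(2) euler_content[OF Q, of p v] by (simp add: d)
    moreover have "int (mono_degree (monom_of \<beta> p e)) = exp_sum p e"
      by (rule mono_degree_monom_of) (use pos in simp)
    ultimately show ?thesis using m by (intro bexI[of _ "monom_of \<beta> p e"]) simp_all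
  qed
  have "dual_support Q \<xi> \<subseteq> (\<Union>d\<in>keys h. (\<lambda>m. (d, self_euler Q d + 2 * int (mono_degree m))) ` keys (?H d))"
  proof
    fix x assume x: "x \<in> dual_support Q \<xi>"
    obtain d n where dn: "x = (d, n)" by fastforce
    obtain m where m: "m \<in> keys (?H d)" "n = self_euler Q d + 2 * int (mono_degree m)"
      using supp x unfolding dn by blast
    have "d \<in> keys h" using m(1) by (auto simp: in_keys_iff)
    thus "x \<in> (\<Union>d\<in>keys h. (\<lambda>m. (d, self_euler Q d + 2 * int (mono_degree m))) ` keys (?H d))"
      using m dn by blast
  qed
  hence "finite (dual_support Q \<xi>)" by (rule finite_subset) simp
  hence gd: "\<xi> \<in> graded_dual Q" using fn by (simp add: graded_dual_def)
  have "coha_map Q vs \<xi> = h"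
  proof (rule poly_mapping_eqI)
    fix d
    have "correlator_of Q \<xi> = correlator_of_family Q ?H"
      unfolding \<xi>_def correlator_of_functional_of[OF Q \<theta>] by (rule \<theta>_def)
    hence "F_series Q vs d \<xi> = F_corr Q (correlator_of_family Q ?H) (num_vars d) (vertex_at vs d)"
      unfolding F_series_eq[OF fn] by (simp only:)
    also have "\<dots> = poly_series vs d (?H d)"
      unfolding F_corr_correlator_of_family by (rule poly_family_standard[OF vs H])
    finally have "F_series Q vs d \<xi> = poly_series vs d (?H d)" .
    hence "coha_poly Q vs d \<xi> = ?H d" by (intro coha_poly_unique[OF vs H]) simp
    thus "lookup (coha_map Q vs \<xi>) d = lookup h d" by (simp add: lookup_coha_map[OF Q vs gd])
  qed
  thus ?thesis using that gd supp by blast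
qed

lemma lookup_coha_scale: "lookup (coha_scale c h) d = scale c (lookup h d)"
  by (simp add: coha_scale_def map.rep_eq when_def)

lemma single_coha: "f \<in> sym_polys d \<Longrightarrow> single d f \<in> coha"
  by (simp add: coha_def lookup_single_if zero_sym_polys)

lemma coha_map_single:
  fixes Q :: "('i::finite, 'a) pre_digraph"
  assumes Q: "symmetric_quiver Q" and vs: "distinct vs" "set vs = UNIV" and \<xi>: "\<xi> \<in> graded_dual Q"
    and sub: "dual_support Q \<xi> \<subseteq> {d} \<times> UNIV"
  shows "coha_map Q vs \<xi> = single d (coha_poly Q vs d \<xi>)"
proof (rule poly_mapping_eqI)
  fix d'
  have "coha_poly Q vs d' \<xi> = 0" if "d' \<noteq> d"
  proof (rule ccontr)
    assume "coha_poly Q vs d' \<xi> \<noteq> 0"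
    hence "keys (coha_poly Q vs d' \<xi>) \<noteq> {}" by simp
    then obtain m where "m \<in> keys (coha_poly Q vs d' \<xi>)" by blast
    from coha_poly(3)[OF Q vs \<xi> this] show False using sub that by blast
  qed
  thus "lookup (coha_map Q vs \<xi>) d' = lookup (single d (coha_poly Q vs d \<xi>)) d'"
    by (simp add: lookup_coha_map[OF Q vs \<xi>] lookup_single_if)
qed

text \<open>Degrees are preserved in one direction by the support statement of
  \<open>coha_poly\<close>, in the other by that of \<open>coha_map_surj\<close>.\<close>

lemma graded_iso_coha_map:
  fixes Q :: "('i::finite, 'a) pre_digraph"
  assumes Q: "symmetric_quiver Q" and vs: "distinct vs" "set vs = UNIV"
  shows "graded_iso Q (coha_map Q vs)"
  unfolding graded_iso_def
proof (intro conjI ballI allI)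
  note lk = lookup_coha_map[OF Q vs]
  fix \<xi> assume \<xi>: "\<xi> \<in> graded_dual Q"
  show "coha_map Q vs (\<lambda>X. \<xi> X + \<eta> X) = coha_map Q vs \<xi> + coha_map Q vs \<eta>" if \<eta>: "\<eta> \<in> graded_dual Q" for \<eta>
    using coha_poly_combination[OF Q vs \<xi> \<eta>, of _ 1 1] lk[OF graded_dual_combination[OF \<xi> \<eta>, of 1 1]]
    by (intro poly_mapping_eqI) (simp add: lookup_add lk[OF \<xi>] lk[OF \<eta>])
  show "coha_map Q vs (\<lambda>X. c * \<xi> X) = coha_scale c (coha_map Q vs \<xi>)" for c
    using coha_poly_combination[OF Q vs \<xi> \<xi>, of _ c 0] lk[OF graded_dual_combination[OF \<xi> \<xi>, of c 0]]
    by (intro poly_mapping_eqI) (simp add: lookup_coha_scale lk[OF \<xi>])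
next
  show "bij_betw (coha_map Q vs) (graded_dual Q) coha"
  proof (rule bij_betw_imageI)
    show "inj_on (coha_map Q vs) (graded_dual Q)"
      by (rule inj_onI) (rule coha_map_inj[OF Q vs])
    show "coha_map Q vs ` graded_dual Q = coha"
    proof (intro equalityI subsetI)
      fix h assume "h \<in> coha_map Q vs ` graded_dual Q"
      thus "h \<in> coha" by (auto simp: coha_def lookup_coha_map[OF Q vs] coha_poly(1)[OF Q vs])
    next
      fix h :: "'i coha" assume "h \<in> coha"
      then obtain \<xi> where "\<xi> \<in> graded_dual Q" "coha_map Q vs \<xi> = h" using coha_map_surj[OF Q vs] by blast
      thus "h \<in> coha_map Q vs ` graded_dual Q" by blast
    qed
  qed
next
  fix d n
  show "coha_map Q vs ` dual_comp Q d n = single d ` coha_comp Q d n"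
  proof (intro equalityI subsetI)
    fix h assume "h \<in> coha_map Q vs ` dual_comp Q d n"
    then obtain \<xi> where \<xi>: "\<xi> \<in> graded_dual Q" "dual_support Q \<xi> \<subseteq> {(d, n)}" "h = coha_map Q vs \<xi>"
      by (auto simp: dual_comp_def)
    have "h = single d (coha_poly Q vs d \<xi>)"
      unfolding \<xi>(3) by (rule coha_map_single[OF Q vs \<xi>(1)]) (use \<xi>(2) in blast)
    moreover have "coha_poly Q vs d \<xi> \<in> coha_comp Q d n"
      using coha_poly(1)[OF Q vs \<xi>(1)] coha_poly(3)[OF Q vs \<xi>(1), of _ d] \<xi>(2) by (fastforce simp: coha_comp_def)
    ultimately show "h \<in> single d ` coha_comp Q d n" by blast
  next
    fix h assume "h \<in> single d ` coha_comp Q d n"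
    then obtain f where f: "f \<in> sym_polys d" "h = single d f"
      "\<And>m. m \<in> keys f \<Longrightarrow> 2 * int (mono_degree m) = n - self_euler Q d"
      by (auto simp: coha_comp_def)
    obtain \<xi> where \<xi>: "\<xi> \<in> graded_dual Q" "coha_map Q vs \<xi> = h"
      "\<And>d n. (d, n) \<in> dual_support Q \<xi> \<Longrightarrow> \<exists>m\<in>keys (lookup h d). n = self_euler Q d + 2 * int (mono_degree m)"
      using coha_map_surj[OF Q vs single_coha[OF f(1)]] unfolding f(2) by blast
    have "dual_support Q \<xi> \<subseteq> {(d, n)}"
    proof
      fix x assume x: "x \<in> dual_support Q \<xi>"
      obtain d' n' where dn: "x = (d', n')" by fastforce
      obtain m where m: "m \<in> keys (lookup h d')" "n' = self_euler Q d' + 2 * int (mono_degree m)"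
        using \<xi>(3) x unfolding dn by blast
      hence "d' = d" "m \<in> keys f" by (auto simp: f(2) lookup_single_if split: if_splits)
      thus "x \<in> {(d, n)}" using m(2) f(3) by (simp add: dn)
    qed
    hence "\<xi> \<in> dual_comp Q d n" using \<xi>(1) by (simp add: dual_comp_def)
    thus "h \<in> coha_map Q vs ` dual_comp Q d n" using \<xi>(2) by blast
  qed
qed

theorem proposition5p3:
  fixes Q :: "('i::finite, 'a) pre_digraph" and vs :: "'i list"
  assumes "symmetric_quiver Q"
    and "distinct vs" and "set vs = UNIV"
  shows "\<exists>F. graded_iso Q F \<and>
    (\<forall>d. bij_betw (\<lambda>\<xi>. lookup (F \<xi>) d) (dual_at Q d) (sym_polys d) \<and>
      (\<forall>\<xi>\<in>dual_at Q d.
         F \<xi> = single d (lookup (F \<xi>) d) \<and>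
         correlation Q vs d \<xi> \<in> iter_laurent (num_vars d) \<and>
         poly_series vs d (lookup (F \<xi>) d) = F_series Q vs d \<xi>))"
proof (intro exI[of _ "coha_map Q vs"] conjI allI ballI)
  note lk = lookup_coha_map[OF assms]
  show "graded_iso Q (coha_map Q vs)" by (rule graded_iso_coha_map[OF assms])
  fix d
  have single: "coha_map Q vs \<xi> = single d (coha_poly Q vs d \<xi>)" if "\<xi> \<in> dual_at Q d" for \<xi>
    using that by (intro coha_map_single[OF assms]) (auto simp: dual_at_def)
  show "bij_betw (\<lambda>\<xi>. lookup (coha_map Q vs \<xi>) d) (dual_at Q d) (sym_polys d)"
  proof (rule bij_betw_imageI)
    show "inj_on (\<lambda>\<xi>. lookup (coha_map Q vs \<xi>) d) (dual_at Q d)"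
    proof (rule inj_onI)
      fix \<xi> \<eta> assume h: "\<xi> \<in> dual_at Q d" "\<eta> \<in> dual_at Q d"
        "lookup (coha_map Q vs \<xi>) d = lookup (coha_map Q vs \<eta>) d"
      hence gd: "\<xi> \<in> graded_dual Q" "\<eta> \<in> graded_dual Q" by (auto simp: dual_at_def)
      have "coha_map Q vs \<xi> = coha_map Q vs \<eta>"
        unfolding single[OF h(1)] single[OF h(2)] using h(3) by (simp add: lk[OF gd(1)] lk[OF gd(2)])
      thus "\<xi> = \<eta>" by (rule coha_map_inj[OF assms gd])
    qed
    show "(\<lambda>\<xi>. lookup (coha_map Q vs \<xi>) d) ` dual_at Q d = sym_polys d"
    proof (intro equalityI subsetI)
      fix f assume "f \<in> (\<lambda>\<xi>. lookup (coha_map Q vs \<xi>) d) ` dual_at Q d"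
      thus "f \<in> sym_polys d" by (auto simp: dual_at_def lk coha_poly(1)[OF assms])
    next
      fix f :: "'i xpoly" assume f: "f \<in> sym_polys d"
      obtain \<xi> where \<xi>: "\<xi> \<in> graded_dual Q" "coha_map Q vs \<xi> = single d f"
        "\<And>d' n. (d', n) \<in> dual_support Q \<xi> \<Longrightarrow> \<exists>m\<in>keys (lookup (single d f) d'). n = self_euler Q d' + 2 * int (mono_degree m)"
        using coha_map_surj[OF assms single_coha[OF f]] by blast
      \<comment> \<open>The element \<open>single d f\<close> has no component besides the one at
        \<open>d\<close>, so its preimage is supported over \<open>d\<close>.\<close>
      have "d' = d" if "(d', n) \<in> dual_support Q \<xi>" for d' n
        using \<xi>(3)[OF that] by (auto simp: lookup_single_if split: if_splits)
      hence "\<xi> \<in> dual_at Q d" using \<xi>(1) by (auto simp: dual_at_def)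
      thus "f \<in> (\<lambda>\<xi>. lookup (coha_map Q vs \<xi>) d) ` dual_at Q d"
        by (intro image_eqI[of _ _ \<xi>]) (simp_all add: \<xi>(2))
    qed
  qed
  fix \<xi> assume \<xi>: "\<xi> \<in> dual_at Q d"
  hence gd: "\<xi> \<in> graded_dual Q" and fn: "\<xi> \<in> functionals Q" by (auto simp: dual_at_def graded_dual_def)
  show "coha_map Q vs \<xi> = single d (lookup (coha_map Q vs \<xi>) d)"
    unfolding lk[OF gd] by (rule single[OF \<xi>])
  show "correlation Q vs d \<xi> \<in> iter_laurent (num_vars d)"
    unfolding correlation_eq
    using corr_laurent[OF correlator_correlator_of[OF fn]] laurent_subset_iter_laurent by blast
  show "poly_series vs d (lookup (coha_map Q vs \<xi>) d) = F_series Q vs d \<xi>"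
    unfolding lk[OF gd] by (rule coha_poly(2)[OF assms gd])
qed

end
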